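(* Let $d\geq 1$ and let $\psi:\mathbb{R}^d\to[0,1]$ be a measurable symmetric connection function with support contained in the closed unit ball. Then $\tilde\lambda_c=\lambda_c$, and moreover: (I) for every $\lambda<\lambda_c$ there exists $c>0$ such that for all $t>0$, $\theta_t(\lambda,\psi)\leq e^{-ct}$; (II) for every $\lambda>\lambda_c$, $\theta(\lambda,\psi)\geq\frac{\lambda-\lambda_c}{\lambda}$.
   Context: RCM: $\mathcal P_\lambda$ is a homogeneous Poisson point process of intensity $\lambda$ on $\mathbb{R}^d$; each pair of distinct points $x,y$ is joined by an edge independently with probability $\psi(x-y)$ (via independent uniform marks $U_{\{x,y\}}$, edge iff $U_{\{x,y\}}\le\psi(x-y)$). For a (random) point set $A$ and added points, $\xi[A]$ denotes the RCM graph on $A$ using these marks (added points receive fresh independent marks for their edges). $\xi_\lambda^o=\xi[\mathcal P_\lambda\cup\{o\}]$ with $o$ the origin. $\Lambda_t=[-t/2,t/2]^d$. $\theta_t(\lambda,\psi)=\mathbb{P}[o\leftrightarrow\Lambda_t^c\text{ in }\xi_\lambda^o]$ (the origin is joined by a finite path to a point of $\mathcal P_\lambda$ outside $\Lambda_t$), $\theta(\lambda,\psi)=\lim_{t\to\infty}\theta_t(\lambda,\psi)$, and $\lambda_c=\inf\{\lambda:\theta(\lambda)>0\}$. A thinning function is a measurable $f:\mathbb{R}^d\to[0,1]$ with bounded support; $\mathcal T$ is the set of thinning functions. The $f$-thinning $f_*\mathcal P_\lambda$ retains each point $x\in\mathcal P_\lambda$ independently with probability $f(x)$ (using independent uniform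 marks $U_x$: keep $x$ iff $U_x\le f(x)$). Define $$\varphi_\lambda(f)=\lambda\int_{\mathbb{R}^d}(1-f(y))\,\mathbb{P}\big[o\leftrightarrow y\text{ in }\xi[f_*\mathcal P_\lambda\cup\{o,y\}]\big]\,dy,$$ and $\tilde\lambda_c=\sup\{\lambda:\exists f\in\mathcal T\text{ with }\varphi_\lambda(f)<1\}$. *)

theory Defs
  imports "HOL-Probability.Probability"
begin

text \<open>Random connection model on real^'d, built from a countable product of
independent ingredients: Poisson(lambda) counts in the unit cubes [k,k+1)^d
(k in Z^d), i.i.d. uniform positions in each cube, i.i.d. uniform edge marks
indexed by (unordered) pairs of vertex labels, and i.i.d. uniform thinning marks
per vertex label.  The label Orig is the origin o, Extra is the added point y.\<close>

datatype 'd vtx = Orig | Extra | Pt "int ^ 'd" nat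

definition unit_cube :: "int ^ 'd \<Rightarrow> (real ^ 'd) set" where
  "unit_cube k = cbox (\<chi> i. real_of_int (k $ i)) (\<chi> i. real_of_int (k $ i) + 1)"

type_synonym 'd sample =
  "(int ^ 'd \<Rightarrow> nat) \<times> (((int ^ 'd) \<times> nat \<Rightarrow> real ^ 'd) \<times> ('d vtx set \<Rightarrow> real) \<times> ('d vtx \<Rightarrow> real))"

definition RCM_space :: "real \<Rightarrow> ('d::finite) sample measure" where
  "RCM_space lam =
     (PiM UNIV (\<lambda>k::int ^ 'd. measure_pmf (poisson_pmf lam)))
     \<Otimes>\<^sub>M ((PiM UNIV (\<lambda>ki::(int ^ 'd) \<times> nat. uniform_measure lborel (unit_cube (fst ki))))
     \<Otimes>\<^sub>M ((PiM UNIV (\<lambda>e::'d vtx set. uniform_measure lborel {0..1::real}))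
     \<Otimes>\<^sub>M (PiM UNIV (\<lambda>v::'d vtx. uniform_measure lborel {0..1::real}))))"

definition Pts :: "('d::finite) sample \<Rightarrow> 'd vtx set" where
  "Pts \<omega> = {Pt k i | k i. i < fst \<omega> k}"

fun loc :: "real ^ 'd \<Rightarrow> ('d::finite) sample \<Rightarrow> 'd vtx \<Rightarrow> real ^ 'd" where
  "loc y \<omega> Orig = 0"
| "loc y \<omega> Extra = y"
| "loc y \<omega> (Pt k i) = fst (snd \<omega>) (k, i)"

definition edge_mark :: "('d::finite) sample \<Rightarrow> 'd vtx \<Rightarrow> 'd vtx \<Rightarrow> real" where
  "edge_mark \<omega> a b = fst (snd (snd \<omega>)) {a, b}"

definition thin_mark :: "('d::finite) sample \<Rightarrow> 'd vtx \<Rightarrow> real" where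
  "thin_mark \<omega> v = snd (snd (snd \<omega>)) v"

definition adj :: "(real ^ 'd \<Rightarrow> real) \<Rightarrow> real ^ 'd \<Rightarrow> ('d::finite) sample \<Rightarrow> 'd vtx set
                   \<Rightarrow> 'd vtx \<Rightarrow> 'd vtx \<Rightarrow> bool" where
  "adj psi y \<omega> V a b \<longleftrightarrow> a \<in> V \<and> b \<in> V \<and> a \<noteq> b \<and>
       edge_mark \<omega> a b \<le> psi (loc y \<omega> a - loc y \<omega> b)"

definition thinned :: "(real ^ 'd \<Rightarrow> real) \<Rightarrow> ('d::finite) sample \<Rightarrow> 'd vtx set" where
  "thinned f \<omega> = {v \<in> Pts \<omega>. thin_mark \<omega> v \<le> f (loc 0 \<omega> v)}"

definition box_t :: "real \<Rightarrow> (real ^ 'd) set" where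
  "box_t t = {x. \<forall>i. \<bar>x $ i\<bar> \<le> t / 2}"

definition theta_t :: "real \<Rightarrow> (real ^ ('d::finite) \<Rightarrow> real) \<Rightarrow> real \<Rightarrow> real" where
  "theta_t lam psi t = measure (RCM_space lam :: 'd sample measure)
     {\<omega> \<in> space (RCM_space lam). \<exists>v \<in> Pts \<omega>. loc 0 \<omega> v \<notin> box_t t \<and>
         (adj psi 0 \<omega> (insert Orig (Pts \<omega>)))\<^sup>*\<^sup>* Orig v}"

definition theta :: "real \<Rightarrow> (real ^ ('d::finite) \<Rightarrow> real) \<Rightarrow> real" where
  "theta lam psi = Lim at_top (\<lambda>t. theta_t lam psi t)"

definition lambda_c :: "(real ^ ('d::finite) \<Rightarrow> real) \<Rightarrow> ereal" where
  "lambda_c psi = Inf {ereal lam | lam. lam > 0 \<and> theta lam psi > 0}"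

definition thinning_fns :: "(real ^ ('d::finite) \<Rightarrow> real) set" where
  "thinning_fns = {f. f \<in> borel_measurable lborel \<and> (\<forall>x. 0 \<le> f x \<and> f x \<le> 1) \<and>
                      bounded {x. f x \<noteq> 0}}"

definition phi :: "real \<Rightarrow> (real ^ ('d::finite) \<Rightarrow> real) \<Rightarrow> (real ^ 'd \<Rightarrow> real) \<Rightarrow> ennreal" where
  "phi lam psi f = ennreal lam * (\<integral>\<^sup>+ y. ennreal ((1 - f y) *
      measure (RCM_space lam :: 'd sample measure)
        {\<omega> \<in> space (RCM_space lam).
           (adj psi y \<omega> ({Orig, Extra} \<union> thinned f \<omega>))\<^sup>*\<^sup>* Orig Extra}) \<partial>lborel)"

definition lambda_c_tilde :: "(real ^ ('d::finite) \<Rightarrow> real) \<Rightarrow> ereal" where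
  "lambda_c_tilde psi = Sup {ereal lam | lam. lam > 0 \<and> (\<exists>f \<in> thinning_fns. phi lam psi f < 1)}"

end

(*
Duminil-Copin and Tassion's argument.

In a finite window Poisson expectations are exponential series in the intensity, so the derivative of a
connection probability is the integral over y of the probability that an added point at y is pivotal.
Write z for the probability that o is not joined to the target (the outside of the box). Exploring
the cluster A of the target, the unexplored points form a Poisson process thinned by
f(x) = prod_{a in A} (1 - psi(x - a)), and y is pivotal if A sees y but not o, while y is joined to o through
unexplored points. Averaging over A, the derivative of theta_t is at least z / lambda times the infimum
of phi(f), which is at least 1 above the threshold of phi; so lambda (1 - theta_t) is nonincreasing there.

Conversely, if phi(f) < 1 and f is supported in [-R, R]^d, a path from o to the outside of the box leaves
the f-thinned cluster of o through a point that the thinning rejects and from there still has to reach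
distance of order t, so theta_t <= phi(f) theta_{t - 2R - 2}, and iterating gives exponential decay. Both
thresholds therefore agree with lambda_c.
*)
theory Submission
  imports Defs
begin

text \<open>The obstacle is that conditioning on a cluster of a Poisson process must be made exact.
  With finitely many points, the probability of a given cluster is a weight depending on that
  cluster alone (\<open>kap\<close>), times a product over all other points of the probability not
  to see it. Such products are what a Poisson process integrates in closed form
  (\<open>PE_prod\<close>). Conditioning therefore becomes a splitting of the points into two sets
  (\<open>mecke_split\<close>), valid for functionals that ignore labels (\<open>labf\<close>); the
  same splitting yields thinning, superposition and the insertion of a point.

  The retention function left by exploring the target vanishes on the target, hence outside a box,
  and so is an admissible thinning function. This is why \<open>phi\<close> has to be compared with
  1 for functions rather than for sets.

  The infinite model is reduced to this setting by the finite range of \<open>psi\<close>: up to its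
  first point outside the box, a path stays in a finite union of unit cubes, on which the
  cube-by-cube construction is a Poisson number of i.i.d. uniform points.\<close>

section \<open>Resampling and reindexing coordinates of product measures\<close>

lemma nn_integral_PiM_resample:
  fixes M :: "'i \<Rightarrow> 'a measure"
  assumes M: "\<And>i. prob_space (M i)" and F: "F \<in> borel_measurable (PiM UNIV M)"
  shows "(\<integral>\<^sup>+\<omega>. F \<omega> \<partial>PiM UNIV M) =
    (\<integral>\<^sup>+\<omega>. \<integral>\<^sup>+\<omega>'. F (\<lambda>i. if i \<in> S then \<omega>' i else \<omega> i) \<partial>PiM UNIV M \<partial>PiM UNIV M)"
proof -
  let ?P = "PiM UNIV M"
  let ?h = "\<lambda>(\<omega>, \<omega>'). (\<lambda>i. if i \<in> S then \<omega>' i else \<omega> i)"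
  interpret P: prob_space ?P by (intro prob_space_PiM M)
  interpret PP: product_prob_space M UNIV by (intro product_prob_spaceI M)
  have h: "?h \<in> measurable (?P \<Otimes>\<^sub>M ?P) ?P"
  proof (rule measurable_PiM_single')
    fix i show "(\<lambda>x. ?h x i) \<in> measurable (?P \<Otimes>\<^sub>M ?P) (M i)"
      by (cases "i \<in> S") (simp_all add: split_beta')
  qed (auto simp: space_pair_measure space_PiM PiE_iff)
  \<comment> \<open>Overwriting the coordinates in \<open>S\<close> by those of an independent copy
    preserves the law. It is enough to test cylinders, and the preimage of a cylinder over
    \<open>J\<close> is the product of a cylinder over \<open>J - S\<close> and one over
    \<open>J \<inter> S\<close>.\<close>
  have "distr (?P \<Otimes>\<^sub>M ?P) ?P ?h = ?P"
  proof (rule PP.PiM_eq)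
    fix J E assume J: "finite J" "J \<subseteq> UNIV" "\<And>j. j \<in> J \<Longrightarrow> E j \<in> sets (M j)"
    let ?X = "prod_emb UNIV M J (\<Pi>\<^sub>E j\<in>J. E j)"
    let ?A = "prod_emb UNIV M (J - S) (\<Pi>\<^sub>E j\<in>J - S. E j)"
    let ?B = "prod_emb UNIV M (J \<inter> S) (\<Pi>\<^sub>E j\<in>J \<inter> S. E j)"
    have eq: "?h -` ?X \<inter> space (?P \<Otimes>\<^sub>M ?P) = ?A \<times> ?B"
      using J(3)[THEN sets.sets_into_space]
      by (fastforce simp: space_pair_measure space_PiM prod_emb_def PiE_iff split: if_splits)
    have "emeasure (distr (?P \<Otimes>\<^sub>M ?P) ?P ?h) ?X = emeasure (?P \<Otimes>\<^sub>M ?P) (?A \<times> ?B)"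
      using J by (subst emeasure_distr[OF h]) (auto simp: eq intro!: sets_PiM_I)
    also have "\<dots> = emeasure ?P ?A * emeasure ?P ?B"
      using J by (intro P.emeasure_pair_measure_Times sets_PiM_I) auto
    also have "\<dots> = (\<Prod>j\<in>J - S. emeasure (M j) (E j)) * (\<Prod>j\<in>J \<inter> S. emeasure (M j) (E j))"
      using J by (subst (1 2) emeasure_PiM_emb) (auto intro: M)
    also have "\<dots> = (\<Prod>j\<in>J. emeasure (M j) (E j))"
      using prod.Int_Diff[OF J(1), of "\<lambda>j. emeasure (M j) (E j)" S] by (simp add: mult.commute)
    finally show "emeasure (distr (?P \<Otimes>\<^sub>M ?P) ?P ?h) ?X = (\<Prod>j\<in>J. emeasure (M j) (E j))" .
  qed simp
  then have "(\<integral>\<^sup>+\<omega>. F \<omega> \<partial>?P) = (\<integral>\<^sup>+\<omega>. F \<omega> \<partial>distr (?P \<Otimes>\<^sub>M ?P) ?P ?h)" by simp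
  also have "\<dots> = (\<integral>\<^sup>+\<omega>. F (?h \<omega>) \<partial>(?P \<Otimes>\<^sub>M ?P))"
    by (rule nn_integral_distr[OF h]) (use F in simp)
  also have "\<dots> = (\<integral>\<^sup>+\<omega>. \<integral>\<^sup>+\<omega>'. F (?h (\<omega>, \<omega>')) \<partial>?P \<partial>?P)"
    by (rule P.nn_integral_fst[symmetric]) (use measurable_compose[OF h F] in simp)
  finally show ?thesis by simp
qed

text \<open>A pointwise substitute for measurability with respect to the coordinates in
  \<open>S\<close>, so that independence can be used without generated sigma-algebras.\<close>

definition depends :: "'i set \<Rightarrow> (('i \<Rightarrow> 'a) \<Rightarrow> 'b) \<Rightarrow> bool" where
  "depends S F \<longleftrightarrow> (\<forall>\<omega> \<omega>'. (\<forall>i\<in>S. \<omega> i = \<omega>' i) \<longrightarrow> F \<omega> = F \<omega>')"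

lemma dependsD: "depends S F \<Longrightarrow> (\<And>i. i \<in> S \<Longrightarrow> \<omega> i = \<omega>' i) \<Longrightarrow> F \<omega> = F \<omega>'"
  by (auto simp: depends_def)

lemma nn_integral_PiM_indep:
  fixes M :: "'i \<Rightarrow> 'a measure" and F G :: "('i \<Rightarrow> 'a) \<Rightarrow> ennreal"
  assumes M: "\<And>i. prob_space (M i)"
    and F[measurable]: "F \<in> borel_measurable (PiM UNIV M)"
    and G[measurable]: "G \<in> borel_measurable (PiM UNIV M)"
    and d: "depends S F" "depends S' G" "S \<inter> S' = {}"
  shows "(\<integral>\<^sup>+\<omega>. F \<omega> * G \<omega> \<partial>PiM UNIV M) = (\<integral>\<^sup>+\<omega>. F \<omega> \<partial>PiM UNIV M) * (\<integral>\<^sup>+\<omega>. G \<omega> \<partial>PiM UNIV M)"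
proof -
  have 1: "F (\<lambda>i. if i \<in> S' then \<omega>' i else \<omega> i) = F \<omega>" for \<omega> \<omega>'
    by (rule dependsD[OF d(1)]) (use d(3) in auto)
  have 2: "G (\<lambda>i. if i \<in> S' then \<omega>' i else \<omega> i) = G \<omega>'" for \<omega> \<omega>'
    by (rule dependsD[OF d(2)]) auto
  show ?thesis
    by (subst nn_integral_PiM_resample[OF M, where S=S']) (simp_all add: 1 2 nn_integral_cmult nn_integral_multc)
qed

text \<open>Both sides are integrals over the product indexed by \<open>I\<close>, since an
  injection only renames independent coordinates. This transports probabilities between different
  types of vertices and gives exchangeability of i.i.d. sequences.\<close>

lemma nn_integral_PiM_reindex:
  fixes M :: "'i \<Rightarrow> 'a measure" and N :: "'j \<Rightarrow> 'a measure" and F :: "('i \<Rightarrow> 'a) \<Rightarrow> ennreal"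
  assumes M: "\<And>i. prob_space (M i)" and N: "\<And>i. prob_space (N i)"
    and f: "inj_on f I" and MN: "\<And>i. i \<in> I \<Longrightarrow> M i = N (f i)"
    and F: "F \<in> borel_measurable (PiM UNIV M)" and d: "depends I F"
    and sp: "\<And>i. space (M i) = UNIV"
  shows "(\<integral>\<^sup>+\<omega>. F \<omega> \<partial>PiM UNIV M) = (\<integral>\<^sup>+\<omega>. F (\<lambda>i. \<omega> (f i)) \<partial>PiM UNIV N)"
proof -
  \<comment> \<open>Coordinates outside \<open>I\<close> receive an arbitrary value, which
    \<open>F\<close> ignores.\<close>
  define F0 where "F0 = (\<lambda>\<eta>. F (\<lambda>i. if i \<in> I then \<eta> i else undefined))"
  have "(\<lambda>\<eta> i. if i \<in> I then \<eta> i else undefined) \<in> measurable (PiM I M) (PiM UNIV M)"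
  proof (rule measurable_PiM_single')
    fix i show "(\<lambda>\<eta>. if i \<in> I then \<eta> i else undefined) \<in> measurable (PiM I M) (M i)"
      by (cases "i \<in> I") (auto simp: sp)
  qed (auto simp: space_PiM sp)
  from measurable_compose[OF this F] have F0: "F0 \<in> borel_measurable (PiM I M)" by (simp add: F0_def)
  have PI: "PiM I (\<lambda>i. N (f i)) = PiM I M" by (rule PiM_cong) (auto simp: MN)
  have m1: "(\<lambda>\<omega>. \<lambda>n\<in>I. \<omega> (f n)) \<in> measurable (PiM UNIV N) (PiM I M)"
    using measurable_PiM_single'[of I "\<lambda>n \<omega>. \<omega> (f n)" "PiM UNIV N" M] MN sp 
    by (subst PI[symmetric]) (rule measurable_restrict, simp)
  have m2: "(\<lambda>\<omega>. \<lambda>n\<in>I. \<omega> n) \<in> measurable (PiM UNIV M) (PiM I M)"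
    by (rule measurable_restrict) simp
  have "(\<integral>\<^sup>+\<omega>. F \<omega> \<partial>PiM UNIV M) = (\<integral>\<^sup>+\<omega>. F0 (\<lambda>n\<in>I. \<omega> n) \<partial>PiM UNIV M)"
    unfolding F0_def by (intro nn_integral_cong dependsD[OF d]) auto
  also have "\<dots> = (\<integral>\<^sup>+\<omega>. F0 \<omega> \<partial>PiM I M)"
    using distr_PiM_reindex[of UNIV M "\<lambda>i. i" I] M nn_integral_distr[OF m2, of F0] F0 by simp
  also have "\<dots> = (\<integral>\<^sup>+\<omega>. F0 (\<lambda>n\<in>I. \<omega> (f n)) \<partial>PiM UNIV N)"
    using distr_PiM_reindex[of UNIV N f I] N f nn_integral_distr[OF m1, of F0] F0 by (simp add: PI)
  also have "\<dots> = (\<integral>\<^sup>+\<omega>. F (\<lambda>i. \<omega> (f i)) \<partial>PiM UNIV N)"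
    unfolding F0_def by (intro nn_integral_cong dependsD[OF d]) auto
  finally show ?thesis .
qed

subsection \<open>Random graphs on finite vertex sets\<close>

definition U01 :: "real measure" where "U01 = uniform_measure lborel {0..1}"

lemma prob_space_U01: "prob_space U01"
  unfolding U01_def by (rule prob_space_uniform_measure) auto

lemma space_U01[simp]: "space U01 = UNIV" and sets_U01[simp, measurable_cong]: "sets U01 = sets borel"
  by (auto simp: U01_def)

lemma measure_U01_le: "0 \<le> r \<Longrightarrow> r \<le> 1 \<Longrightarrow> measure U01 {x. x \<le> r} = r"
proof -
  assume r: "0 \<le> r" "r \<le> 1"
  have "measure U01 {..r} = measure lborel ({0..1} \<inter> {..r}) / measure lborel {0..1::real}"
    unfolding U01_def by (subst measure_uniform_measure) auto
  also have "{0..1} \<inter> {..r} = {0..r}" using r by auto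
  finally show ?thesis using r by (simp add: atMost_def)
qed

lemma measure_U01_gt: "0 \<le> r \<Longrightarrow> r \<le> 1 \<Longrightarrow> measure U01 {x. \<not> x \<le> r} = 1 - r"
proof -
  assume r: "0 \<le> r" "r \<le> 1"
  interpret prob_space U01 by (rule prob_space_U01)
  have "measure U01 (space U01 - {x. x \<le> r}) = 1 - measure U01 {x. x \<le> r}"
    by (rule prob_compl) simp
  also have "space U01 - {x. x \<le> r} = {x. \<not> x \<le> r}" by auto
  finally show ?thesis using measure_U01_le[OF r] by simp
qed

definition UM :: "('i \<Rightarrow> real) measure" where
  "UM = PiM UNIV (\<lambda>_. U01)"

lemma prob_space_UM: "prob_space UM"
  unfolding UM_def by (intro prob_space_PiM prob_space_U01)

interpretation UM: prob_space UM by (rule prob_space_UM)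

lemma space_UM[simp]: "space UM = UNIV" by (simp add: UM_def space_PiM)

lemma sets_UM[measurable_cong]: "sets UM = sets (PiM UNIV (\<lambda>_. borel))"
  unfolding UM_def by (rule sets_PiM_cong) auto

abbreviation prU :: "(('i \<Rightarrow> real) \<Rightarrow> bool) \<Rightarrow> real" where
  "prU Q \<equiv> measure UM {\<omega>. Q \<omega>}"

lemma measurable_UM_component[measurable]: "(\<lambda>\<omega>. \<omega> i) \<in> borel_measurable UM"
  using measurable_component_singleton[of i UNIV "\<lambda>_. U01"] by (simp add: UM_def cong: measurable_cong_sets)

lemma pred_UM: "Measurable.pred UM Q \<longleftrightarrow> {\<omega>. Q \<omega>} \<in> sets UM"
  by (simp add: pred_def)

lemma prU_indep:
  fixes Q R :: "('i \<Rightarrow> real) \<Rightarrow> bool"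
  assumes [measurable]: "Measurable.pred UM Q" "Measurable.pred UM R"
    and d: "depends S Q" "depends S' R" "S \<inter> S' = {}"
  shows "prU (\<lambda>\<omega>. Q \<omega> \<and> R \<omega>) = prU Q * prU R"
proof -
  let ?i = "\<lambda>Q \<omega>. indicator {\<omega>. Q \<omega>} \<omega> :: ennreal"
  have [measurable]: "{\<omega>. Q \<omega>} \<in> sets UM" "{\<omega>. R \<omega>} \<in> sets UM" "{\<omega>. Q \<omega> \<and> R \<omega>} \<in> sets UM"
    by (simp_all add: pred_UM[symmetric])
  have "ennreal (prU (\<lambda>\<omega>. Q \<omega> \<and> R \<omega>)) = (\<integral>\<^sup>+\<omega>. ?i (\<lambda>\<omega>. Q \<omega> \<and> R \<omega>) \<omega> \<partial>UM)"
    by (simp add: UM.emeasure_eq_measure)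
  also have "\<dots> = (\<integral>\<^sup>+\<omega>. ?i Q \<omega> * ?i R \<omega> \<partial>UM)"
    by (intro nn_integral_cong) (auto simp: indicator_def)
  also have "\<dots> = (\<integral>\<^sup>+\<omega>. ?i Q \<omega> \<partial>UM) * (\<integral>\<^sup>+\<omega>. ?i R \<omega> \<partial>UM)"
    unfolding UM_def
    by (rule nn_integral_PiM_indep[where S=S and S'=S'])
       (use d in \<open>auto simp: UM_def[symmetric] prob_space_U01 depends_def indicator_def\<close>)
  also have "\<dots> = ennreal (prU Q * prU R)"
    by (simp add: UM.emeasure_eq_measure ennreal_mult)
  finally show ?thesis by simp
qed

lemma prU_reindex:
  fixes Q :: "('i \<Rightarrow> real) \<Rightarrow> bool" and f :: "'i \<Rightarrow> 'j"
  assumes [measurable]: "Measurable.pred UM Q" and d: "depends I Q" and f: "inj_on f I"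
  shows "prU Q = prU (\<lambda>\<omega>. Q (\<lambda>i. \<omega> (f i)))"
proof -
  have m: "(\<lambda>\<omega> i. \<omega> (f i)) \<in> measurable UM UM"
    unfolding UM_def by (rule measurable_PiM_single') (auto simp: space_PiM)
  have Q: "{\<omega>. Q \<omega>} \<in> sets UM" by (simp add: pred_UM[symmetric])
  have "{\<omega>. Q (\<lambda>i. \<omega> (f i))} = (\<lambda>\<omega> i. \<omega> (f i)) -` {\<omega>. Q \<omega>} \<inter> space UM" by auto
  then have Q': "{\<omega>. Q (\<lambda>i. \<omega> (f i))} \<in> sets UM"
    using measurable_sets[OF m Q] by simp
  have "ennreal (prU Q) = (\<integral>\<^sup>+\<omega>. indicator {\<omega>. Q \<omega>} \<omega> \<partial>UM)"
    using Q by (simp add: UM.emeasure_eq_measure)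
  also have "\<dots> = (\<integral>\<^sup>+\<omega>. indicator {\<omega>. Q \<omega>} (\<lambda>i. \<omega> (f i)) \<partial>(UM :: ('j \<Rightarrow> real) measure))"
    unfolding UM_def
    by (rule nn_integral_PiM_reindex[OF _ _ f])
       (use d Q in \<open>auto simp: UM_def[symmetric] prob_space_U01 depends_def indicator_def\<close>)
  also have "\<dots> = (\<integral>\<^sup>+\<omega>. indicator {\<omega>. Q (\<lambda>i. \<omega> (f i))} \<omega> \<partial>(UM :: ('j \<Rightarrow> real) measure))"
    by (intro nn_integral_cong) (auto simp: indicator_def)
  also have "\<dots> = ennreal (prU (\<lambda>\<omega>. Q (\<lambda>i. \<omega> (f i))))"
    using Q' by (simp add: UM.emeasure_eq_measure)
  finally show ?thesis by simp
qed

lemma prU_single: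
  assumes Q: "{x. Q x} \<in> sets borel"
  shows "prU (\<lambda>\<omega>. Q (\<omega> i)) = measure U01 {x. Q x}"
proof -
  interpret U: prob_space U01 by (rule prob_space_U01)
  have "emeasure UM {\<omega>\<in>space (PiM UNIV (\<lambda>_. U01)). \<omega> i \<in> {x. Q x}} = emeasure U01 {x. Q x}"
    unfolding UM_def
    by (rule product_prob_space.emeasure_PiM_Collect_single)
       (use Q in \<open>auto intro!: product_prob_spaceI prob_space_U01\<close>)
  then show ?thesis by (simp add: space_PiM measure_def)
qed

lemma prU_all:
  fixes Q :: "'x \<Rightarrow> real \<Rightarrow> bool"
  assumes "finite F" "inj_on h F" and Q: "\<And>x. x \<in> F \<Longrightarrow> {r. Q x r} \<in> sets borel"
  shows "prU (\<lambda>\<omega>. \<forall>x\<in>F. Q x (\<omega> (h x))) = (\<Prod>x\<in>F. measure U01 {r. Q x r})"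
  using assms
proof (induction F)
  case empty then show ?case using UM.prob_space by simp
next
  case (insert a F)
  have [measurable]: "Measurable.pred borel (Q x)" if "x \<in> insert a F" for x
    using insert.prems(2)[OF that] by (simp add: pred_def)
  have m: "Measurable.pred UM (\<lambda>\<omega>. Q x (\<omega> (h x)))" if "x \<in> insert a F" for x
    using that by (intro measurable_compose[OF measurable_UM_component]) measurable
  have "prU (\<lambda>\<omega>. Q a (\<omega> (h a)) \<and> (\<forall>x\<in>F. Q x (\<omega> (h x)))) =
      prU (\<lambda>\<omega>. Q a (\<omega> (h a))) * prU (\<lambda>\<omega>. \<forall>x\<in>F. Q x (\<omega> (h x)))"
  proof (rule prU_indep)
    show "Measurable.pred UM (\<lambda>\<omega>. \<forall>x\<in>F. Q x (\<omega> (h x)))"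
      using insert.hyps(1) m by (intro pred_intros_finite) auto
    show "depends {h a} (\<lambda>\<omega>. Q a (\<omega> (h a)))" "depends (h ` F) (\<lambda>\<omega>. \<forall>x\<in>F. Q x (\<omega> (h x)))"
      by (auto simp: depends_def)
    show "{h a} \<inter> h ` F = {}" using insert by (auto simp: inj_on_def)
  qed (rule m, simp)
  then show ?case using insert by (simp add: prU_single)
qed

section \<open>Connection events and cluster events\<close>

definition gadj :: "('v \<Rightarrow> 'v \<Rightarrow> real) \<Rightarrow> ('v set \<Rightarrow> real) \<Rightarrow> 'v set \<Rightarrow> 'v \<Rightarrow> 'v \<Rightarrow> bool" where
  "gadj p \<omega> V a b \<longleftrightarrow> a \<in> V \<and> b \<in> V \<and> a \<noteq> b \<and> \<omega> {a, b} \<le> p a b"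

abbreviation reach :: "('v \<Rightarrow> 'v \<Rightarrow> real) \<Rightarrow> ('v set \<Rightarrow> real) \<Rightarrow> 'v set \<Rightarrow> 'v \<Rightarrow> 'v \<Rightarrow> bool" where
  "reach p \<omega> V \<equiv> (gadj p \<omega> V)\<^sup>*\<^sup>*"

definition spans :: "('v \<Rightarrow> 'v \<Rightarrow> real) \<Rightarrow> 'v \<Rightarrow> 'v set \<Rightarrow> ('v set \<Rightarrow> real) \<Rightarrow> bool" where
  "spans p s C \<omega> \<longleftrightarrow> (\<forall>c\<in>C. reach p \<omega> (insert s C) s c)"

definition noadj :: "('v \<Rightarrow> 'v \<Rightarrow> real) \<Rightarrow> 'v set \<Rightarrow> 'v set \<Rightarrow> ('v set \<Rightarrow> real) \<Rightarrow> bool" where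
  "noadj p B D \<omega> \<longleftrightarrow> (\<forall>b\<in>B. \<forall>c\<in>D. \<not> \<omega> {b, c} \<le> p b c)"

text \<open>The first event reads only marks inside \<open>insert s C\<close>, the second only marks
  between \<open>P - C\<close> and \<open>insert s C\<close>. Written in this way, the event that
  \<open>C\<close> is the cluster of \<open>s\<close> is visibly an intersection of two independent
  events; \<open>cluster_is_iff\<close> identifies it with the usual description.\<close>

definition cluster_is :: "('v \<Rightarrow> 'v \<Rightarrow> real) \<Rightarrow> 'v \<Rightarrow> 'v set \<Rightarrow> 'v set \<Rightarrow> ('v set \<Rightarrow> real) \<Rightarrow> bool" where
  "cluster_is p s P C \<omega> \<longleftrightarrow> spans p s C \<omega> \<and> noadj p (P - C) (insert s C) \<omega>"

definition con :: "('v \<Rightarrow> 'v \<Rightarrow> real) \<Rightarrow> 'v set \<Rightarrow> 'v \<Rightarrow> 'v \<Rightarrow> real" where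
  "con p V s t = prU (\<lambda>\<omega>. reach p \<omega> V s t)"

text \<open>The factor in the law of the cluster that does not change with the vertices outside it.
  The other factor is a product of \<open>qf\<close> over those vertices.\<close>

definition kap :: "('v \<Rightarrow> 'v \<Rightarrow> real) \<Rightarrow> 'v \<Rightarrow> 'v set \<Rightarrow> real" where
  "kap p s C = prU (spans p s C)"

definition qf :: "('v \<Rightarrow> 'v \<Rightarrow> real) \<Rightarrow> 'v set \<Rightarrow> 'v \<Rightarrow> real" where
  "qf p D b = (\<Prod>c\<in>D. 1 - p b c)"

text \<open>A path is a finite sequence in a countable set, so the event is a countable union over
  lengths and intermediate vertices.\<close>

lemma measurable_rtranclp:
  fixes R :: "'z \<Rightarrow> 'v::countable \<Rightarrow> 'v \<Rightarrow> bool"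
  assumes [measurable]: "\<And>a b. Measurable.pred M (\<lambda>z. R z a b)"
  shows "Measurable.pred M (\<lambda>z. (R z)\<^sup>*\<^sup>* a b)"
proof -
  have [measurable]: "Measurable.pred M (\<lambda>z. (R z ^^ n) a b)" for n b
  proof (induction n arbitrary: b)
    case (Suc n)
    note [measurable] = Suc
    have "(\<lambda>z. (R z ^^ Suc n) a b) = (\<lambda>z. \<exists>c. (R z ^^ n) a c \<and> R z c b)"
      by (auto simp: fun_eq_iff)
    then show ?case by simp
  qed simp
  have "(\<lambda>z. (R z)\<^sup>*\<^sup>* a b) = (\<lambda>z. \<exists>n. (R z ^^ n) a b)"
    by (auto simp: fun_eq_iff rtranclp_power)
  then show ?thesis by simp
qed

lemma pred_gadj[measurable]: "Measurable.pred UM (\<lambda>\<omega>. gadj p \<omega> V a b)"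
  unfolding gadj_def by measurable

lemma pred_reach[measurable]: "Measurable.pred UM (\<lambda>\<omega>. reach p \<omega> V a (b :: 'v :: countable))"
  by (rule measurable_rtranclp) measurable

lemma pred_spans[measurable]: "finite C \<Longrightarrow> Measurable.pred UM (spans p s (C :: 'v :: countable set))"
  unfolding spans_def by (intro pred_intros_finite) measurable

lemma pred_noadj[measurable]: "finite B \<Longrightarrow> finite D \<Longrightarrow> Measurable.pred UM (noadj p B D)"
  unfolding noadj_def by (intro pred_intros_finite) measurable

lemma pred_cluster[measurable]: "finite P \<Longrightarrow> finite C \<Longrightarrow> Measurable.pred UM (cluster_is p s P (C :: 'v :: countable set))"
  unfolding cluster_is_def by measurable

lemma gadj_cong: "(\<And>e. e \<in> Pow V - {{}} \<Longrightarrow> \<omega> e = \<omega>' e) \<Longrightarrow> gadj p \<omega> V = gadj p \<omega>' V"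
  by (auto simp: gadj_def fun_eq_iff)

text \<open>The index set is larger than the set of edges, but removing the empty set is what makes
  the index sets of disjoint vertex sets disjoint.\<close>

lemma depends_reach: "depends (Pow V - {{}}) (\<lambda>\<omega>. reach p \<omega> V s t)"
  unfolding depends_def using gadj_cong by metis

lemma depends_spans: "depends (Pow (insert s C) - {{}}) (spans p s C)"
  unfolding depends_def spans_def using gadj_cong by metis

definition edges :: "'v set \<Rightarrow> 'v set \<Rightarrow> 'v set set" where
  "edges B D = {{b, c} | b c. b \<in> B \<and> c \<in> D}"

lemma depends_noadj: "depends (edges B D) (noadj p B D)"
  unfolding depends_def
proof (intro allI impI)
  fix \<omega> \<omega>' :: "'a set \<Rightarrow> real"
  assume "\<forall>i\<in>edges B D. \<omega> i = \<omega>' i"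
  then have "\<omega> {b, c} = \<omega>' {b, c}" if "b \<in> B" "c \<in> D" for b c
    using that by (auto simp: edges_def)
  then show "noadj p B D \<omega> = noadj p B D \<omega>'" by (simp add: noadj_def)
qed

lemma depends_noadj': "depends (edges B D) (\<lambda>\<omega>. \<not> noadj p B D \<omega>)"
  using depends_noadj[of B D p] unfolding depends_def by blast

lemma depends_conj:
  "depends S Q \<Longrightarrow> depends S' R \<Longrightarrow> depends (S \<union> S') (\<lambda>\<omega>. Q \<omega> \<and> R \<omega>)"
  unfolding depends_def by (metis UnCI)

lemma gadj_mono: "V \<subseteq> V' \<Longrightarrow> (\<And>a b. a \<in> V \<Longrightarrow> b \<in> V \<Longrightarrow> p a b \<le> p' a b) \<Longrightarrow> gadj p \<omega> V a b \<Longrightarrow> gadj p' \<omega> V' a b"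
  by (force simp: gadj_def)

lemma reach_mono': 
  assumes "reach p \<omega> V s t" "V \<subseteq> V'" "\<And>a b. a \<in> V \<Longrightarrow> b \<in> V \<Longrightarrow> p a b \<le> p' a b" 
  shows "reach p' \<omega> V' s t"
  using assms(1) by (rule rtranclp_mono[THEN predicate2D, rotated]) (auto intro: gadj_mono[OF assms(2,3)])

lemma reach_mono: "reach p \<omega> V s t \<Longrightarrow> V \<subseteq> V' \<Longrightarrow> reach p \<omega> V' s t"
  by (erule reach_mono') auto

lemma reach_stays: "reach p \<omega> V s t \<Longrightarrow> s \<in> V \<Longrightarrow> t \<in> V"
  by (induction rule: rtranclp_induct) (auto simp: gadj_def)

lemma con_nonneg[simp]: "0 \<le> con p V s t" and con_le_1[simp]: "con p V s t \<le> 1"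
  by (auto simp: con_def)

lemma kap_nonneg[simp]: "0 \<le> kap p s C" and kap_le_1[simp]: "kap p s C \<le> 1"
  by (auto simp: kap_def)

lemma con_mono:
  fixes V :: "'v::countable set"
  assumes "V \<subseteq> V'" "\<And>a b. a \<in> V \<Longrightarrow> b \<in> V \<Longrightarrow> p a b \<le> p' a b"
  shows "con p V s t \<le> con p' V' s t"
  unfolding con_def
  by (rule UM.finite_measure_mono)
     (auto simp: pred_UM[symmetric] intro: reach_mono'[OF _ assms(1), of p _ _ _ p'] assms(2))

lemma con_cong:
  assumes "\<And>a b. a \<in> V \<Longrightarrow> b \<in> V \<Longrightarrow> p a b = p' a b"
  shows "con p V s t = con p' V s t"
proof -
  have "gadj p \<omega> V = gadj p' \<omega> V" for \<omega> using assms by (auto simp: gadj_def fun_eq_iff)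
  then show ?thesis by (simp add: con_def)
qed

lemma kap_cong:
  assumes "\<And>a b. a \<in> insert s C \<Longrightarrow> b \<in> insert s C \<Longrightarrow> p a b = p' a b"
  shows "kap p s C = kap p' s C"
proof -
  have "gadj p \<omega> (insert s C) = gadj p' \<omega> (insert s C)" for \<omega> using assms by (auto simp: gadj_def fun_eq_iff)
  then show ?thesis by (simp add: kap_def spans_def[abs_def])
qed

section \<open>Relabelling vertices\<close>

lemma gadj_image:
  assumes "inj_on \<pi> V" "a \<in> V" "b \<in> V"
  shows "gadj p \<omega> (\<pi> ` V) (\<pi> a) (\<pi> b) \<longleftrightarrow> gadj (\<lambda>a b. p (\<pi> a) (\<pi> b)) (\<lambda>e. \<omega> (\<pi> ` e)) V a b"
  using assms by (auto simp: gadj_def inj_on_eq_iff)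

lemma reach_image:
  assumes "inj_on \<pi> V" "s \<in> V" "t \<in> V"
  shows "reach p \<omega> (\<pi> ` V) (\<pi> s) (\<pi> t) \<longleftrightarrow> reach (\<lambda>a b. p (\<pi> a) (\<pi> b)) (\<lambda>e. \<omega> (\<pi> ` e)) V s t"
proof
  assume "reach p \<omega> (\<pi> ` V) (\<pi> s) (\<pi> t)"
  then have "\<exists>u\<in>V. \<pi> u = \<pi> t \<and> reach (\<lambda>a b. p (\<pi> a) (\<pi> b)) (\<lambda>e. \<omega> (\<pi> ` e)) V s u"
  proof (induction rule: rtranclp_induct)
    case base then show ?case using assms by auto
  next
    case (step y z)
    then obtain u where u: "u \<in> V" "\<pi> u = y" "reach (\<lambda>a b. p (\<pi> a) (\<pi> b)) (\<lambda>e. \<omega> (\<pi> ` e)) V s u" by auto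
    from step obtain w where w: "w \<in> V" "\<pi> w = z" by (auto simp: gadj_def)
    have "gadj (\<lambda>a b. p (\<pi> a) (\<pi> b)) (\<lambda>e. \<omega> (\<pi> ` e)) V u w"
      using step u w assms(1) by (subst gadj_image[symmetric]) auto
    then show ?case using u w rtranclp.rtrancl_into_rtrancl by metis
  qed
  then show "reach (\<lambda>a b. p (\<pi> a) (\<pi> b)) (\<lambda>e. \<omega> (\<pi> ` e)) V s t"
    using assms by (auto simp: inj_on_eq_iff)
next
  assume "reach (\<lambda>a b. p (\<pi> a) (\<pi> b)) (\<lambda>e. \<omega> (\<pi> ` e)) V s t"
  then show "reach p \<omega> (\<pi> ` V) (\<pi> s) (\<pi> t)"
  proof (induction rule: rtranclp_induct)
    case (step y z)
    then have "y \<in> V" "z \<in> V" by (auto simp: gadj_def)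
    with step have "gadj p \<omega> (\<pi> ` V) (\<pi> y) (\<pi> z)" using assms by (subst gadj_image) auto
    with step show ?case by (meson rtranclp.rtrancl_into_rtrancl)
  qed simp
qed

lemma inj_on_image_Pow': "inj_on \<pi> V \<Longrightarrow> inj_on ((`) \<pi>) (Pow V - {{}})"
  by (rule inj_on_subset[OF inj_on_image_Pow]) auto

lemma con_reindex:
  fixes \<pi> :: "'v::countable \<Rightarrow> 'w::countable"
  assumes "inj_on \<pi> V" "s \<in> V" "t \<in> V"
  shows "con p (\<pi> ` V) (\<pi> s) (\<pi> t) = con (\<lambda>a b. p (\<pi> a) (\<pi> b)) V s t"
  unfolding con_def reach_image[OF assms]
  by (rule prU_reindex[OF _ depends_reach, symmetric]) (simp_all add: inj_on_image_Pow' assms)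

lemma kap_reindex:
  fixes \<pi> :: "'v::countable \<Rightarrow> 'w::countable"
  assumes "inj_on \<pi> (insert s C)" "finite C"
  shows "kap p (\<pi> s) (\<pi> ` C) = kap (\<lambda>a b. p (\<pi> a) (\<pi> b)) s C"
proof -
  have "spans p (\<pi> s) (\<pi> ` C) \<omega> \<longleftrightarrow> spans (\<lambda>a b. p (\<pi> a) (\<pi> b)) s C (\<lambda>e. \<omega> (\<pi> ` e))" for \<omega>
    unfolding spans_def using reach_image[OF assms(1), of s _ p \<omega>] by auto
  then have "prU (spans p (\<pi> s) (\<pi> ` C)) = prU (\<lambda>\<omega>. spans (\<lambda>a b. p (\<pi> a) (\<pi> b)) s C (\<lambda>e. \<omega> (\<pi> ` e)))"
    by simp
  also have "\<dots> = prU (spans (\<lambda>a b. p (\<pi> a) (\<pi> b)) s C)"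
    by (rule prU_reindex[OF pred_spans[OF assms(2)] depends_spans inj_on_image_Pow'[OF assms(1)], symmetric])
  finally show ?thesis by (simp add: kap_def)
qed

section \<open>Cluster exploration in a finite random graph\<close>

locale edge_prob =
  fixes p :: "'v::countable \<Rightarrow> 'v \<Rightarrow> real"
  assumes p_ge0: "0 \<le> p a b" and p_le1: "p a b \<le> 1" and p_sym: "p a b = p b a"
begin

lemma qf_nonneg[simp]: "0 \<le> qf p D b" and qf_le_1[simp]: "qf p D b \<le> 1"
  unfolding qf_def using p_ge0 p_le1 by (auto intro!: prod_nonneg prod_le_1)

lemma gadj_sym: "gadj p \<omega> V a b = gadj p \<omega> V b a"
  by (auto simp: gadj_def insert_commute p_sym)

lemma reach_sym1: "reach p \<omega> V s t \<Longrightarrow> reach p \<omega> V t s"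
proof (induction rule: rtranclp_induct)
  case (step v w)
  then have "gadj p \<omega> V w v" by (simp add: gadj_sym)
  then show ?case using step.IH by (rule converse_rtranclp_into_rtranclp)
qed simp

lemma reach_sym: "reach p \<omega> V s t \<longleftrightarrow> reach p \<omega> V t s"
  using reach_sym1 by blast

lemma con_sym: "con p V s t = con p V t s"
  unfolding con_def using reach_sym by metis

text \<open>An edge is open when its mark is at most its probability, so an edge of probability 0 is
  closed only where its mark is positive.\<close>

lemma AE_pos: "finite F \<Longrightarrow> AE \<omega> in UM. \<forall>e\<in>F. \<omega> e > (0::real)"
proof -
  assume "finite F"
  moreover have "AE \<omega> in UM. \<omega> e > (0::real)" for e :: 'a
  proof (rule UM.AE_I_eq_1)
    have "prU (\<lambda>\<omega>. \<not> \<omega> e \<le> 0) = 1"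
      using prU_single[of "\<lambda>x. \<not> x \<le> 0" e] measure_U01_gt[of 0] by simp
    then show "emeasure UM {\<omega> \<in> space UM. 0 < \<omega> e} = 1"
      by (simp add: not_le UM.emeasure_eq_measure)
    show "{\<omega> \<in> space UM. 0 < \<omega> e} \<in> UM.events" by measurable
  qed
  ultimately show ?thesis by (simp add: AE_finite_all)
qed

text \<open>Because \<open>B\<close> and \<open>D\<close> are disjoint, distinct pairs in
  \<open>B \<times> D\<close> give distinct unordered pairs, so all the marks involved are
  independent.\<close>

lemma prU_noadj:
  assumes "finite B" "finite D" "B \<inter> D = {}"
  shows "prU (noadj p B D) = (\<Prod>b\<in>B. qf p D b)"
proof -
  have "prU (noadj p B D) = prU (\<lambda>\<omega>. \<forall>x\<in>B \<times> D. \<not> \<omega> {fst x, snd x} \<le> p (fst x) (snd x))"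
    unfolding noadj_def by (intro arg_cong[where f="measure UM"]) auto
  also have "\<dots> = (\<Prod>x\<in>B\<times>D. measure U01 {r. \<not> r \<le> p (fst x) (snd x)})"
    by (rule prU_all[of "B \<times> D" "\<lambda>x. {fst x, snd x}" "\<lambda>x r. \<not> r \<le> p (fst x) (snd x)"])
      (use assms in \<open>auto simp: inj_on_def doubleton_eq_iff\<close>)
  also have "\<dots> = (\<Prod>x\<in>B\<times>D. 1 - p (fst x) (snd x))"
    by (intro prod.cong refl measure_U01_gt p_ge0 p_le1)
  also have "\<dots> = (\<Prod>b\<in>B. qf p D b)"
    unfolding qf_def by (subst prod.cartesian_product) (simp add: split_beta)
  finally show ?thesis .
qed

lemma prU_not_noadj:
  assumes "finite D" "y \<notin> D"
  shows "prU (\<lambda>\<omega>. \<not> noadj p {y} D \<omega>) = 1 - qf p D y"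
proof -
  have "prU (\<lambda>\<omega>. \<not> noadj p {y} D \<omega>) = 1 - prU (noadj p {y} D)"
    using UM.prob_compl[of "{\<omega>. noadj p {y} D \<omega>}"] assms
    by (simp add: pred_UM[symmetric] Compl_eq_Diff_UNIV[symmetric] Collect_neg_eq)
  then show ?thesis using prU_noadj[of "{y}" D] assms by simp
qed

lemma prU_spans_noadj:
  assumes "finite C" "finite B" "B \<inter> insert s C = {}"
  shows "prU (\<lambda>\<omega>. spans p s C \<omega> \<and> noadj p B (insert s C) \<omega>) = kap p s C * (\<Prod>b\<in>B. qf p (insert s C) b)"
  using assms
  by (subst prU_indep[OF _ _ depends_spans depends_noadj])
     (auto simp: prU_noadj kap_def edges_def)

text \<open>Four independent events, living on the edges inside the cluster, from the cluster to
  \<open>B\<close>, from the cluster to \<open>y\<close>, and inside a set \<open>V\<close> that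
  avoids the cluster. Both the pivotal inequality and the exit inequality reduce to events of this
  shape.\<close>

lemma prU_four:
  assumes "finite C" "finite B" "B \<inter> insert s C = {}" "y \<notin> B" "y \<notin> insert s C"
    and [measurable]: "Measurable.pred UM R" and R: "depends (Pow V - {{}}) R" "V \<inter> insert s C = {}"
  shows "prU (\<lambda>\<omega>. (spans p s C \<omega> \<and> noadj p B (insert s C) \<omega>) \<and> \<not> noadj p {y} (insert s C) \<omega> \<and> R \<omega>)
    = kap p s C * (\<Prod>b\<in>B. qf p (insert s C) b) * ((1 - qf p (insert s C) y) * prU R)"
proof -
  note [measurable] = pred_spans[OF assms(1)] pred_noadj[of _ "insert s C"]
  have "prU (\<lambda>\<omega>. (spans p s C \<omega> \<and> noadj p B (insert s C) \<omega>) \<and> \<not> noadj p {y} (insert s C) \<omega> \<and> R \<omega>)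
    = prU (\<lambda>\<omega>. (spans p s C \<omega> \<and> noadj p B (insert s C) \<omega>)) * prU (\<lambda>\<omega>. \<not> noadj p {y} (insert s C) \<omega> \<and> R \<omega>)"
    by (rule prU_indep[OF _ _ depends_conj[OF depends_spans depends_noadj] depends_conj[OF depends_noadj' R(1)]])
       (use assms in \<open>auto simp: edges_def doubleton_eq_iff\<close>)
  also have "prU (\<lambda>\<omega>. \<not> noadj p {y} (insert s C) \<omega> \<and> R \<omega>) = (1 - qf p (insert s C) y) * prU R"
    by (subst prU_indep[OF _ _ depends_noadj' R(1)]) (use assms in \<open>auto simp: edges_def prU_not_noadj\<close>)
  finally show ?thesis using assms by (simp add: prU_spans_noadj)
qed

lemma cluster_closed:
  assumes c: "cluster_is p s P C \<omega>" and B: "noadj p B (insert s C) \<omega>"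
    and r: "reach p \<omega> (insert s (B \<union> P)) s v"
  shows "v \<in> insert s C"
  using r
proof (induction rule: rtranclp_induct)
  case (step v w)
  show ?case
  proof (rule ccontr)
    assume w: "w \<notin> insert s C"
    with step have "w \<in> B \<or> w \<in> P - C" "\<omega> {w, v} \<le> p w v" by (auto simp: gadj_def insert_commute p_sym)
    with c B step.IH show False by (auto simp: cluster_is_def noadj_def)
  qed
qed simp

text \<open>A vertex outside \<open>C\<close> that sees no vertex of \<open>insert s C\<close> can
  never be reached, and conversely every vertex on a path from \<open>s\<close> already belongs to
  the cluster. Hence the events \<open>cluster_is p s P C\<close> with
  \<open>C \<subseteq> P\<close> partition the space.\<close>

lemma cluster_is_iff:
  assumes "s \<notin> P" "C \<subseteq> P"
  shows "cluster_is p s P C \<omega> \<longleftrightarrow> C = {v\<in>P. reach p \<omega> (insert s P) s v}" (is "_ \<longleftrightarrow> C = ?R")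
proof
  assume c: "cluster_is p s P C \<omega>"
  then have "v \<in> insert s C" if "reach p \<omega> (insert s P) s v" for v
    using cluster_closed[OF c, of "{}" v] that by (simp add: noadj_def)
  moreover have "reach p \<omega> (insert s P) s v" if "v \<in> C" for v
    using c that assms by (auto simp: cluster_is_def spans_def intro: reach_mono)
  ultimately show "C = ?R" using assms by auto
next
  assume C: "C = ?R"
  have *: "reach p \<omega> (insert s C) s v" if "reach p \<omega> (insert s P) s v" for v
    using that
  proof (induction rule: rtranclp_induct)
    case (step v w)
    have "reach p \<omega> (insert s P) s w" using step by (meson rtranclp.rtrancl_into_rtrancl)
    then have "v \<in> insert s C" "w \<in> insert s C"
      using step C by (auto simp: gadj_def)
    with step have "gadj p \<omega> (insert s C) v w" by (auto simp: gadj_def)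
    with step show ?case by (meson rtranclp.rtrancl_into_rtrancl)
  qed simp
  moreover have False if "b \<in> P" "b \<notin> C" "c \<in> insert s C" "\<omega> {b, c} \<le> p b c" for b c
  proof -
    have "reach p \<omega> (insert s P) s c" using that C by auto
    moreover have "gadj p \<omega> (insert s P) c b"
      using that assms by (auto simp: gadj_def insert_commute p_sym)
    ultimately have "reach p \<omega> (insert s P) s b" by (rule rtranclp.rtrancl_into_rtrancl)
    with that C show False by auto
  qed
  ultimately show "cluster_is p s P C \<omega>" using C unfolding cluster_is_def spans_def noadj_def by blast
qed

lemma cluster_unique:
  "s \<notin> P \<Longrightarrow> C \<subseteq> P \<Longrightarrow> C' \<subseteq> P \<Longrightarrow> cluster_is p s P C \<omega> \<Longrightarrow> cluster_is p s P C' \<omega> \<Longrightarrow> C = C'"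
  by (simp add: cluster_is_iff)

lemma cluster_exists: "s \<notin> P \<Longrightarrow> \<exists>C\<in>Pow P. cluster_is p s P C \<omega>"
  using cluster_is_iff[of s P "{v\<in>P. reach p \<omega> (insert s P) s v}" \<omega>] by auto

lemma prU_cluster_sum:
  assumes P: "finite P" "s \<notin> P" and K: "\<And>C. C \<subseteq> P \<Longrightarrow> Measurable.pred UM (K C)"
  shows "(\<Sum>C\<in>Pow P. prU (\<lambda>\<omega>. cluster_is p s P C \<omega> \<and> K C \<omega>)) = prU (\<lambda>\<omega>. \<exists>C\<in>Pow P. cluster_is p s P C \<omega> \<and> K C \<omega>)"
proof -
  have "measure UM (\<Union>C\<in>Pow P. {\<omega>. cluster_is p s P C \<omega> \<and> K C \<omega>}) = (\<Sum>C\<in>Pow P. prU (\<lambda>\<omega>. cluster_is p s P C \<omega> \<and> K C \<omega>))"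
  proof (rule UM.finite_measure_finite_Union)
    show "(\<lambda>C. {\<omega>. cluster_is p s P C \<omega> \<and> K C \<omega>}) ` Pow P \<subseteq> sets UM"
    proof safe
      fix C assume C: "C \<subseteq> P"
      note [measurable] = K[OF C] pred_cluster[OF P(1) finite_subset[OF C P(1)]]
      show "{\<omega>. cluster_is p s P C \<omega> \<and> K C \<omega>} \<in> sets UM" by (subst pred_UM[symmetric]) measurable
    qed
    show "disjoint_family_on (\<lambda>C. {\<omega>. cluster_is p s P C \<omega> \<and> K C \<omega>}) (Pow P)"
      using cluster_unique[OF P(2)] by (auto simp: disjoint_family_on_def)
  qed (use P in simp)
  moreover have "(\<Union>C\<in>Pow P. {\<omega>. cluster_is p s P C \<omega> \<and> K C \<omega>}) = {\<omega>. \<exists>C\<in>Pow P. cluster_is p s P C \<omega> \<and> K C \<omega>}" by auto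
  ultimately show ?thesis by simp
qed

lemma prU_cluster:
  assumes "finite P" "s \<notin> P" "C \<subseteq> P"
  shows "prU (cluster_is p s P C) = kap p s C * (\<Prod>b\<in>P - C. qf p (insert s C) b)"
  unfolding cluster_is_def using assms finite_subset[OF assms(3,1)]
  by (subst prU_spans_noadj) auto

text \<open>These are the probabilities of a partition. The identity is used later to turn a formula
  for non-connection into one for connection.\<close>

lemma sum_kap_eq_1:
  assumes "finite P" "s \<notin> P"
  shows "(\<Sum>C\<in>Pow P. kap p s C * (\<Prod>b\<in>P - C. qf p (insert s C) b)) = 1"
proof -
  have "(\<Sum>C\<in>Pow P. kap p s C * (\<Prod>b\<in>P - C. qf p (insert s C) b)) =
      (\<Sum>C\<in>Pow P. prU (\<lambda>\<omega>. cluster_is p s P C \<omega> \<and> True))"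
    using assms by (intro sum.cong refl) (simp add: prU_cluster)
  also have "\<dots> = prU (\<lambda>\<omega>. \<exists>C\<in>Pow P. cluster_is p s P C \<omega> \<and> True)"
    using assms by (rule prU_cluster_sum) auto
  also have "\<dots> = prU (\<lambda>\<omega> :: 'v set \<Rightarrow> real. True)"
    using cluster_exists[OF assms(2)] by (intro arg_cong[where f="measure UM"]) auto
  finally show ?thesis using UM.prob_space by simp
qed

lemma reach_cluster_iff:
  assumes c: "cluster_is p s P C \<omega>" and t: "t \<notin> P" "t \<noteq> s" "C \<subseteq> P"
  shows "\<not> reach p \<omega> (insert s (insert t P)) s t \<longleftrightarrow> noadj p {t} (insert s C) \<omega>"
proof
  assume "noadj p {t} (insert s C) \<omega>"
  from cluster_closed[OF c this, of t] t show "\<not> reach p \<omega> (insert s (insert t P)) s t" by auto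
next
  assume n: "\<not> reach p \<omega> (insert s (insert t P)) s t"
  show "noadj p {t} (insert s C) \<omega>"
  proof (rule ccontr)
    assume "\<not> noadj p {t} (insert s C) \<omega>"
    then obtain d where d: "d \<in> insert s C" "\<omega> {t, d} \<le> p t d" by (auto simp: noadj_def)
    have "reach p \<omega> (insert s C) s d" using c d by (auto simp: cluster_is_def spans_def)
    then have "reach p \<omega> (insert s (insert t P)) s d" by (rule reach_mono) (use t in auto)
    moreover have "gadj p \<omega> (insert s (insert t P)) d t"
      using d t by (auto simp: gadj_def insert_commute p_sym)
    ultimately show False using n by (meson rtranclp.rtrancl_into_rtrancl)
  qed
qed

text \<open>Explore the cluster of \<open>s\<close> while leaving \<open>t\<close> out. Then
  \<open>t\<close> is disconnected from \<open>s\<close> exactly when it sees nothing of that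
  cluster, which adds one more factor \<open>qf\<close> to the law of the cluster.\<close>

lemma one_minus_con:
  assumes P: "finite P" "s \<notin> P" "t \<notin> P" "s \<noteq> t"
  shows "1 - con p (insert s (insert t P)) s t =
    (\<Sum>C\<in>Pow P. kap p s C * (\<Prod>b\<in>P - C. qf p (insert s C) b) * qf p (insert s C) t)"
proof -
  have m: "Measurable.pred UM (noadj p {t} (insert s C))" if "C \<subseteq> P" for C
    using finite_subset[OF that P(1)] by (intro pred_noadj) auto
  have "1 - con p (insert s (insert t P)) s t = prU (\<lambda>\<omega>. \<not> reach p \<omega> (insert s (insert t P)) s t)"
    using UM.prob_compl[of "{\<omega>. reach p \<omega> (insert s (insert t P)) s t}"]
    by (simp add: con_def pred_UM[symmetric] Compl_eq_Diff_UNIV[symmetric] Collect_neg_eq)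
  also have "\<dots> = prU (\<lambda>\<omega>. \<exists>C\<in>Pow P. cluster_is p s P C \<omega> \<and> noadj p {t} (insert s C) \<omega>)"
  proof -
    have "\<not> reach p \<omega> (insert s (insert t P)) s t \<longleftrightarrow>
        (\<exists>C\<in>Pow P. cluster_is p s P C \<omega> \<and> noadj p {t} (insert s C) \<omega>)" for \<omega>
    proof -
      obtain C where "C \<in> Pow P" "cluster_is p s P C \<omega>" using cluster_exists[OF P(2)] by blast
      moreover have "\<not> reach p \<omega> (insert s (insert t P)) s t \<longleftrightarrow> noadj p {t} (insert s C) \<omega>"
        if "C \<in> Pow P" "cluster_is p s P C \<omega>" for C
        using reach_cluster_iff[OF that(2) P(3)] P(4) that(1) by auto
      ultimately show ?thesis by metis
    qed
    then show ?thesis by simp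
  qed
  also have "\<dots> = (\<Sum>C\<in>Pow P. prU (\<lambda>\<omega>. cluster_is p s P C \<omega> \<and> noadj p {t} (insert s C) \<omega>))"
    by (rule prU_cluster_sum[symmetric]) (use P m in auto)
  also have "\<dots> = (\<Sum>C\<in>Pow P. kap p s C * (\<Prod>b\<in>P - C. qf p (insert s C) b) * qf p (insert s C) t)"
  proof (intro sum.cong refl)
    fix C assume C: "C \<in> Pow P"
    then have fC: "finite C" using P finite_subset by auto
    have "prU (\<lambda>\<omega>. cluster_is p s P C \<omega> \<and> noadj p {t} (insert s C) \<omega>) =
      prU (\<lambda>\<omega>. spans p s C \<omega> \<and> noadj p (insert t (P - C)) (insert s C) \<omega>)"
      by (intro arg_cong[where f="measure UM"]) (auto simp: cluster_is_def noadj_def)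
    also have "\<dots> = kap p s C * (\<Prod>b\<in>insert t (P - C). qf p (insert s C) b)"
      by (rule prU_spans_noadj) (use P C fC in auto)
    finally show "prU (\<lambda>\<omega>. cluster_is p s P C \<omega> \<and> noadj p {t} (insert s C) \<omega>) =
       kap p s C * (\<Prod>b\<in>P - C. qf p (insert s C) b) * qf p (insert s C) t"
      using P by (simp add: mult_ac)
  qed
  finally show ?thesis .
qed

text \<open>The vertex \<open>y\<close> is pivotal as soon as the cluster \<open>A\<close> of \<open>g\<close> misses \<open>r\<close>, sees \<open>y\<close>, and \<open>y\<close> is
  joined to \<open>r\<close> off \<open>A\<close>; given \<open>A\<close> these events live on disjoint sets of edges.\<close>

lemma con_pivotal:
  assumes P: "finite P" "g \<notin> P" "r \<notin> P" "y \<notin> P" "g \<noteq> r" "g \<noteq> y" "r \<noteq> y"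
  shows "con p (insert g (insert r P)) r g +
     (\<Sum>A\<in>Pow P. kap p g A * (\<Prod>b\<in>P - A. qf p (insert g A) b) * qf p (insert g A) r *
        ((1 - qf p (insert g A) y) * con p (insert r (insert y (P - A))) r y))
     \<le> con p (insert g (insert r (insert y P))) r g"
proof -
  define R where "R = (\<lambda>A \<omega>. reach p \<omega> (insert r (insert y (P - A))) r y)"
  define K where "K = (\<lambda>A \<omega>. noadj p {r} (insert g A) \<omega> \<and> \<not> noadj p {y} (insert g A) \<omega> \<and> R A \<omega>)"
  have fA: "finite A" if "A \<subseteq> P" for A using that P finite_subset by auto
  have mK: "Measurable.pred UM (K A)" if "A \<subseteq> P" for A
    using fA[OF that] unfolding K_def R_def
    by (intro pred_intros_logic pred_noadj pred_reach) auto
  have "(\<Sum>A\<in>Pow P. kap p g A * (\<Prod>b\<in>P - A. qf p (insert g A) b) * qf p (insert g A) r *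
        ((1 - qf p (insert g A) y) * con p (insert r (insert y (P - A))) r y)) =
     (\<Sum>A\<in>Pow P. prU (\<lambda>\<omega>. cluster_is p g P A \<omega> \<and> K A \<omega>))"
  proof (intro sum.cong refl)
    fix A assume A: "A \<in> Pow P"
    \<comment> \<open>That \<open>r\<close> does not see the cluster is absorbed into the condition
      on the unexplored vertices, which brings the event into the form of
      \<open>prU_four\<close>.\<close>
    have "prU (\<lambda>\<omega>. cluster_is p g P A \<omega> \<and> K A \<omega>) =
      prU (\<lambda>\<omega>. (spans p g A \<omega> \<and> noadj p (insert r (P - A)) (insert g A) \<omega>) \<and> \<not> noadj p {y} (insert g A) \<omega> \<and> R A \<omega>)"
      by (intro arg_cong[where f="measure UM"]) (auto simp: cluster_is_def noadj_def K_def)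
    also have "\<dots> = kap p g A * (\<Prod>b\<in>insert r (P - A). qf p (insert g A) b) * ((1 - qf p (insert g A) y) * prU (R A))"
      by (rule prU_four[where V="insert r (insert y (P - A))"])
         (use A P fA[of A] in \<open>auto simp: R_def intro!: depends_reach\<close>)
    finally show "kap p g A * (\<Prod>b\<in>P - A. qf p (insert g A) b) * qf p (insert g A) r *
        ((1 - qf p (insert g A) y) * con p (insert r (insert y (P - A))) r y) =
        prU (\<lambda>\<omega>. cluster_is p g P A \<omega> \<and> K A \<omega>)"
      using P by (simp add: con_def R_def mult_ac)
  qed
  also have "\<dots> = prU (\<lambda>\<omega>. \<exists>A\<in>Pow P. cluster_is p g P A \<omega> \<and> K A \<omega>)"
    by (rule prU_cluster_sum) (use P mK in auto)
  also have "\<dots> \<le> measure UM ({\<omega>. reach p \<omega> (insert g (insert r (insert y P))) r g} - {\<omega>. reach p \<omega> (insert g (insert r P)) r g})"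
  proof (rule UM.finite_measure_mono)
    show "{\<omega>. reach p \<omega> (insert g (insert r (insert y P))) r g} - {\<omega>. reach p \<omega> (insert g (insert r P)) r g} \<in> UM.events"
      by (intro sets.Diff) (auto simp: pred_UM[symmetric])
    show "{\<omega>. \<exists>A\<in>Pow P. cluster_is p g P A \<omega> \<and> K A \<omega>} \<subseteq> {\<omega>. reach p \<omega> (insert g (insert r (insert y P))) r g} - {\<omega>. reach p \<omega> (insert g (insert r P)) r g}"
    proof safe
      fix \<omega> A assume A: "A \<subseteq> P" and c: "cluster_is p g P A \<omega>" and K: "K A \<omega>"
      { assume "reach p \<omega> (insert g (insert r P)) r g"
        then have "reach p \<omega> (insert g (insert r P)) g r" by (rule reach_sym1)
        with reach_cluster_iff[OF c P(3)] P A K show False by (auto simp: K_def) }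
      from K obtain d where d: "d \<in> insert g A" "\<omega> {y, d} \<le> p y d" by (auto simp: K_def noadj_def)
      have "reach p \<omega> (insert g A) g d" using c d by (auto simp: cluster_is_def spans_def)
      then have "reach p \<omega> (insert g (insert r (insert y P))) d g"
        by (rule reach_sym1[OF reach_mono]) (use A in auto)
      moreover have "gadj p \<omega> (insert g (insert r (insert y P))) y d"
        using d P A by (auto simp: gadj_def)
      moreover have "reach p \<omega> (insert g (insert r (insert y P))) r y"
        using K unfolding K_def R_def by (auto elim: reach_mono)
      ultimately show "reach p \<omega> (insert g (insert r (insert y P))) r g"
        by (meson rtranclp.rtrancl_into_rtrancl rtranclp_trans)
    qed
  qed
  also have "\<dots> = con p (insert g (insert r (insert y P))) r g - con p (insert g (insert r P)) r g"
    unfolding con_def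
    by (rule UM.finite_measure_Diff) (auto simp: pred_UM[symmetric] elim!: reach_mono)
  finally show ?thesis by simp
qed

text \<open>Last-exit decomposition. Let \<open>C\<close> be the cluster of \<open>r\<close> among
  the vertices of \<open>A\<close>. As \<open>g\<close> has no edge to \<open>insert r A\<close>, a
  path to \<open>g\<close> leaves \<open>insert r C\<close> for the last time towards a vertex
  \<open>y\<close> outside \<open>A\<close>, and from there continues without touching
  \<open>insert r C\<close>. A union bound over \<open>C\<close> and \<open>y\<close>, with
  independence on disjoint edge sets, gives the right-hand side.\<close>

lemma con_le_exit:
  assumes P: "finite P" "A \<subseteq> P" "g \<notin> P" "r \<notin> P" "g \<noteq> r"
    and noedge: "\<And>a. a \<in> insert r A \<Longrightarrow> p a g = 0"
  shows "con p (insert g (insert r P)) r g \<le>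
    (\<Sum>C\<in>Pow A. kap p r C * (\<Prod>b\<in>A - C. qf p (insert r C) b) *
        (\<Sum>y\<in>P - A. (1 - qf p (insert r C) y) * con p (insert g (P - C)) y g))"
proof -
  define R where "R = (\<lambda>C y \<omega>. reach p \<omega> (insert g (P - C)) y g)"
  define K where "K = (\<lambda>C y \<omega>. (spans p r C \<omega> \<and> noadj p (A - C) (insert r C) \<omega>) \<and> \<not> noadj p {y} (insert r C) \<omega> \<and> R C y \<omega>)"
  have fin: "finite A" using P finite_subset by auto
  have fC: "finite C" if "C \<subseteq> A" for C using that fin finite_subset by auto
  have mK: "{\<omega>. K C y \<omega>} \<in> sets UM" if "C \<subseteq> A" for C y
    using fC[OF that] fin unfolding K_def R_def by (subst pred_UM[symmetric]) measurable
  have "AE \<omega> in UM. \<forall>e\<in>(\<lambda>a. {a, g}) ` insert r A. \<omega> e > (0::real)"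
    by (rule AE_pos) (use fin in auto)
  then have "AE \<omega> in UM. \<omega> \<in> {\<omega>. reach p \<omega> (insert g (insert r P)) r g} \<longrightarrow> \<omega> \<in> (\<Union>C\<in>Pow A. \<Union>y\<in>P - A. {\<omega>. K C y \<omega>})"
  proof eventually_elim
    case (elim \<omega>)
    show ?case
    proof
      assume "\<omega> \<in> {\<omega>. reach p \<omega> (insert g (insert r P)) r g}"
      then have reach: "reach p \<omega> (insert g (insert r P)) r g" by simp
      obtain C where C: "C \<subseteq> A" "cluster_is p r A C \<omega>"
        using cluster_exists[of r A \<omega>] P by auto
      \<comment> \<open>Whenever the path returns to the cluster the witness is forgotten, so the
        one that survives to the end comes right after the last visit.\<close>
      have "v \<in> insert r C \<or> (\<exists>y\<in>P - A. \<not> noadj p {y} (insert r C) \<omega> \<and> reach p \<omega> (insert g (P - C)) y v)"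
        if "reach p \<omega> (insert g (insert r P)) r v" for v
        using that
      proof (induction rule: rtranclp_induct)
        case (step v w)
        show ?case
        proof (cases "w \<in> insert r C")
          case False
          from step have vw: "\<omega> {v, w} \<le> p v w" "w \<in> insert g (insert r P)" "v \<noteq> w" by (auto simp: gadj_def)
          show ?thesis
          proof (cases "v \<in> insert r C")
            case True
            have "w \<noteq> g" using elim vw True noedge[of v] C by force
            moreover have "w \<notin> A" 
            proof
              assume "w \<in> A"
              with C(2) False True have "\<not> \<omega> {w, v} \<le> p w v" by (auto simp: cluster_is_def noadj_def)
              with vw(1) show False by (simp add: insert_commute p_sym)
            qed
            ultimately have "w \<in> P - A" using vw False by auto
            moreover have "\<not> noadj p {w} (insert r C) \<omega>"
              using True vw by (auto simp: noadj_def insert_commute p_sym)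
            ultimately show ?thesis by blast
          next
            case v: False
            then obtain y where y: "y \<in> P - A" "\<not> noadj p {y} (insert r C) \<omega>" "reach p \<omega> (insert g (P - C)) y v"
              using step.IH by auto
            have "v \<in> insert g (P - C)"
              using reach_stays[OF y(3)] y(1) C by auto
            then have "gadj p \<omega> (insert g (P - C)) v w"
              using vw False P by (auto simp: gadj_def)
            with y show ?thesis by (meson rtranclp.rtrancl_into_rtrancl)
          qed
        qed simp
      qed simp
      from this[OF reach] obtain y where "y \<in> P - A" "\<not> noadj p {y} (insert r C) \<omega>" "reach p \<omega> (insert g (P - C)) y g"
        using C P by auto
      then have "K C y \<omega>" using C by (auto simp: K_def R_def cluster_is_def)
      then show "\<omega> \<in> (\<Union>C\<in>Pow A. \<Union>y\<in>P - A. {\<omega>. K C y \<omega>})"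
        using C \<open>y \<in> P - A\<close> by auto
    qed
  qed
  then have "con p (insert g (insert r P)) r g \<le> measure UM (\<Union>C\<in>Pow A. \<Union>y\<in>P - A. {\<omega>. K C y \<omega>})"
    unfolding con_def
    by (rule UM.finite_measure_mono_AE) (use fin P mK in \<open>auto intro!: sets.finite_UN\<close>)
  also have "\<dots> \<le> (\<Sum>C\<in>Pow A. measure UM (\<Union>y\<in>P - A. {\<omega>. K C y \<omega>}))"
    by (rule UM.finite_measure_subadditive_finite) (use fin P mK in \<open>auto intro!: sets.finite_UN\<close>)
  also have "\<dots> \<le> (\<Sum>C\<in>Pow A. \<Sum>y\<in>P - A. prU (K C y))"
    by (intro sum_mono UM.finite_measure_subadditive_finite) (use fin P mK in auto)
  also have "\<dots> = (\<Sum>C\<in>Pow A. kap p r C * (\<Prod>b\<in>A - C. qf p (insert r C) b) *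
        (\<Sum>y\<in>P - A. (1 - qf p (insert r C) y) * con p (insert g (P - C)) y g))"
  proof (intro sum.cong refl)
    fix C assume C: "C \<in> Pow A"
    have "prU (K C y) = kap p r C * (\<Prod>b\<in>A - C. qf p (insert r C) b) * ((1 - qf p (insert r C) y) * con p (insert g (P - C)) y g)"
      if y: "y \<in> P - A" for y
      unfolding K_def con_def R_def
      by (rule prU_four[where V="insert g (P - C)"])
         (use C P y fC[of C] fin in \<open>auto intro!: depends_reach\<close>)
    then show "(\<Sum>y\<in>P - A. prU (K C y)) = kap p r C * (\<Prod>b\<in>A - C. qf p (insert r C) b) *
        (\<Sum>y\<in>P - A. (1 - qf p (insert r C) y) * con p (insert g (P - C)) y g)"
      by (simp add: sum_distrib_left)
  qed
  finally show ?thesis .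
qed

end

subsection \<open>Poisson expectations over a finite window\<close>

abbreviation SQ :: "'a measure \<Rightarrow> (nat \<Rightarrow> 'a) measure" where
  "SQ M \<equiv> PiM UNIV (\<lambda>_::nat. M)"

text \<open>Up to the factor \<open>exp (- L)\<close>, the expectation of \<open>F\<close> over a Poisson process with intensity measure
  \<open>L\<close> times \<open>M\<close>, the \<open>n\<close> points being the first \<open>n\<close> entries of an i.i.d. sequence with law \<open>M\<close>.\<close>

definition PE :: "real \<Rightarrow> 'a measure \<Rightarrow> (nat \<Rightarrow> (nat \<Rightarrow> 'a) \<Rightarrow> ennreal) \<Rightarrow> ennreal" where
  "PE L M F = (\<Sum>n. ennreal (L ^ n / fact n) * (\<integral>\<^sup>+x. F n x \<partial>SQ M))"

lemma suminf_swap_ennreal: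
  fixes f :: "nat \<Rightarrow> nat \<Rightarrow> ennreal"
  shows "(\<Sum>i. \<Sum>j. f i j) = (\<Sum>j. \<Sum>i. f i j)"
proof -
  have "(\<Sum>i. \<Sum>j. f i j) = (\<integral>\<^sup>+i. (\<Sum>j. f i j) \<partial>count_space UNIV)"
    by (simp add: nn_integral_count_space_nat)
  also have "\<dots> = (\<Sum>j. (\<integral>\<^sup>+i. f i j \<partial>count_space UNIV))"
    by (rule nn_integral_suminf) simp
  finally show ?thesis by (simp add: nn_integral_count_space_nat)
qed

lemma suminf_triangle_ennreal:
  fixes a :: "nat \<Rightarrow> nat \<Rightarrow> ennreal"
  shows "(\<Sum>n. \<Sum>k\<le>n. a k (n - k)) = (\<Sum>k. \<Sum>m. a k m)"
proof -
  have "(\<Sum>n. \<Sum>k\<le>n. a k (n - k)) = (\<Sum>n. \<Sum>k. if k \<le> n then a k (n - k) else 0)"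
  proof (intro suminf_cong)
    fix n
    have "(\<Sum>k. if k \<le> n then a k (n - k) else 0) = (\<Sum>k\<le>n. if k \<le> n then a k (n - k) else 0)"
      by (rule suminf_finite) auto
    then show "(\<Sum>k\<le>n. a k (n - k)) = (\<Sum>k. if k \<le> n then a k (n - k) else 0)" by simp
  qed
  also have "\<dots> = (\<Sum>k. \<Sum>n. if k \<le> n then a k (n - k) else 0)" by (rule suminf_swap_ennreal)
  also have "\<dots> = (\<Sum>k. \<Sum>m. a k m)"
  proof (rule suminf_cong)
    fix k
    have "(\<Sum>n. if k \<le> n then a k (n - k) else 0) =
       (\<Sum>i<k. if k \<le> i then a k (i - k) else 0) + (\<Sum>i. if k \<le> i + k then a k (i + k - k) else 0)"
      by (subst suminf_offset[where i=k]) auto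
    then show "(\<Sum>n. if k \<le> n then a k (n - k) else 0) = (\<Sum>m. a k m)" by simp
  qed
  finally show ?thesis .
qed

locale iid_seq = M: prob_space M for M :: "'a measure" +
  assumes space_M[simp]: "space M = UNIV"
begin

sublocale SQ: sequence_space M by unfold_locales

lemma space_SQ[simp]: "space (SQ M) = UNIV" by (simp add: space_PiM)

lemma nn_integral_SQ_iter:
  assumes [measurable]: "F \<in> borel_measurable (SQ M)"
  shows "(\<integral>\<^sup>+x. F x \<partial>SQ M) = (\<integral>\<^sup>+y. \<integral>\<^sup>+x. F (case_nat y x) \<partial>SQ M \<partial>M)"
proof -
  have m: "(\<lambda>(s, \<omega>). case_nat s \<omega>) \<in> measurable (M \<Otimes>\<^sub>M SQ M) (SQ M)" by measurable
  have "(\<integral>\<^sup>+x. F x \<partial>SQ M) = (\<integral>\<^sup>+x. F x \<partial>distr (M \<Otimes>\<^sub>M SQ M) (SQ M) (\<lambda>(s, \<omega>). case_nat s \<omega>))"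
    by (simp add: SQ.PiM_iter)
  also have "\<dots> = (\<integral>\<^sup>+z. F ((\<lambda>(s, \<omega>). case_nat s \<omega>) z) \<partial>(M \<Otimes>\<^sub>M SQ M))"
    by (rule nn_integral_distr[OF m]) simp
  also have "\<dots> = (\<integral>\<^sup>+y. \<integral>\<^sup>+x. F (case_nat y x) \<partial>SQ M \<partial>M)"
    by (subst SQ.nn_integral_fst[symmetric]) (auto simp: split_beta')
  finally show ?thesis .
qed

lemma nn_integral_SQ_comb:
  assumes [measurable]: "F \<in> borel_measurable (SQ M)"
  shows "(\<integral>\<^sup>+x. F x \<partial>SQ M) = (\<integral>\<^sup>+x. \<integral>\<^sup>+x'. F (comb_seq k x x') \<partial>SQ M \<partial>SQ M)"
proof -
  have "(\<integral>\<^sup>+x. F x \<partial>SQ M) = (\<integral>\<^sup>+x. F x \<partial>distr (SQ M \<Otimes>\<^sub>M SQ M) (SQ M) (\<lambda>(\<omega>, \<omega>'). comb_seq k \<omega> \<omega>'))"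
    by (simp add: SQ.PiM_comb_seq)
  also have "\<dots> = (\<integral>\<^sup>+z. F ((\<lambda>(\<omega>, \<omega>'). comb_seq k \<omega> \<omega>') z) \<partial>(SQ M \<Otimes>\<^sub>M SQ M))"
    by (rule nn_integral_distr[OF measurable_comb_seq]) simp
  also have "\<dots> = (\<integral>\<^sup>+x. \<integral>\<^sup>+x'. F (comb_seq k x x') \<partial>SQ M \<partial>SQ M)"
    by (subst SQ.nn_integral_fst[symmetric]) (auto simp: split_beta')
  finally show ?thesis .
qed

lemma nn_integral_SQ_component:
  assumes [measurable]: "g \<in> borel_measurable M"
  shows "(\<integral>\<^sup>+x. g (x i) \<partial>SQ M) = (\<integral>\<^sup>+y. g y \<partial>M)"
proof -
  have "(\<integral>\<^sup>+y. g y \<partial>M) = (\<integral>\<^sup>+y. g y \<partial>distr (SQ M) M (\<lambda>x. x i))"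
    using distr_PiM_component[of UNIV "\<lambda>_. M" i] M.prob_space_axioms by simp
  also have "\<dots> = (\<integral>\<^sup>+x. g (x i) \<partial>SQ M)"
    by (rule nn_integral_distr) simp_all
  finally show ?thesis ..
qed

lemma emeasure_SQ_UNIV[simp]: "emeasure (SQ M) UNIV = 1"
  using SQ.P.emeasure_space_1 by simp

section \<open>Mecke equations\<close>

text \<open>The bijection is the identity beyond \<open>n\<close>, so that it permutes all indices
  of an infinite sequence and can be applied to the whole i.i.d. sequence.\<close>

lemma split_bij:
  assumes "A \<subseteq> {..<n::nat}" "card A = k"
  obtains \<pi> where "bij \<pi>" "\<pi> ` {..<k} = A" "\<pi> ` {k..<n} = {..<n} - A"
proof -
  have fA: "finite A" using assms finite_subset by blast
  have kn: "k \<le> n" using assms card_mono[of "{..<n}" A] by simp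
  obtain f where f: "bij_betw f {..<k} A"
    using finite_same_card_bij[of "{..<k}" A] fA assms by auto
  have "card {k..<n} = card ({..<n} - A)" using assms fA by (simp add: card_Diff_subset)
  then obtain g where g: "bij_betw g {k..<n} ({..<n} - A)"
    using finite_same_card_bij[of "{k..<n}" "{..<n} - A"] by auto
  define \<pi> where "\<pi> i = (if i < k then f i else if i < n then g i else i)" for i
  have 1: "bij_betw \<pi> {..<k} A" using f by (subst bij_betw_cong[of _ _ f]) (auto simp: \<pi>_def)
  have 2: "bij_betw \<pi> {k..<n} ({..<n} - A)" using g by (subst bij_betw_cong[of _ _ g]) (auto simp: \<pi>_def)
  have 3: "bij_betw \<pi> {n..} {n..}"
    using kn by (subst bij_betw_cong[of _ _ id]) (auto simp: \<pi>_def id_def[symmetric])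
  have "bij_betw \<pi> ({..<k} \<union> {k..<n} \<union> {n..}) (A \<union> ({..<n} - A) \<union> {n..})"
    using assms by (intro bij_betw_combine 1 2 3) auto
  moreover have "{..<k} \<union> {k..<n} \<union> {n..} = UNIV" "A \<union> ({..<n} - A) \<union> {n..} = UNIV"
    using kn assms by auto
  ultimately have "bij \<pi>" by simp
  with 1 2 show ?thesis by (intro that[of \<pi>]) (auto simp: bij_betw_def)
qed

text \<open>By exchangeability a subset of size \<open>k\<close> contributes the same as
  \<open>{..<k}\<close>, and \<open>n choose k\<close> such subsets turn
  \<open>L ^ n / fact n\<close> into \<open>L ^ k / fact k * (L ^ (n - k) / fact (n - k))\<close>.
  The sum over all splittings of one process thus becomes an integral over two independent
  processes. Since \<open>PE\<close> carries no factor \<open>exp (- L)\<close>, the inner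
  \<open>PE\<close> is \<open>exp L\<close> times an expectation; every exponential that appears
  later comes from this.\<close>

lemma mecke_split:
  fixes u :: "nat set \<Rightarrow> nat set \<Rightarrow> (nat \<Rightarrow> 'a) \<Rightarrow> ennreal"
  assumes L: "0 \<le> L"
    and meas: "\<And>A B. finite A \<Longrightarrow> finite B \<Longrightarrow> u A B \<in> borel_measurable (SQ M)"
    and sym: "\<And>\<pi> A B x. bij \<pi> \<Longrightarrow> finite A \<Longrightarrow> finite B \<Longrightarrow> A \<inter> B = {} \<Longrightarrow> u (\<pi> ` A) (\<pi> ` B) x = u A B (\<lambda>i. x (\<pi> i))"
  shows "PE L M (\<lambda>n x. \<Sum>A\<in>Pow {..<n}. u A ({..<n} - A) x) =
    PE L M (\<lambda>k x. PE L M (\<lambda>m x'. u {..<k} {k..<k+m} (comb_seq k x x')))"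
proof -
  define U where "U k m = (\<integral>\<^sup>+x. u {..<k} {k..<k+m} x \<partial>SQ M)" for k m
  have intA: "(\<integral>\<^sup>+x. u A ({..<n} - A) x \<partial>SQ M) = U (card A) (n - card A)" if A: "A \<subseteq> {..<n}" for A n
  proof -
    define k where "k = card A"
    obtain \<pi> where \<pi>: "bij \<pi>" "\<pi> ` {..<k} = A" "\<pi> ` {k..<n} = {..<n} - A"
      using split_bij[OF A] k_def by metis
    have kn: "k + (n - k) = n" using card_mono[of "{..<n}" A] A by (simp add: k_def)
    have "(\<integral>\<^sup>+x. u A ({..<n} - A) x \<partial>SQ M) = (\<integral>\<^sup>+x. u (\<pi> ` {..<k}) (\<pi> ` {k..<n}) x \<partial>SQ M)"
      by (simp add: \<pi>)
    also have "\<dots> = (\<integral>\<^sup>+x. u {..<k} {k..<n} (\<lambda>i. x (\<pi> i)) \<partial>SQ M)"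
      by (subst sym[OF \<pi>(1)]) auto
    also have "\<dots> = (\<integral>\<^sup>+x. u {..<k} {k..<n} x \<partial>SQ M)"
      by (rule nn_integral_PiM_reindex[where I=UNIV, symmetric])
         (use \<pi> in \<open>auto simp: M.prob_space_axioms depends_def bij_def intro!: meas arg_cong[where f="u _ _"]\<close>)
    finally show ?thesis by (simp add: U_def k_def[symmetric] kn)
  qed
  have "PE L M (\<lambda>n x. \<Sum>A\<in>Pow {..<n}. u A ({..<n} - A) x) =
    (\<Sum>n. ennreal (L ^ n / fact n) * (\<Sum>A\<in>Pow {..<n}. U (card A) (n - card A)))"
    unfolding PE_def
  proof (rule suminf_cong)
    fix n
    have "(\<integral>\<^sup>+x. (\<Sum>A\<in>Pow {..<n}. u A ({..<n} - A) x) \<partial>SQ M) = (\<Sum>A\<in>Pow {..<n}. (\<integral>\<^sup>+x. u A ({..<n} - A) x \<partial>SQ M))"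
      by (rule nn_integral_sum, rule meas) (auto intro: finite_subset)
    also have "\<dots> = (\<Sum>A\<in>Pow {..<n}. U (card A) (n - card A))"
      by (rule sum.cong[OF refl], rule intA) simp
    finally show "ennreal (L ^ n / fact n) * (\<integral>\<^sup>+x. (\<Sum>A\<in>Pow {..<n}. u A ({..<n} - A) x) \<partial>SQ M) =
      ennreal (L ^ n / fact n) * (\<Sum>A\<in>Pow {..<n}. U (card A) (n - card A))" by simp
  qed
  also have "\<dots> = (\<Sum>n. \<Sum>k\<le>n. ennreal (L ^ k / fact k) * (ennreal (L ^ (n - k) / fact (n - k)) * U k (n - k)))"
  proof (intro suminf_cong)
    fix n
    have "(\<Sum>A\<in>Pow {..<n}. U (card A) (n - card A)) =
      (\<Sum>k\<in>{..n}. \<Sum>A\<in>{A\<in>Pow {..<n}. card A = k}. U (card A) (n - card A))"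
      by (rule sum.group[symmetric]) (auto intro: card_mono[of "{..<n}", simplified])
    also have "\<dots> = (\<Sum>k\<le>n. of_nat (n choose k) * U k (n - k))"
      by (intro sum.cong refl) (use n_subsets[of "{..<n}"] in auto)
    finally have 1: "(\<Sum>A\<in>Pow {..<n}. U (card A) (n - card A)) = (\<Sum>k\<le>n. of_nat (n choose k) * U k (n - k))" .
    have 2: "ennreal (L ^ n / fact n) * of_nat (n choose k) = ennreal (L ^ k / fact k) * ennreal (L ^ (n - k) / fact (n - k))"
      if "k \<le> n" for k
    proof -
      have "ennreal (L ^ n / fact n) * of_nat (n choose k) = ennreal (L ^ n / fact n * of_nat (n choose k))"
        using L by (simp add: ennreal_mult ennreal_of_nat_eq_real_of_nat del: times_divide_eq_left times_divide_eq_right)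
      also have "L ^ n / fact n * of_nat (n choose k) = (L ^ k / fact k) * (L ^ (n - k) / fact (n - k))"
        using that by (simp add: binomial_fact power_add[symmetric] field_simps)
      finally show ?thesis using L by (simp add: ennreal_mult del: times_divide_eq_left times_divide_eq_right times_divide_times_eq)
    qed
    show "ennreal (L ^ n / fact n) * (\<Sum>A\<in>Pow {..<n}. U (card A) (n - card A)) =
      (\<Sum>k\<le>n. ennreal (L ^ k / fact k) * (ennreal (L ^ (n - k) / fact (n - k)) * U k (n - k)))"
      unfolding 1 sum_distrib_left
      by (intro sum.cong refl) (simp add: mult.assoc[symmetric] 2)
  qed
  also have "\<dots> = (\<Sum>k. \<Sum>m. ennreal (L ^ k / fact k) * (ennreal (L ^ m / fact m) * U k m))"
    by (rule suminf_triangle_ennreal)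
  also have "\<dots> = (\<Sum>k. ennreal (L ^ k / fact k) * (\<Sum>m. ennreal (L ^ m / fact m) * U k m))"
    by simp
  also have "\<dots> = PE L M (\<lambda>k x. PE L M (\<lambda>m x'. u {..<k} {k..<k+m} (comb_seq k x x')))"
    unfolding PE_def
  proof (intro suminf_cong arg_cong2[where f="(*)"] refl)
    fix k
    have [measurable]: "u {..<k} {k..<k+m} \<in> borel_measurable (SQ M)" for m by (rule meas) auto
    have "(\<integral>\<^sup>+x. (\<Sum>m. ennreal (L ^ m / fact m) * (\<integral>\<^sup>+x'. u {..<k} {k..<k+m} (comb_seq k x x') \<partial>SQ M)) \<partial>SQ M) =
        (\<Sum>m. (\<integral>\<^sup>+x. ennreal (L ^ m / fact m) * (\<integral>\<^sup>+x'. u {..<k} {k..<k+m} (comb_seq k x x') \<partial>SQ M) \<partial>SQ M))"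
      by (rule nn_integral_suminf) measurable
    also have "\<dots> = (\<Sum>m. ennreal (L ^ m / fact m) * (\<integral>\<^sup>+x. \<integral>\<^sup>+x'. u {..<k} {k..<k+m} (comb_seq k x x') \<partial>SQ M \<partial>SQ M))"
      by (intro suminf_cong nn_integral_cmult) measurable
    also have "\<dots> = (\<Sum>m. ennreal (L ^ m / fact m) * U k m)"
      unfolding U_def by (intro suminf_cong arg_cong2[where f="(*)"] refl nn_integral_SQ_comb[symmetric]) measurable
    finally show "(\<Sum>m. ennreal (L ^ m / fact m) * U k m) =
      (\<integral>\<^sup>+x. (\<Sum>m. ennreal (L ^ m / fact m) * (\<integral>\<^sup>+x'. u {..<k} {k..<k+m} (comb_seq k x x') \<partial>SQ M)) \<partial>SQ M)" ..
  qed
  finally show ?thesis .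
qed

lemma PE_mono:
  assumes "\<And>n x. F n x \<le> G n x"
  shows "PE L M F \<le> PE L M G"
  unfolding PE_def using assms by (intro suminf_le mult_left_mono nn_integral_mono) auto

lemma PE_cmult:
  assumes [measurable]: "\<And>n. F n \<in> borel_measurable (SQ M)"
  shows "PE L M (\<lambda>n x. c * F n x) = c * PE L M F"
proof -
  have "PE L M (\<lambda>n x. c * F n x) = (\<Sum>n. c * (ennreal (L ^ n / fact n) * (\<integral>\<^sup>+x. F n x \<partial>SQ M)))"
    unfolding PE_def by (intro suminf_cong) (simp add: nn_integral_cmult mult_ac)
  then show ?thesis by (simp add: PE_def)
qed

lemma PE_add:
  assumes [measurable]: "\<And>n. F n \<in> borel_measurable (SQ M)" "\<And>n. G n \<in> borel_measurable (SQ M)"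
  shows "PE L M (\<lambda>n x. F n x + G n x) = PE L M F + PE L M G"
  unfolding PE_def by (simp add: nn_integral_add distrib_left suminf_add[symmetric])

lemma PE_nn_integral:
  assumes N: "sigma_finite_measure N" and [measurable]: "\<And>n. (\<lambda>(y, x). F y n x) \<in> borel_measurable (N \<Otimes>\<^sub>M SQ M)"
  shows "PE L M (\<lambda>n x. \<integral>\<^sup>+y. F y n x \<partial>N) = (\<integral>\<^sup>+y. PE L M (F y) \<partial>N)"
proof -
  interpret N: sigma_finite_measure N by fact
  interpret P: pair_sigma_finite N "SQ M" by unfold_locales
  have "PE L M (\<lambda>n x. \<integral>\<^sup>+y. F y n x \<partial>N) = (\<Sum>n. (\<integral>\<^sup>+y. ennreal (L ^ n / fact n) * (\<integral>\<^sup>+x. F y n x \<partial>SQ M) \<partial>N))"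
    unfolding PE_def
  proof (intro suminf_cong)
    fix n
    have "(\<integral>\<^sup>+x. \<integral>\<^sup>+y. F y n x \<partial>N \<partial>SQ M) = (\<integral>\<^sup>+y. \<integral>\<^sup>+x. F y n x \<partial>SQ M \<partial>N)"
      by (rule P.Fubini') simp
    then show "ennreal (L ^ n / fact n) * (\<integral>\<^sup>+x. \<integral>\<^sup>+y. F y n x \<partial>N \<partial>SQ M) =
      (\<integral>\<^sup>+y. ennreal (L ^ n / fact n) * (\<integral>\<^sup>+x. F y n x \<partial>SQ M) \<partial>N)"
      by (subst nn_integral_cmult) simp_all
  qed
  also have "\<dots> = (\<integral>\<^sup>+y. PE L M (F y) \<partial>N)"
    unfolding PE_def by (rule nn_integral_suminf[symmetric]) measurable
  finally show ?thesis .
qed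

lemma measurable_PE[measurable (raw)]:
  assumes [measurable]: "\<And>n. (\<lambda>(y, x). F y n x) \<in> borel_measurable (N \<Otimes>\<^sub>M SQ M)"
  shows "(\<lambda>y. PE L M (F y)) \<in> borel_measurable N"
  unfolding PE_def by measurable

text \<open>The classical Mecke equation: a sum over the points of the process is an integral over
  the location of one added point.\<close>

lemma mecke_one:
  fixes v :: "nat \<Rightarrow> nat set \<Rightarrow> (nat \<Rightarrow> 'a) \<Rightarrow> ennreal"
  assumes L: "0 \<le> L"
    and meas: "\<And>j B. finite B \<Longrightarrow> v j B \<in> borel_measurable (SQ M)"
    and sym: "\<And>\<pi> j B x. bij \<pi> \<Longrightarrow> finite B \<Longrightarrow> j \<notin> B \<Longrightarrow> v (\<pi> j) (\<pi> ` B) x = v j B (\<lambda>i. x (\<pi> i))"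
  shows "PE L M (\<lambda>n x. \<Sum>j<n. v j ({..<n} - {j}) x) =
    ennreal L * (\<integral>\<^sup>+y. PE L M (\<lambda>m x'. v 0 {1..<1+m} (case_nat y x')) \<partial>M)"
proof -
  \<comment> \<open>With a weight supported on singletons, only the term \<open>k = 1\<close> of the
    outer series survives.\<close>
  define u where "u A B x = (if is_singleton A then v (the_elem A) B x else 0)" for A B x
  have "(\<Sum>j<n. v j ({..<n} - {j}) x) = (\<Sum>A\<in>Pow {..<n}. u A ({..<n} - A) x)" for n x
  proof -
    have "(\<Sum>A\<in>Pow {..<n}. u A ({..<n} - A) x) = (\<Sum>A\<in>(\<lambda>j. {j}) ` {..<n}. u A ({..<n} - A) x)"
      by (rule sum.mono_neutral_right) (auto simp: u_def is_singleton_def)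
    also have "\<dots> = (\<Sum>j<n. v j ({..<n} - {j}) x)"
      by (subst sum.reindex) (auto simp: u_def)
    finally show ?thesis ..
  qed
  then have "PE L M (\<lambda>n x. \<Sum>j<n. v j ({..<n} - {j}) x) = PE L M (\<lambda>n x. \<Sum>A\<in>Pow {..<n}. u A ({..<n} - A) x)"
    by simp
  also have "\<dots> = PE L M (\<lambda>k x. PE L M (\<lambda>m x'. u {..<k} {k..<k+m} (comb_seq k x x')))"
  proof (rule mecke_split[OF L])
    show "u A B \<in> borel_measurable (SQ M)" if "finite A" "finite B" for A B
      using meas[OF that(2)] by (cases "is_singleton A") (auto simp: u_def[abs_def])
    show "u (\<pi> ` A) (\<pi> ` B) x = u A B (\<lambda>i. x (\<pi> i))" if "bij \<pi>" "finite A" "finite B" "A \<inter> B = {}" for \<pi> A B x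
    proof (cases "is_singleton A")
      case True
      then obtain j where "A = {j}" by (auto simp: is_singleton_def)
      with that show ?thesis by (simp add: u_def sym)
    next
      case False
      have "inj_on \<pi> A" using that(1) by (auto simp: bij_def intro: inj_on_subset)
      then have "\<not> is_singleton (\<pi> ` A)" using False by (simp add: is_singleton_altdef card_image)
      with False show ?thesis by (simp add: u_def)
    qed
  qed
  also have "\<dots> = (\<Sum>k. if k = 1 then ennreal L * (\<integral>\<^sup>+x. PE L M (\<lambda>m x'. v 0 {1..<1+m} (case_nat (x 0) x')) \<partial>SQ M) else 0)"
    unfolding PE_def[of L M "\<lambda>k x. PE L M (F k x)" for F]
  proof (intro suminf_cong)
    fix k
    have "is_singleton {..<k} \<longleftrightarrow> k = 1" for k :: nat unfolding is_singleton_altdef by simp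
    moreover have "the_elem {..<Suc 0} = 0" by (simp add: lessThan_Suc)
    ultimately show "ennreal (L ^ k / fact k) * (\<integral>\<^sup>+x. PE L M (\<lambda>m x'. u {..<k} {k..<k+m} (comb_seq k x x')) \<partial>SQ M) =
      (if k = 1 then ennreal L * (\<integral>\<^sup>+x. PE L M (\<lambda>m x'. v 0 {1..<1+m} (case_nat (x 0) x')) \<partial>SQ M) else 0)"
      by (auto simp: u_def PE_def)
  qed
  also have "\<dots> = ennreal L * (\<integral>\<^sup>+x. PE L M (\<lambda>m x'. v 0 {1..<1+m} (case_nat (x 0) x')) \<partial>SQ M)"
    by (subst suminf_finite[of "{1}"]) auto
  also have "(\<integral>\<^sup>+x. PE L M (\<lambda>m x'. v 0 {1..<1+m} (case_nat (x 0) x')) \<partial>SQ M) =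
      (\<integral>\<^sup>+y. PE L M (\<lambda>m x'. v 0 {1..<1+m} (case_nat y x')) \<partial>M)"
  proof (rule nn_integral_SQ_component)
    have [measurable]: "v 0 {1..<1+m} \<in> borel_measurable (SQ M)" for m by (rule meas) simp
    show "(\<lambda>y. PE L M (\<lambda>m x'. v 0 {1..<1+m} (case_nat y x'))) \<in> borel_measurable M"
      by measurable
  qed
  finally show ?thesis .
qed

end

section \<open>Change of variables and products over the points\<close>

text \<open>Integrate out one coordinate at a time with \<open>H\<close>, each of which contributes
  a factor \<open>r\<close>. Weights \<open>w\<close> describe thinning and restriction, maps
  \<open>\<tau>\<close> describe translation; one statement covers both.\<close>

lemma nn_integral_SQ_change:
  fixes M1 :: "'b measure" and M2 :: "'a measure"
  assumes "iid_seq M1" "iid_seq M2"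
    and \<tau>[measurable]: "\<tau> \<in> measurable M2 M1" and w[measurable]: "w \<in> borel_measurable M2"
    and H: "\<And>g. g \<in> borel_measurable M1 \<Longrightarrow> (\<integral>\<^sup>+x. w x * g (\<tau> x) \<partial>M2) = r * (\<integral>\<^sup>+x. g x \<partial>M1)"
    and "F \<in> borel_measurable (SQ M1)" "depends {..<k} F"
  shows "(\<integral>\<^sup>+x. (\<Prod>i<k. w (x i)) * F (\<lambda>i. \<tau> (x i)) \<partial>SQ M2) = r ^ k * (\<integral>\<^sup>+x. F x \<partial>SQ M1)"
  using assms(6,7)
proof (induction k arbitrary: F)
  case 0
  interpret M1: iid_seq M1 by fact
  interpret M2: iid_seq M2 by fact
  define c where "c = F (\<lambda>_. undefined)"
  have "F x = c" for x unfolding c_def by (rule dependsD[OF 0(2)]) simp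
  then show ?case by simp
next
  case (Suc k)
  interpret M1: iid_seq M1 by fact
  interpret M2: iid_seq M2 by fact
  note [measurable] = Suc.prems(1)
  have t[measurable]: "(\<lambda>x. (\<lambda>i. \<tau> (x i))) \<in> measurable (SQ M2) (SQ M1)"
    by (rule measurable_PiM_single') (auto simp: space_PiM)
  have Ft[measurable]: "(\<lambda>x. F (\<lambda>i. \<tau> (x i))) \<in> borel_measurable (SQ M2)"
    by (rule measurable_compose[OF t Suc.prems(1)])
  have "(\<integral>\<^sup>+x. (\<Prod>i<Suc k. w (x i)) * F (\<lambda>i. \<tau> (x i)) \<partial>SQ M2) =
    (\<integral>\<^sup>+y. \<integral>\<^sup>+x. (\<Prod>i<Suc k. w (case_nat y x i)) * F (\<lambda>i. \<tau> (case_nat y x i)) \<partial>SQ M2 \<partial>M2)"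
    by (rule M2.nn_integral_SQ_iter) measurable
  also have "\<dots> = (\<integral>\<^sup>+y. w y * (\<integral>\<^sup>+x. (\<Prod>i<k. w (x i)) * F (case_nat (\<tau> y) (\<lambda>i. \<tau> (x i))) \<partial>SQ M2) \<partial>M2)"
  proof (intro nn_integral_cong)
    fix y
    have "(\<lambda>x. F (case_nat (\<tau> y) (\<lambda>i. \<tau> (x i)))) \<in> borel_measurable (SQ M2)"
      by (rule measurable_compose[OF t, of "\<lambda>z. F (case_nat (\<tau> y) z)"]) simp
    then have "(\<lambda>x. (\<Prod>i<k. w (x i)) * F (case_nat (\<tau> y) (\<lambda>i. \<tau> (x i)))) \<in> borel_measurable (SQ M2)"
      by (intro borel_measurable_times_ennreal) measurable
    then have *: "(\<integral>\<^sup>+x. w y * ((\<Prod>i<k. w (x i)) * F (case_nat (\<tau> y) (\<lambda>i. \<tau> (x i)))) \<partial>SQ M2) =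
      w y * (\<integral>\<^sup>+x. (\<Prod>i<k. w (x i)) * F (case_nat (\<tau> y) (\<lambda>i. \<tau> (x i))) \<partial>SQ M2)"
      by (rule nn_integral_cmult)
    have "(\<lambda>i. \<tau> (case_nat y x i)) = case_nat (\<tau> y) (\<lambda>i. \<tau> (x i))" for x
      by (auto simp: fun_eq_iff split: nat.split)
    then show "(\<integral>\<^sup>+x. (\<Prod>i<Suc k. w (case_nat y x i)) * F (\<lambda>i. \<tau> (case_nat y x i)) \<partial>SQ M2) =
      w y * (\<integral>\<^sup>+x. (\<Prod>i<k. w (x i)) * F (case_nat (\<tau> y) (\<lambda>i. \<tau> (x i))) \<partial>SQ M2)"
      by (subst *[symmetric]) (simp add: prod.lessThan_Suc_shift mult.assoc del: prod.lessThan_Suc)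
  qed
  also have "\<dots> = (\<integral>\<^sup>+y. w y * (r ^ k * (\<integral>\<^sup>+x. F (case_nat (\<tau> y) x) \<partial>SQ M1)) \<partial>M2)"
  proof (intro nn_integral_cong arg_cong2[where f="(*)"] refl Suc.IH)
    fix y
    show "(\<lambda>x. F (case_nat (\<tau> y) x)) \<in> borel_measurable (SQ M1)" by measurable
    show "depends {..<k} (\<lambda>x. F (case_nat (\<tau> y) x))"
      unfolding depends_def
    proof (intro allI impI dependsD[OF Suc.prems(2)])
      fix x x' :: "nat \<Rightarrow> 'b" and i assume "\<forall>i\<in>{..<k}. x i = x' i" "i \<in> {..<Suc k}"
      then show "(case i of 0 \<Rightarrow> \<tau> y | Suc m \<Rightarrow> x m) = (case i of 0 \<Rightarrow> \<tau> y | Suc m \<Rightarrow> x' m)"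
        by (auto split: nat.split)
    qed
  qed
  also have "\<dots> = r * (\<integral>\<^sup>+y. r ^ k * (\<integral>\<^sup>+x. F (case_nat y x) \<partial>SQ M1) \<partial>M1)"
    by (rule H) measurable
  also have "\<dots> = r ^ Suc k * (\<integral>\<^sup>+y. \<integral>\<^sup>+x. F (case_nat y x) \<partial>SQ M1 \<partial>M1)"
    by (subst nn_integral_cmult) (simp_all add: mult.assoc)
  also have "\<dots> = r ^ Suc k * (\<integral>\<^sup>+x. F x \<partial>SQ M1)"
    by (subst M1.nn_integral_SQ_iter[symmetric]) simp_all
  finally show ?case .
qed

context iid_seq
begin

lemma nn_integral_SQ_prod:
  assumes [measurable]: "w \<in> borel_measurable M"
  shows "(\<integral>\<^sup>+x. (\<Prod>i<k. w (x i)) \<partial>SQ M) = (\<integral>\<^sup>+y. w y \<partial>M) ^ k"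
proof -
  \<comment> \<open>Changing variables to the one-point space leaves nothing but the
    weights.\<close>
  have R: "iid_seq (return (count_space UNIV) ())"
    by (auto simp: iid_seq_def iid_seq_axioms_def intro: prob_space_return)
  have "(\<integral>\<^sup>+x. (\<Prod>i<k. w (x i)) * 1 \<partial>SQ M) = (\<integral>\<^sup>+y. w y \<partial>M) ^ k * (\<integral>\<^sup>+x. 1 \<partial>SQ (return (count_space UNIV) ()))"
    by (rule nn_integral_SQ_change[OF R _ _ _ _, of M "\<lambda>_. ()" w])
       (auto simp: iid_seq_axioms nn_integral_return nn_integral_multc depends_def)
  then show ?thesis using iid_seq.emeasure_SQ_UNIV[OF R] by (simp add: space_PiM)
qed

text \<open>The generating functional of the Poisson process; with the missing factor
  \<open>exp (- L)\<close> it reads \<open>exp (L * (W - 1))\<close>.\<close>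

lemma PE_prod:
  assumes [measurable]: "w \<in> borel_measurable M" and W: "(\<integral>\<^sup>+y. w y \<partial>M) = ennreal W" "0 \<le> W" and L: "0 \<le> L"
  shows "PE L M (\<lambda>m x. \<Prod>i<m. w (x i)) = ennreal (exp (L * W))"
proof -
  have "PE L M (\<lambda>m x. \<Prod>i<m. w (x i)) = (\<Sum>n. ennreal ((L * W) ^ n / fact n))"
    unfolding PE_def using L W
    by (intro suminf_cong) (simp add: nn_integral_SQ_prod ennreal_power ennreal_mult[symmetric] power_mult_distrib)
  also have "\<dots> = ennreal (exp (L * W))"
    using L W summable_exp_generic[of "L * W"]
    by (subst suminf_ennreal2) (auto simp: exp_def scaleR_conv_of_real field_simps)
  finally show ?thesis .
qed

end

subsection \<open>Connection functionals of point configurations\<close>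

text \<open>\<open>Gh\<close> is a ghost vertex joined to exactly the points of a target set \<open>T\<close>, so that reaching \<open>T\<close> becomes
  a connection event between two vertices; \<open>Pn i\<close> is the \<open>i\<close>-th point of the process.\<close>

datatype lab = Gh | Or | Ex | Pn nat

instance lab :: countable by countable_datatype

fun pp :: "('a::ab_group_add \<Rightarrow> real) \<Rightarrow> 'a set \<Rightarrow> 'a option \<Rightarrow> 'a option \<Rightarrow> real" where
  "pp psi T (Some a) (Some b) = psi (a - b)"
| "pp psi T (Some a) None = indicator T a"
| "pp psi T None (Some a) = indicator T a"
| "pp psi T None None = 0"

fun lpos :: "'a::zero \<Rightarrow> (nat \<Rightarrow> 'a) \<Rightarrow> lab \<Rightarrow> 'a option" where
  "lpos y x Gh = None"
| "lpos y x Or = Some 0"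
| "lpos y x Ex = Some y"
| "lpos y x (Pn i) = Some (x i)"

definition ep :: "('a::ab_group_add \<Rightarrow> real) \<Rightarrow> 'a set \<Rightarrow> 'a \<Rightarrow> (nat \<Rightarrow> 'a) \<Rightarrow> lab \<Rightarrow> lab \<Rightarrow> real" where
  "ep psi T y x a b = pp psi T (lpos y x a) (lpos y x b)"

text \<open>One condition for two properties: with \<open>\<pi>\<close> the identity it says that
  \<open>H\<close> reads only the positions of the points in \<open>A\<close>, and with other
  injections that it ignores their labels. Injectivity on \<open>A\<close> alone is demanded so that
  shifts of blocks of indices are covered besides permutations.\<close>

definition labf :: "(nat set \<Rightarrow> (nat \<Rightarrow> 'a) \<Rightarrow> 'b) \<Rightarrow> bool" where
  "labf H \<longleftrightarrow> (\<forall>A \<pi> x x'. finite A \<longrightarrow> inj_on \<pi> A \<longrightarrow> (\<forall>i\<in>A. x (\<pi> i) = x' i) \<longrightarrow> H (\<pi> ` A) x = H A x')"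

lemma labfD: "labf H \<Longrightarrow> finite A \<Longrightarrow> inj_on \<pi> A \<Longrightarrow> (\<And>i. i \<in> A \<Longrightarrow> x (\<pi> i) = x' i) \<Longrightarrow> H (\<pi> ` A) x = H A x'"
  unfolding labf_def by blast

lemma labf_cong: "labf H \<Longrightarrow> finite A \<Longrightarrow> (\<And>i. i \<in> A \<Longrightarrow> x i = x' i) \<Longrightarrow> H A x = H A x'"
  using labfD[of H A id x x'] by simp

lemma labf_const: "labf (\<lambda>A x. c)"
  by (simp add: labf_def)

lemma labf_map: "labf H \<Longrightarrow> labf (\<lambda>A x. g (H A x))"
  unfolding labf_def by metis

lemma labf_comb: "labf H \<Longrightarrow> labf K \<Longrightarrow> labf (\<lambda>A x. g (H A x) (K A x))"
  unfolding labf_def by metis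

lemma labf_prod: "labf (\<lambda>A x. \<Prod>a\<in>A. g (x a) :: 'b :: comm_monoid_mult)"
  unfolding labf_def by (auto simp: prod.reindex intro!: prod.cong)

lemma comb_lt[simp]: "i < k \<Longrightarrow> comb_seq k x x' i = x i"
  by (simp add: comb_seq_def)

lemma comb_plus[simp]: "comb_seq k x x' (k + i) = x' i"
  by (simp add: comb_seq_def)

lemma labf_comb_left: "labf H \<Longrightarrow> H {..<k} (comb_seq k x x') = H {..<k} x"
  by (rule labf_cong) auto

lemma labf_comb_right: "labf H \<Longrightarrow> H {k..<k+m} (comb_seq k x x') = H {..<m} x'"
proof -
  assume "labf H"
  then have "H ((\<lambda>i. k + i) ` {..<m}) (comb_seq k x x') = H {..<m} x'"
    by (rule labfD) auto
  moreover have "(\<lambda>i. k + i) ` {..<m} = {k..<k+m}"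
    by (simp add: lessThan_atLeast0 image_add_atLeastLessThan add.commute)
  ultimately show ?thesis by simp
qed

lemma labf_case_nat: "labf H \<Longrightarrow> H {1..<1+m} (case_nat y x') = H {..<m} x'"
  using labfD[of H "{..<m}" Suc "case_nat y x'" x'] image_Suc_lessThan[of m]
  by (simp add: atLeastLessThanSuc_atLeastAtMost)

lemma prod_Pow_add:
  fixes f g :: "'i \<Rightarrow> 'b::comm_semiring_1"
  assumes "finite A"
  shows "(\<Sum>E\<in>Pow A. (\<Prod>i\<in>E. f i) * (\<Prod>i\<in>A - E. g i)) = (\<Prod>i\<in>A. f i + g i)"
  using prod_add[OF assms, of f g] by simp

lemma sum_Pow_image: "inj f \<Longrightarrow> (\<Sum>C\<in>Pow (f ` A). g C) = (\<Sum>C\<in>Pow A. g (f ` C))"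
  by (subst sum.reindex[symmetric, where h="(`) f", unfolded o_def])
     (auto simp: inj_on_def inj_image_eq_iff image_Pow_surj[symmetric])

locale rcm =
  fixes psi :: "real ^ ('d::finite) \<Rightarrow> real"
  assumes psi_meas[measurable]: "psi \<in> borel_measurable borel"
    and psi_ge0: "0 \<le> psi x" and psi_le1: "psi x \<le> 1"
    and psi_sym: "psi (- x) = psi x"
    and psi_range: "1 < norm x \<Longrightarrow> psi x = 0"
begin

lemma psi_sym': "psi (a - b) = psi (b - a)"
  using psi_sym[of "b - a"] by simp

lemma edge_prob_pp: "edge_prob (\<lambda>a b :: 'v::countable. pp psi T (l a) (l b))"
proof
  fix a b show "0 \<le> pp psi T (l a) (l b)" "pp psi T (l a) (l b) \<le> 1" "pp psi T (l a) (l b) = pp psi T (l b) (l a)"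
    by (cases "l a"; cases "l b"; auto simp: psi_ge0 psi_le1 psi_sym' intro: psi_sym')+
qed

lemma edge_prob_ep: "edge_prob (ep psi T y x)"
  using edge_prob_pp[of T "lpos y x"] by (simp add: ep_def[abs_def])

lemma con_pp_reindex:
  fixes \<pi> :: "'v::countable \<Rightarrow> 'w::countable"
  assumes "inj_on \<pi> V" "s \<in> V" "t \<in> V" and "\<And>l. l \<in> V \<Longrightarrow> p (\<pi> l) = p' l"
  shows "con (\<lambda>a b. pp psi T (p a) (p b)) (\<pi> ` V) (\<pi> s) (\<pi> t) = con (\<lambda>a b. pp psi T (p' a) (p' b)) V s t"
  using assms by (subst con_reindex) (auto intro!: con_cong)

lemma con_ep_reindex:
  assumes "inj_on \<pi> V" "s \<in> V" "t \<in> V" and "\<And>l. l \<in> V \<Longrightarrow> lpos y x (\<pi> l) = lpos y' x' l"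
  shows "con (ep psi T y x) (\<pi> ` V) (\<pi> s) (\<pi> t) = con (ep psi T y' x') V s t"
  unfolding ep_def[abs_def] by (rule con_pp_reindex) (use assms in auto)

lemma kap_ep_reindex:
  assumes "inj_on \<pi> (insert s C)" "finite C" and "\<And>l. l \<in> insert s C \<Longrightarrow> lpos y x (\<pi> l) = lpos y' x' l"
  shows "kap (ep psi T y x) (\<pi> s) (\<pi> ` C) = kap (ep psi T y' x') s C"
  using assms by (subst kap_reindex) (auto intro!: kap_cong simp: ep_def)

text \<open>Positions are fixed here and only the edges are random. The letters c, k, f stand for a
  connection probability, the weight of an explored cluster, and the probability that a point at
  \<open>b\<close> sees nothing of it. G refers to the ghost, hence to the target \<open>T\<close>;
  O refers to the origin; E to the connection from the added point to the target.\<close>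

definition "cG T A x = con (ep psi T 0 x) (insert Gh (insert Or (Pn ` A))) Or Gh"
definition "cO y A x = con (ep psi {} y x) (insert Or (insert Ex (Pn ` A))) Or Ex"
definition "cE T y A x = con (ep psi T y x) (insert Gh (insert Ex (Pn ` A))) Ex Gh"
definition "kG T A x = kap (ep psi T 0 x) Gh (Pn ` A)"
definition "kO A x = kap (ep psi {} 0 x) Or (Pn ` A)"
text \<open>The first factor is the absent edge to the ghost. It makes the function vanish on
  \<open>T\<close>, so its support is bounded as soon as the complement of \<open>T\<close>
  is.\<close>

definition "fG T A x b = (1 - indicator T b) * (\<Prod>a\<in>A. 1 - psi (b - x (a :: nat)))"
definition "fO A x b = (1 - psi b) * (\<Prod>a\<in>A. 1 - psi (b - x (a :: nat)))"

lemma cG_ge0[simp]: "0 \<le> cG T A x" and cG_le1[simp]: "cG T A x \<le> 1"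
  and cO_ge0[simp]: "0 \<le> cO y A x" and cO_le1[simp]: "cO y A x \<le> 1"
  and cE_ge0[simp]: "0 \<le> cE T y A x" and cE_le1[simp]: "cE T y A x \<le> 1"
  and kG_ge0[simp]: "0 \<le> kG T A x" and kG_le1[simp]: "kG T A x \<le> 1"
  and kO_ge0[simp]: "0 \<le> kO A x" and kO_le1[simp]: "kO A x \<le> 1"
  by (simp_all add: cG_def cO_def cE_def kG_def kO_def)

lemma fG_ge0[simp]: "0 \<le> fG T A x b" and fG_le1[simp]: "fG T A x b \<le> 1"
  unfolding fG_def using psi_ge0 psi_le1
  by (auto intro!: mult_nonneg_nonneg prod_nonneg mult_le_one prod_le_1 simp: indicator_def)

lemma fO_ge0[simp]: "0 \<le> fO A x b" and fO_le1[simp]: "fO A x b \<le> 1"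
  unfolding fO_def using psi_ge0 psi_le1
  by (auto intro!: mult_nonneg_nonneg prod_nonneg mult_le_one prod_le_1)

abbreviation mapl :: "(nat \<Rightarrow> nat) \<Rightarrow> lab \<Rightarrow> lab" where
  "mapl \<pi> l \<equiv> (case l of Pn i \<Rightarrow> Pn (\<pi> i) | _ \<Rightarrow> l)"

lemma inj_mapl: "inj_on \<pi> A \<Longrightarrow> inj_on (mapl \<pi>) ({Gh, Or, Ex} \<union> Pn ` A)"
  by (auto simp: inj_on_def)

lemma mapl_image: "mapl \<pi> ` Pn ` A = Pn ` \<pi> ` A"
  by (auto simp: image_image)

lemma con_mapl:
  assumes "finite A" "inj_on \<pi> A" "\<And>i. i \<in> A \<Longrightarrow> x (\<pi> i) = x' i" "V \<subseteq> {Gh, Or, Ex}" "s \<in> V" "t \<in> V"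
  shows "con (ep psi T y x) (V \<union> Pn ` \<pi> ` A) s t = con (ep psi T y x') (V \<union> Pn ` A) s t"
proof -
  have "mapl \<pi> l = l" if "l \<in> V" for l using that assms(4) by (auto split: lab.split)
  then have "mapl \<pi> ` V = V" "mapl \<pi> s = s" "mapl \<pi> t = t" using assms(5,6) by auto
  moreover have "con (ep psi T y x) (mapl \<pi> ` (V \<union> Pn ` A)) (mapl \<pi> s) (mapl \<pi> t) = con (ep psi T y x') (V \<union> Pn ` A) s t"
  proof (rule con_ep_reindex)
    show "inj_on (mapl \<pi>) (V \<union> Pn ` A)"
      by (rule inj_on_subset[OF inj_mapl[OF assms(2)]]) (use assms(4) in auto)
    show "lpos y x (mapl \<pi> l) = lpos y x' l" if "l \<in> V \<union> Pn ` A" for l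
      using that assms(3,4) by (cases l) auto
  qed (use assms in auto)
  ultimately show ?thesis by (simp add: image_Un mapl_image)
qed

lemma kap_mapl:
  assumes "finite A" "inj_on \<pi> A" "\<And>i. i \<in> A \<Longrightarrow> x (\<pi> i) = x' i" "s \<in> {Gh, Or, Ex}"
  shows "kap (ep psi T y x) s (Pn ` \<pi> ` A) = kap (ep psi T y x') s (Pn ` A)"
proof -
  have "mapl \<pi> s = s" using assms(4) by auto
  moreover have "kap (ep psi T y x) (mapl \<pi> s) (mapl \<pi> ` Pn ` A) = kap (ep psi T y x') s (Pn ` A)"
  proof (rule kap_ep_reindex)
    show "inj_on (mapl \<pi>) (insert s (Pn ` A))"
      by (rule inj_on_subset[OF inj_mapl[OF assms(2)]]) (use assms(4) in auto)
    show "lpos y x (mapl \<pi> l) = lpos y x' l" if "l \<in> insert s (Pn ` A)" for l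
      using that assms(3,4) by (cases l) auto
  qed (use assms in auto)
  ultimately show ?thesis by (simp add: mapl_image)
qed

lemma labf_cG: "labf (cG T)"
  using con_mapl[where V="{Gh, Or}"] by (simp add: labf_def cG_def)

lemma labf_cO: "labf (cO y)"
  using con_mapl[where V="{Or, Ex}"] by (simp add: labf_def cO_def)

lemma labf_cE: "labf (cE T y)"
  using con_mapl[where V="{Gh, Ex}"] by (simp add: labf_def cE_def)

lemma labf_kG: "labf (kG T)"
  using kap_mapl[where s=Gh] by (simp add: labf_def kG_def)

lemma labf_kO: "labf kO"
  using kap_mapl[where s=Or] by (simp add: labf_def kO_def)

lemma labf_fG: "labf (fG T)"
  unfolding labf_def fG_def[abs_def] by (auto simp: prod.reindex fun_eq_iff intro!: prod.cong)

lemma labf_fO: "labf fO"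
  unfolding labf_def fO_def[abs_def] by (auto simp: prod.reindex fun_eq_iff intro!: prod.cong)

lemma kap_Gh: "finite A \<Longrightarrow> kap (ep psi T y x) Gh (Pn ` A) = kG T A x"
  unfolding kG_def by (rule kap_cong) (auto simp: ep_def)

lemma kap_Or: "finite A \<Longrightarrow> kap (ep psi T y x) Or (Pn ` A) = kO A x"
  unfolding kO_def by (rule kap_cong) (auto simp: ep_def)

lemma con_OE: "con (ep psi T y x) (insert Or (insert Ex (Pn ` A))) Or Ex = cO y A x"
  unfolding cO_def by (rule con_cong) (auto simp: ep_def)

lemma con_OG: "con (ep psi T y x) (insert Gh (insert Or (Pn ` A))) Or Gh = cG T A x"
  unfolding cG_def by (rule con_cong) (auto simp: ep_def)

lemma qf_Gh: "finite A \<Longrightarrow> lpos y x l = Some b \<Longrightarrow> qf (ep psi T y x) (insert Gh (Pn ` A)) l = fG T A x b"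
  unfolding qf_def fG_def by (subst prod.insert) (auto simp: ep_def prod.reindex inj_on_def)

lemma qf_Or: "finite A \<Longrightarrow> lpos y x l = Some b \<Longrightarrow> qf (ep psi T y x) (insert Or (Pn ` A)) l = fO A x b"
  unfolding qf_def fO_def by (subst prod.insert) (auto simp: ep_def prod.reindex inj_on_def)

lemma con_PG:
  assumes "j \<in> A"
  shows "con (ep psi T y x) (insert Gh (Pn ` A)) (Pn j) Gh = cE T (x j) (A - {j}) x"
proof -
  let ?\<pi> = "\<lambda>l. if l = Ex then Pn j else l"
  have "?\<pi> ` (insert Gh (insert Ex (Pn ` (A - {j})))) = insert Gh (Pn ` A)"
    using assms by auto
  then show ?thesis unfolding cE_def
    using con_ep_reindex[of ?\<pi> "insert Gh (insert Ex (Pn ` (A - {j})))" Ex Gh y x "x j" x T]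
    by (force simp: inj_on_def)
qed

lemma inj_Pn: "inj Pn" by (auto simp: inj_def)

lemma Pn_diff: "Pn ` A - Pn ` B = Pn ` (A - B)"
  by auto

lemma prod_Pn: "(\<Prod>b\<in>Pn ` A. g b) = (\<Prod>b\<in>A. g (Pn b))"
  by (simp add: prod.reindex inj_on_def)

lemma sum_Pn: "(\<Sum>b\<in>Pn ` A. g b) = (\<Sum>b\<in>A. g (Pn b))"
  by (simp add: sum.reindex inj_on_def)

section \<open>Exploration with fixed positions\<close>

text \<open>The cluster explored is that of the ghost and not that of the origin: the points left
  over are then thinned by \<open>fG\<close>, while the neighbourhood of the origin remains
  unexplored.\<close>

lemma one_minus_cG:
  assumes A: "finite A"
  shows "1 - cG T A x = (\<Sum>C\<in>Pow A. kG T C x * fG T C x 0 * (\<Prod>b\<in>A - C. fG T C x (x b)))"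
proof -
  interpret edge_prob "ep psi T 0 x" by (rule edge_prob_ep)
  have fC: "finite C" if "C \<subseteq> A" for C using that A finite_subset by auto
  have "1 - cG T A x = 1 - con (ep psi T 0 x) (insert Gh (insert Or (Pn ` A))) Gh Or"
    unfolding cG_def by (simp add: con_sym)
  also have "\<dots> = (\<Sum>C\<in>Pow A. kG T C x * (\<Prod>b\<in>A - C. fG T C x (x b)) * fG T C x 0)"
    using A by (subst one_minus_con) (auto simp: sum_Pow_image inj_Pn Pn_diff prod_Pn kap_Gh qf_Gh fC intro!: sum.cong)
  finally show ?thesis by (simp add: mult_ac)
qed

text \<open>Subtracting the formula for non-connection from \<open>sum_kap_eq_1\<close> replaces the
  factor \<open>fO C x y\<close> by \<open>1 - fO C x y\<close>.\<close>

lemma cO_eq: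
  assumes A: "finite A"
  shows "cO y A x = (\<Sum>C\<in>Pow A. kO C x * (1 - fO C x y) * (\<Prod>b\<in>A - C. fO C x (x b)))"
proof -
  interpret edge_prob "ep psi {} y x" by (rule edge_prob_ep)
  have fC: "finite C" if "C \<subseteq> A" for C using that A finite_subset by auto
  have 1: "1 - cO y A x = (\<Sum>C\<in>Pow A. kO C x * (\<Prod>b\<in>A - C. fO C x (x b)) * fO C x y)"
    unfolding cO_def using A
    by (subst one_minus_con) (auto simp: sum_Pow_image inj_Pn Pn_diff prod_Pn kap_Or qf_Or fC intro!: sum.cong)
  have 2: "1 = (\<Sum>C\<in>Pow A. kO C x * (\<Prod>b\<in>A - C. fO C x (x b)))"
    using A by (subst sum_kap_eq_1[of "Pn ` A" Or, symmetric])
       (auto simp: sum_Pow_image inj_Pn Pn_diff prod_Pn kap_Or qf_Or fC intro!: sum.cong)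
  have "cO y A x = 1 - (1 - cO y A x)" by simp
  also have "\<dots> = (\<Sum>C\<in>Pow A. kO C x * (\<Prod>b\<in>A - C. fO C x (x b))) - (\<Sum>C\<in>Pow A. kO C x * (\<Prod>b\<in>A - C. fO C x (x b)) * fO C x y)"
    using 1 2 by simp
  also have "\<dots> = (\<Sum>C\<in>Pow A. kO C x * (1 - fO C x y) * (\<Prod>b\<in>A - C. fO C x (x b)))"
    by (simp add: sum_subtractf[symmetric] algebra_simps)
  finally show ?thesis .
qed

text \<open>\<open>con_pivotal\<close> read as a bound on the increment from \<open>n\<close> to
  \<open>n + 1\<close> points, which is what the derivative of an exponential series in the
  intensity involves.\<close>

lemma cG_pivotal:
  "cG T {..<n} x + (\<Sum>A\<in>Pow {..<n}. kG T A x * fG T A x 0 * (1 - fG T A x y) *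
       ((\<Prod>b\<in>{..<n} - A. fG T A x (x b)) * cO y ({..<n} - A) x)) \<le> cG T {..<Suc n} (case_nat y x)"
proof -
  interpret edge_prob "ep psi T y x" by (rule edge_prob_ep)
  have fC: "finite C" if "C \<subseteq> {..<n}" for C using that finite_subset by auto
  \<comment> \<open>The added point becomes the first entry of \<open>case_nat y x\<close> and the
    old points move up by one.\<close>
  let ?\<pi> = "\<lambda>l. case l of Ex \<Rightarrow> Pn 0 | Pn i \<Rightarrow> Pn (Suc i) | _ \<Rightarrow> l"
  have im: "?\<pi> ` (insert Gh (insert Or (insert Ex (Pn ` {..<n})))) = insert Gh (insert Or (Pn ` {..<Suc n}))"
    by (auto simp: image_image lessThan_Suc_eq_insert_0)
  have "con (ep psi T 0 (case_nat y x)) (?\<pi> ` (insert Gh (insert Or (insert Ex (Pn ` {..<n}))))) (?\<pi> Or) (?\<pi> Gh) =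
      con (ep psi T y x) (insert Gh (insert Or (insert Ex (Pn ` {..<n})))) Or Gh"
    by (rule con_ep_reindex) (auto simp: inj_on_def)
  then have 1: "con (ep psi T y x) (insert Gh (insert Or (insert Ex (Pn ` {..<n})))) Or Gh = cG T {..<Suc n} (case_nat y x)"
    unfolding im by (simp add: cG_def)
  have "con (ep psi T y x) (insert Gh (insert Or (Pn ` {..<n}))) Or Gh +
     (\<Sum>A\<in>Pow (Pn ` {..<n}). kap (ep psi T y x) Gh A * (\<Prod>b\<in>Pn ` {..<n} - A. qf (ep psi T y x) (insert Gh A) b) * qf (ep psi T y x) (insert Gh A) Or *
        ((1 - qf (ep psi T y x) (insert Gh A) Ex) * con (ep psi T y x) (insert Or (insert Ex (Pn ` {..<n} - A))) Or Ex))
     \<le> con (ep psi T y x) (insert Gh (insert Or (insert Ex (Pn ` {..<n})))) Or Gh"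
    by (rule con_pivotal) auto
  also have "(\<Sum>A\<in>Pow (Pn ` {..<n}). kap (ep psi T y x) Gh A * (\<Prod>b\<in>Pn ` {..<n} - A. qf (ep psi T y x) (insert Gh A) b) * qf (ep psi T y x) (insert Gh A) Or *
        ((1 - qf (ep psi T y x) (insert Gh A) Ex) * con (ep psi T y x) (insert Or (insert Ex (Pn ` {..<n} - A))) Or Ex)) =
      (\<Sum>A\<in>Pow {..<n}. kG T A x * fG T A x 0 * (1 - fG T A x y) *
       ((\<Prod>b\<in>{..<n} - A. fG T A x (x b)) * cO y ({..<n} - A) x))"
    by (auto simp: sum_Pow_image inj_Pn Pn_diff prod_Pn kap_Gh qf_Gh fC con_OE mult_ac intro!: sum.cong)
  finally show ?thesis by (simp add: 1 con_OG)
qed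

text \<open>Average \<open>con_le_exit\<close> over a random set \<open>A\<close> that keeps each
  point \<open>x i\<close> independently with probability \<open>f (x i)\<close>. Kept points avoid
  \<open>T\<close>, so none of them is joined to the ghost and the hypothesis of
  \<open>con_le_exit\<close> holds whenever \<open>A\<close> has positive weight.\<close>

lemma cG_le_exit:
  assumes f: "\<And>z. 0 \<le> f z" "\<And>z. f z \<le> 1" "\<And>z. f z \<noteq> 0 \<Longrightarrow> z \<notin> T" and T: "0 \<notin> T"
  shows "cG T {..<n} x \<le> (\<Sum>C\<in>Pow {..<n}. (\<Prod>i\<in>C. f (x i)) * kO C x *
      (\<Sum>j\<in>{..<n} - C. (1 - f (x j)) * (1 - fO C x (x j)) *
        ((\<Prod>b\<in>{..<n} - C - {j}. 1 - f (x b) * (1 - fO C x (x b))) * cE T (x j) ({..<n} - C - {j}) x)))"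
proof -
  interpret edge_prob "ep psi T 0 x" by (rule edge_prob_ep)
  let ?N = "{..<n}"
  have fC: "finite C" if "C \<subseteq> ?N" for C using that finite_subset by auto
  define w where "w A = (\<Prod>i\<in>A. f (x i)) * (\<Prod>i\<in>?N - A. 1 - f (x i))" for A
  define g where "g A C j = w A * (kO C x * (\<Prod>b\<in>A - C. fO C x (x b)) * ((1 - fO C x (x j)) * cE T (x j) (?N - C - {j}) x))" for A C j
  have w0: "0 \<le> w A" for A unfolding w_def using f by (auto intro!: mult_nonneg_nonneg prod_nonneg)
  have "(\<Sum>A\<in>Pow ?N. w A) = 1"
    unfolding w_def by (subst prod_Pow_add) auto
  then have "cG T ?N x = (\<Sum>A\<in>Pow ?N. w A * cG T ?N x)"
    by (simp add: sum_distrib_right[symmetric])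
  also have "\<dots> \<le> (\<Sum>A\<in>Pow ?N. \<Sum>C\<in>Pow A. \<Sum>j\<in>?N - A. g A C j)"
  proof (rule sum_mono)
    fix A assume A: "A \<in> Pow ?N"
    show "w A * cG T ?N x \<le> (\<Sum>C\<in>Pow A. \<Sum>j\<in>?N - A. g A C j)"
    proof (cases "w A = 0")
      case True then show ?thesis by (simp add: g_def)
    next
      case False
      then have "f (x a) \<noteq> 0" if "a \<in> A" for a using that A fC[of A] by (auto simp: w_def)
      then have noT: "x a \<notin> T" if "a \<in> A" for a using that f(3) by blast
      have "cG T ?N x \<le> (\<Sum>C\<in>Pow (Pn ` A). kap (ep psi T 0 x) Or C * (\<Prod>b\<in>Pn ` A - C. qf (ep psi T 0 x) (insert Or C) b) *
        (\<Sum>y\<in>Pn ` ?N - Pn ` A. (1 - qf (ep psi T 0 x) (insert Or C) y) * con (ep psi T 0 x) (insert Gh (Pn ` ?N - C)) y Gh))"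
        unfolding cG_def by (rule con_le_exit) (use A noT T in \<open>auto simp: ep_def\<close>)
      also have "\<dots> = (\<Sum>C\<in>Pow A. kO C x * (\<Prod>b\<in>A - C. fO C x (x b)) *
        (\<Sum>j\<in>?N - A. (1 - fO C x (x j)) * cE T (x j) (?N - C - {j}) x))"
        unfolding sum_Pow_image[OF inj_Pn]
      proof (rule sum.cong[OF refl])
        fix C assume C: "C \<in> Pow A"
        then have fc: "finite C" using fC A by auto
        have "j \<in> ?N - C" if "j \<in> ?N - A" for j using C that by auto
        then show "kap (ep psi T 0 x) Or (Pn ` C) * (\<Prod>b\<in>Pn ` A - Pn ` C. qf (ep psi T 0 x) (insert Or (Pn ` C)) b) *
          (\<Sum>y\<in>Pn ` ?N - Pn ` A. (1 - qf (ep psi T 0 x) (insert Or (Pn ` C)) y) * con (ep psi T 0 x) (insert Gh (Pn ` ?N - Pn ` C)) y Gh) =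
          kO C x * (\<Prod>b\<in>A - C. fO C x (x b)) * (\<Sum>j\<in>?N - A. (1 - fO C x (x j)) * cE T (x j) (?N - C - {j}) x)"
          by (auto simp: Pn_diff prod_Pn sum_Pn kap_Or qf_Or fc con_PG)
      qed
      finally have "w A * cG T ?N x \<le> w A * \<dots>" using w0 by (rule mult_left_mono)
      also have "\<dots> = (\<Sum>C\<in>Pow A. \<Sum>j\<in>?N - A. g A C j)"
        by (simp add: g_def sum_distrib_left mult.assoc)
      finally show ?thesis .
    qed
  qed
  \<comment> \<open>A kept set is the cluster \<open>C\<close> of the origin together with a set
    \<open>E\<close> of kept points that the cluster does not see; \<open>j\<close> is the rejected
    point through which the path leaves.\<close>
  also have "\<dots> = (\<Sum>C\<in>Pow ?N. \<Sum>j\<in>?N - C. \<Sum>E\<in>Pow (?N - C - {j}). g (C \<union> E) C j)"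
  proof -
    have "(\<Sum>A\<in>Pow ?N. \<Sum>C\<in>Pow A. \<Sum>j\<in>?N - A. g A C j) =
      (\<Sum>(A, C, j)\<in>(SIGMA A:Pow ?N. Pow A \<times> (?N - A)). g A C j)"
      by (subst sum.Sigma[symmetric]) (auto simp: fC sum.cartesian_product intro!: sum.cong finite_cartesian_product)
    also have "\<dots> = (\<Sum>(C, j, E)\<in>(SIGMA C:Pow ?N. SIGMA j:?N - C. Pow (?N - C - {j})). g (C \<union> E) C j)"
      by (rule sum.reindex_bij_witness[of _ "\<lambda>(C, j, E). (C \<union> E, C, j)" "\<lambda>(A, C, j). (C, j, A - C)"]) 
         (auto simp: Un_absorb1)
    also have "\<dots> = (\<Sum>C\<in>Pow ?N. \<Sum>j\<in>?N - C. \<Sum>E\<in>Pow (?N - C - {j}). g (C \<union> E) C j)"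
      by (subst sum.Sigma[symmetric]) (auto simp: sum.Sigma intro!: sum.cong)
    finally show ?thesis .
  qed
  also have "\<dots> = (\<Sum>C\<in>Pow ?N. (\<Prod>i\<in>C. f (x i)) * kO C x *
      (\<Sum>j\<in>?N - C. (1 - f (x j)) * (1 - fO C x (x j)) *
        ((\<Prod>b\<in>?N - C - {j}. 1 - f (x b) * (1 - fO C x (x b))) * cE T (x j) (?N - C - {j}) x)))"
    unfolding sum_distrib_left
  proof (intro sum.cong refl)
    fix C j assume C: "C \<in> Pow ?N" and j: "j \<in> ?N - C"
    let ?R = "?N - C - {j}"
    have "g (C \<union> E) C j = ((\<Prod>i\<in>C. f (x i)) * kO C x * ((1 - f (x j)) * (1 - fO C x (x j)) * cE T (x j) ?R x)) *
        ((\<Prod>b\<in>E. f (x b) * fO C x (x b)) * (\<Prod>b\<in>?R - E. 1 - f (x b)))" if E: "E \<in> Pow ?R" for E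
    proof -
      have fE: "finite E" using E finite_subset[of E ?R] by auto
      have "(\<Prod>i\<in>C \<union> E. f (x i)) = (\<Prod>i\<in>C. f (x i)) * (\<Prod>i\<in>E. f (x i))"
        by (rule prod.union_disjoint) (use E C fC fE in auto)
      moreover have "?N - (C \<union> E) = insert j (?R - E)" using E C j by auto
      then have "(\<Prod>i\<in>?N - (C \<union> E). 1 - f (x i)) = (1 - f (x j)) * (\<Prod>i\<in>?R - E. 1 - f (x i))"
        by simp
      moreover have "C \<union> E - C = E" using E by auto
      ultimately show ?thesis by (simp add: g_def w_def prod.distrib mult_ac)
    qed
    then have "(\<Sum>E\<in>Pow ?R. g (C \<union> E) C j) = ((\<Prod>i\<in>C. f (x i)) * kO C x * ((1 - f (x j)) * (1 - fO C x (x j)) * cE T (x j) ?R x)) *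
        (\<Sum>E\<in>Pow ?R. (\<Prod>b\<in>E. f (x b) * fO C x (x b)) * (\<Prod>b\<in>?R - E. 1 - f (x b)))"
      by (simp add: sum_distrib_left)
    \<comment> \<open>Every remaining point is either rejected, with weight \<open>1 - f\<close>, or
      kept and unseen, with weight \<open>f * fO\<close>; the sum of the two is
      \<open>1 - f * (1 - fO)\<close>.\<close>
    also have "(\<Sum>E\<in>Pow ?R. (\<Prod>b\<in>E. f (x b) * fO C x (x b)) * (\<Prod>b\<in>?R - E. 1 - f (x b))) = (\<Prod>b\<in>?R. 1 - f (x b) * (1 - fO C x (x b)))"
      by (subst prod_Pow_add) (auto simp: algebra_simps)
    finally show "(\<Sum>E\<in>Pow ?R. g (C \<union> E) C j) = (\<Prod>i\<in>C. f (x i)) * kO C x * ((1 - f (x j)) * (1 - fO C x (x j)) *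
        ((\<Prod>b\<in>?R. 1 - f (x b) * (1 - fO C x (x b))) * cE T (x j) ?R x))"
      by (simp add: mult_ac)
  qed
  finally show ?thesis .
qed

lemma cG_mono: "A \<subseteq> B \<Longrightarrow> T \<subseteq> T' \<Longrightarrow> cG T A x \<le> cG T' B x"
  unfolding cG_def
proof (rule con_mono)
  fix a b assume "T \<subseteq> T'"
  then show "ep psi T 0 x a b \<le> ep psi T' 0 x a b"
    by (cases a; cases b) (auto simp: ep_def indicator_def)
qed auto

lemma cE_mono: "A \<subseteq> B \<Longrightarrow> cE T y A x \<le> cE T y B x"
  unfolding cE_def by (rule con_mono) auto

text \<open>The edge probabilities depend on differences of positions only, so the exit problem from
  \<open>y\<close> is the original one with a shifted target.\<close>

lemma cE_translate: "cE T y A x = cG ((\<lambda>z. z - y) ` T) A (\<lambda>i. x i - y)"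
proof -
  let ?\<pi> = "\<lambda>l. if l = Or then Ex else l"
  have im: "?\<pi> ` (insert Gh (insert Or (Pn ` A))) = insert Gh (insert Ex (Pn ` A))" by force
  have "con (ep psi T y x) (?\<pi> ` (insert Gh (insert Or (Pn ` A)))) (?\<pi> Or) (?\<pi> Gh) =
    con (\<lambda>a b. ep psi T y x (?\<pi> a) (?\<pi> b)) (insert Gh (insert Or (Pn ` A))) Or Gh"
    by (rule con_reindex) (auto simp: inj_on_def)
  also have "\<dots> = con (ep psi ((\<lambda>z. z - y) ` T) 0 (\<lambda>i. x i - y)) (insert Gh (insert Or (Pn ` A))) Or Gh"
  proof (rule con_cong)
    have "indicator ((\<lambda>z. z - y) ` T) (a - y) = (indicator T a :: real)" for a
      by (auto simp: indicator_def)
    moreover have "indicator ((\<lambda>z. z - y) ` T) 0 = (indicator T y :: real)"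
      by (force simp: indicator_def)
    ultimately show "ep psi T y x (?\<pi> a) (?\<pi> b) = ep psi ((\<lambda>z. z - y) ` T) 0 (\<lambda>i. x i - y) a b"
      if "a \<in> insert Gh (insert Or (Pn ` A))" "b \<in> insert Gh (insert Or (Pn ` A))" for a b
      using that by (auto simp: ep_def)
  qed
  finally show ?thesis unfolding im by (simp add: cE_def cG_def)
qed

end

section \<open>Measurability in the positions\<close>

text \<open>The connection event is jointly measurable in the parameter and the marks, and the
  probability is the measure of its sections.\<close>

lemma measurable_con_param:
  fixes p :: "'z \<Rightarrow> 'v::countable \<Rightarrow> 'v \<Rightarrow> real"
  assumes p[measurable]: "\<And>a b. (\<lambda>z. p z a b) \<in> borel_measurable N"
  shows "(\<lambda>z. con (p z) V s t) \<in> borel_measurable N"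
proof -
  have [measurable]: "(\<lambda>x. snd x e) \<in> borel_measurable (N \<Otimes>\<^sub>M UM)" for e :: "'v set"
    by (rule measurable_compose[OF measurable_snd measurable_UM_component])
  have pr: "Measurable.pred (N \<Otimes>\<^sub>M UM) (\<lambda>x. reach (p (fst x)) (snd x) V s t)"
    by (rule measurable_rtranclp) (unfold gadj_def, measurable)
  define Q where "Q = {x \<in> space (N \<Otimes>\<^sub>M UM). reach (p (fst x)) (snd x) V s t}"
  have "Q \<in> sets (N \<Otimes>\<^sub>M UM)" using pr unfolding Q_def pred_def by simp
  then have [measurable]: "(\<lambda>z. emeasure UM (Pair z -` Q)) \<in> borel_measurable N"
    by (rule UM.measurable_emeasure_Pair)
  have "con (p z) V s t = enn2real (emeasure UM (Pair z -` Q))" if "z \<in> space N" for z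
  proof -
    have "Pair z -` Q = {\<omega>. reach (p z) \<omega> V s t}" using that by (auto simp: Q_def space_pair_measure)
    then show ?thesis by (simp add: con_def measure_def)
  qed
  then show ?thesis by (subst measurable_cong) auto
qed

lemma measurable_kap_param:
  fixes p :: "'z \<Rightarrow> 'v::countable \<Rightarrow> 'v \<Rightarrow> real"
  assumes p[measurable]: "\<And>a b. (\<lambda>z. p z a b) \<in> borel_measurable N" and C: "finite C"
  shows "(\<lambda>z. kap (p z) s C) \<in> borel_measurable N"
proof -
  have [measurable]: "(\<lambda>x. snd x e) \<in> borel_measurable (N \<Otimes>\<^sub>M UM)" for e :: "'v set"
    by (rule measurable_compose[OF measurable_snd measurable_UM_component])
  have "Measurable.pred (N \<Otimes>\<^sub>M UM) (\<lambda>x. reach (p (fst x)) (snd x) V s t)" for V t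
    by (rule measurable_rtranclp) (unfold gadj_def, measurable)
  then have pr: "Measurable.pred (N \<Otimes>\<^sub>M UM) (\<lambda>x. spans (p (fst x)) s C (snd x))"
    unfolding spans_def using C by (intro pred_intros_finite) auto
  define Q where "Q = {x \<in> space (N \<Otimes>\<^sub>M UM). spans (p (fst x)) s C (snd x)}"
  have "Q \<in> sets (N \<Otimes>\<^sub>M UM)" using pr unfolding Q_def pred_def by simp
  then have [measurable]: "(\<lambda>z. emeasure UM (Pair z -` Q)) \<in> borel_measurable N"
    by (rule UM.measurable_emeasure_Pair)
  have "kap (p z) s C = enn2real (emeasure UM (Pair z -` Q))" if "z \<in> space N" for z
  proof -
    have "Pair z -` Q = {\<omega>. spans (p z) s C \<omega>}" using that by (auto simp: Q_def space_pair_measure)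
    then show ?thesis by (simp add: kap_def measure_def)
  qed
  then show ?thesis by (subst measurable_cong) auto
qed

context rcm
begin

lemma measurable_ep:
  assumes [measurable]: "T \<in> sets borel" "y \<in> borel_measurable N" "\<And>i. (\<lambda>z. x z i) \<in> borel_measurable N"
  shows "(\<lambda>z. ep psi T (y z) (x z) a b) \<in> borel_measurable N"
  by (cases a; cases b; simp add: ep_def; measurable)

lemma measurable_cG[measurable (raw)]:
  assumes "T \<in> sets borel" "\<And>i. (\<lambda>z. x z i) \<in> borel_measurable N"
  shows "(\<lambda>z. cG T A (x z)) \<in> borel_measurable N"
  unfolding cG_def by (intro measurable_con_param measurable_ep) (use assms in auto)

lemma measurable_cO[measurable (raw)]:
  assumes "y \<in> borel_measurable N" "\<And>i. (\<lambda>z. x z i) \<in> borel_measurable N"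
  shows "(\<lambda>z. cO (y z) A (x z)) \<in> borel_measurable N"
  unfolding cO_def by (intro measurable_con_param measurable_ep) (use assms in auto)

lemma measurable_cE[measurable (raw)]:
  assumes "T \<in> sets borel" "y \<in> borel_measurable N" "\<And>i. (\<lambda>z. x z i) \<in> borel_measurable N"
  shows "(\<lambda>z. cE T (y z) A (x z)) \<in> borel_measurable N"
  unfolding cE_def by (intro measurable_con_param measurable_ep) (use assms in auto)

lemma measurable_kG[measurable (raw)]:
  assumes "finite A" "T \<in> sets borel" "\<And>i. (\<lambda>z. x z i) \<in> borel_measurable N"
  shows "(\<lambda>z. kG T A (x z)) \<in> borel_measurable N"
  unfolding kG_def by (intro measurable_kap_param measurable_ep) (use assms in auto)

lemma measurable_kO[measurable (raw)]:
  assumes "finite A" "\<And>i. (\<lambda>z. x z i) \<in> borel_measurable N"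
  shows "(\<lambda>z. kO A (x z)) \<in> borel_measurable N"
  unfolding kO_def by (intro measurable_kap_param measurable_ep) (use assms in auto)

lemma measurable_fG[measurable (raw)]:
  assumes [measurable]: "T \<in> sets borel" "\<And>i. (\<lambda>z. x z i) \<in> borel_measurable N" "b \<in> borel_measurable N"
  shows "(\<lambda>z. fG T A (x z) (b z)) \<in> borel_measurable N"
  unfolding fG_def by measurable

lemma measurable_fO[measurable (raw)]:
  assumes [measurable]: "\<And>i. (\<lambda>z. x z i) \<in> borel_measurable N" "b \<in> borel_measurable N"
  shows "(\<lambda>z. fO A (x z) (b z)) \<in> borel_measurable N"
  unfolding fO_def by measurable

lemma measurable_fG_const[measurable]:
  assumes [measurable]: "T \<in> sets borel"
  shows "fG T A x \<in> borel_measurable borel"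
  unfolding fG_def[abs_def] by measurable

lemma measurable_fO_const[measurable]: "fO A x \<in> borel_measurable borel"
  unfolding fO_def[abs_def] by measurable

lemma measurable_cO_const[measurable]: "(\<lambda>y. cO y A x) \<in> borel_measurable borel"
  by (rule measurable_cO) simp_all

end

subsection \<open>Two inequalities in a finite window\<close>

locale window = rcm psi + iid_seq M
  for psi :: "real ^ ('d::finite) \<Rightarrow> real" and M :: "(real ^ 'd) measure" +
  fixes L :: real
  assumes sets_M[measurable_cong]: "sets M = sets borel" and L0: "0 \<le> L"
begin

lemma measurable_SQ_comp[measurable]: "(\<lambda>x. x i) \<in> borel_measurable (SQ M)"
  using measurable_component_singleton[of i UNIV "\<lambda>_. M"] by (simp cong: measurable_cong_sets add: sets_M)

lemma measurable_id_M[measurable]: "(\<lambda>z. z) \<in> borel_measurable M"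
  by (rule measurable_ident_sets[OF sets_M])

lemmas meas_intros = borel_measurable_times_ennreal measurable_compose[OF _ measurable_ennreal]
  borel_measurable_diff borel_measurable_times borel_measurable_const borel_measurable_prod
  measurable_fG measurable_fO measurable_cO measurable_cE measurable_kG measurable_kO

lemma integrable_01:
  assumes "f \<in> borel_measurable borel" "\<And>x. 0 \<le> f x" "\<And>x. f x \<le> (1::real)"
  shows "integrable M f"
  by (rule M.integrable_const_bound[of _ 1]) (use assms in \<open>auto cong: measurable_cong_sets simp: sets_M\<close>)

lemma PE_prod_real:
  assumes f: "f \<in> borel_measurable borel" "\<And>x. 0 \<le> f x" "\<And>x. f x \<le> (1::real)"
  shows "PE L M (\<lambda>m x. ennreal (\<Prod>i<m. f (x i))) = ennreal (exp (L * (\<integral>b. f b \<partial>M)))"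
proof -
  have [measurable]: "f \<in> borel_measurable M" using f(1) by (simp cong: measurable_cong_sets add: sets_M)
  have "PE L M (\<lambda>m x. \<Prod>i<m. ennreal (f (x i))) = ennreal (exp (L * (\<integral>b. f b \<partial>M)))"
    by (rule PE_prod) (use f L0 in \<open>auto simp: nn_integral_eq_integral[OF integrable_01[OF f]]\<close>)
  then show ?thesis using f by (simp add: prod_ennreal)
qed

text \<open>Split the points into the explored set \<open>A\<close> and the rest by
  \<open>mecke_split\<close>, then integrate the rest by the generating functional. All exploration
  formulas of the form "weight of the cluster times product over unexplored points" are evaluated in
  this way.\<close>

lemma PE_split_weight:
  assumes H: "labf H" "\<And>A. finite A \<Longrightarrow> H A \<in> borel_measurable (SQ M)"
    and w: "labf w" "\<And>A x b. 0 \<le> w A x b" "\<And>A x b. w A x b \<le> (1::real)"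
      "\<And>A. finite A \<Longrightarrow> (\<lambda>(x, b). w A x b) \<in> borel_measurable (SQ M \<Otimes>\<^sub>M borel)"
  shows "PE L M (\<lambda>n x. \<Sum>A\<in>Pow {..<n}. H A x * ennreal (\<Prod>b\<in>{..<n} - A. w A x (x b))) =
    PE L M (\<lambda>k x. H {..<k} x * ennreal (exp (L * (\<integral>b. w {..<k} x b \<partial>M))))"
proof -
  define u where "u A B x = H A x * ennreal (\<Prod>b\<in>B. w A x (x b))" for A B x
  have wm: "w {..<k} x \<in> borel_measurable borel" for k x
    using measurable_compose[OF measurable_Pair1'[of x "SQ M"] w(4)[of "{..<k}"]] by simp
  have "PE L M (\<lambda>n x. \<Sum>A\<in>Pow {..<n}. u A ({..<n} - A) x) =
    PE L M (\<lambda>k x. PE L M (\<lambda>m x'. u {..<k} {k..<k+m} (comb_seq k x x')))"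
  proof (rule mecke_split[OF L0])
    fix A B :: "nat set" assume [simp]: "finite A" "finite B"
    have [measurable]: "H A \<in> borel_measurable (SQ M)" by (rule H(2)) simp
    have [measurable]: "(\<lambda>x. w A x (x b)) \<in> borel_measurable (SQ M)" for b
      using measurable_compose[OF _ w(4)[of A], of "\<lambda>x. (x, x b)" "SQ M"] by simp
    show "u A B \<in> borel_measurable (SQ M)" unfolding u_def by measurable
    fix \<pi> :: "nat \<Rightarrow> nat" and x assume \<pi>: "bij \<pi>"
    then have i: "inj_on \<pi> A" "inj_on \<pi> B" by (auto simp: bij_def intro: inj_on_subset)
    show "u (\<pi> ` A) (\<pi> ` B) x = u A B (\<lambda>i. x (\<pi> i))"
      unfolding u_def labfD[OF H(1) \<open>finite A\<close> i(1) refl] labfD[OF w(1) \<open>finite A\<close> i(1) refl] by (simp add: prod.reindex[OF i(2)])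
  qed
  also have "\<dots> = PE L M (\<lambda>k x. H {..<k} x * ennreal (exp (L * (\<integral>b. w {..<k} x b \<partial>M))))"
  proof -
    have "u {..<k} {k..<k+m} (comb_seq k x x') = H {..<k} x * ennreal (\<Prod>b<m. w {..<k} x (x' b))" for k m x x'
      unfolding u_def labf_comb_left[OF H(1)] labf_comb_left[OF w(1)] labf_comb_right[OF labf_prod[of "w {..<k} x"]] ..
    moreover have "PE L M (\<lambda>m x'. H {..<k} x * ennreal (\<Prod>b<m. w {..<k} x (x' b))) =
        H {..<k} x * ennreal (exp (L * (\<integral>b. w {..<k} x b \<partial>M)))" for k x
      by (subst PE_cmult) (use wm w in \<open>auto simp: PE_prod_real intro!: measurable_compose[OF _ measurable_ennreal] borel_measurable_prod measurable_compose[OF measurable_SQ_comp]\<close>)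
    ultimately show ?thesis by simp
  qed
  finally show ?thesis by (simp add: u_def)
qed

text \<open>Keep each point with probability \<open>h\<close>. The rejected points integrate to the
  exponential, so the left-hand side is the integral of \<open>F\<close> evaluated on the kept
  points, and \<open>F\<close> is monotone in the set of points.\<close>

lemma PE_thin_mono:
  fixes F :: "nat set \<Rightarrow> (nat \<Rightarrow> real^'d) \<Rightarrow> ennreal"
  assumes F: "labf F" "\<And>A. finite A \<Longrightarrow> F A \<in> borel_measurable (SQ M)" "\<And>A B x. A \<subseteq> B \<Longrightarrow> F A x \<le> F B x"
    and h[measurable]: "h \<in> borel_measurable borel" and h01: "\<And>x. 0 \<le> h x" "\<And>x. h x \<le> (1::real)"
  shows "PE L M (\<lambda>k x. ennreal (\<Prod>i<k. h (x i)) * F {..<k} x) * ennreal (exp (L * (\<integral>b. 1 - h b \<partial>M)))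
    \<le> PE L M (\<lambda>n x. F {..<n} x)"
proof -
  have "PE L M (\<lambda>k x. ennreal (\<Prod>i<k. h (x i)) * F {..<k} x) * ennreal (exp (L * (\<integral>b. 1 - h b \<partial>M))) =
     PE L M (\<lambda>k x. (ennreal (\<Prod>i<k. h (x i)) * F {..<k} x) * ennreal (exp (L * (\<integral>b. 1 - h b \<partial>M))))"
    using F(2)[measurable] by (subst (1 2) mult.commute, subst PE_cmult[symmetric]) (auto simp: mult_ac)
  also have "\<dots> = PE L M (\<lambda>n x. \<Sum>A\<in>Pow {..<n}. ennreal (\<Prod>i\<in>A. h (x i)) * F A x * ennreal (\<Prod>b\<in>{..<n} - A. 1 - h (x b)))"
  proof (rule PE_split_weight[where w="\<lambda>A x b. 1 - h b", symmetric])
    show "labf (\<lambda>A x. ennreal (\<Prod>i\<in>A. h (x i)) * F A x)"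
      by (rule labf_comb[where g="\<lambda>a b. ennreal a * b"]) (auto intro: labf_prod F)
    show "(\<lambda>x. ennreal (\<Prod>i\<in>A. h (x i)) * F A x) \<in> borel_measurable (SQ M)" if "finite A" for A
      using F(2)[OF that, measurable] by measurable
  qed (use h01 in \<open>auto simp: labf_const\<close>)
  also have "\<dots> \<le> PE L M (\<lambda>n x. F {..<n} x)"
  proof (rule PE_mono)
    fix n x
    have "(\<Sum>A\<in>Pow {..<n}. ennreal (\<Prod>i\<in>A. h (x i)) * F A x * ennreal (\<Prod>b\<in>{..<n} - A. 1 - h (x b))) \<le>
      (\<Sum>A\<in>Pow {..<n}. ennreal ((\<Prod>i\<in>A. h (x i)) * (\<Prod>b\<in>{..<n} - A. 1 - h (x b))) * F {..<n} x)"
    proof (rule sum_mono)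
      fix A assume "A \<in> Pow {..<n}"
      then have "F A x \<le> F {..<n} x" by (intro F(3)) auto
      moreover have "0 \<le> (\<Prod>b\<in>{..<n} - A. 1 - h (x b))" "0 \<le> (\<Prod>i\<in>A. h (x i))"
        using h01 by (auto intro!: prod_nonneg)
      ultimately show "ennreal (\<Prod>i\<in>A. h (x i)) * F A x * ennreal (\<Prod>b\<in>{..<n} - A. 1 - h (x b)) \<le>
        ennreal ((\<Prod>i\<in>A. h (x i)) * (\<Prod>b\<in>{..<n} - A. 1 - h (x b))) * F {..<n} x"
        by (simp add: ennreal_mult mult_ac mult_right_mono)
    qed
    also have "\<dots> = ennreal (\<Sum>A\<in>Pow {..<n}. (\<Prod>i\<in>A. h (x i)) * (\<Prod>b\<in>{..<n} - A. 1 - h (x b))) * F {..<n} x"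
      using h01 by (subst sum_ennreal[symmetric]) (auto simp: sum_distrib_right intro!: mult_nonneg_nonneg prod_nonneg)
    also have "\<dots> = F {..<n} x" by (subst prod_Pow_add) auto
    finally show "(\<Sum>A\<in>Pow {..<n}. ennreal (\<Prod>i\<in>A. h (x i)) * F A x * ennreal (\<Prod>b\<in>{..<n} - A. 1 - h (x b))) \<le> F {..<n} x" .
  qed
  finally show ?thesis .
qed

text \<open>\<open>exp (- L * \<integral>b. f b \<partial>M) * tau f y\<close> is the probability that the origin is connected to \<open>y\<close> in the
  \<open>f\<close>-thinned configuration.\<close>

definition tau :: "(real^'d \<Rightarrow> real) \<Rightarrow> real^'d \<Rightarrow> ennreal" where
  "tau f y = PE L M (\<lambda>m x. ennreal ((\<Prod>i<m. f (x i)) * cO y {..<m} x))"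

lemma measurable_tau[measurable]:
  assumes [measurable]: "f \<in> borel_measurable borel"
  shows "tau f \<in> borel_measurable borel"
  unfolding tau_def by measurable

lemma PE_one_minus_cG:
  assumes T[measurable]: "T \<in> sets borel"
  shows "PE L M (\<lambda>n x. ennreal (1 - cG T {..<n} x)) =
    PE L M (\<lambda>k x. ennreal (kG T {..<k} x * fG T {..<k} x 0) * ennreal (exp (L * (\<integral>b. fG T {..<k} x b \<partial>M))))"
proof -
  have "ennreal (1 - cG T {..<n} x) = (\<Sum>C\<in>Pow {..<n}. ennreal (kG T C x * fG T C x 0) * ennreal (\<Prod>b\<in>{..<n} - C. fG T C x (x b)))" for n x
    by (subst one_minus_cG) (auto simp: sum_ennreal[symmetric] ennreal_mult prod_nonneg)
  then show ?thesis
    by (simp only:, intro PE_split_weight)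
       (auto intro!: labf_map[where g=ennreal] labf_comb[where g="(*)"] labf_kG labf_map[OF labf_fG, where g="\<lambda>f. f 0"] labf_fG)
qed

text \<open>Exploring the cluster of the origin in the \<open>f\<close>-thinned process: a point is
  unexplored if it is kept and unseen, hence the weight \<open>f b * fO {..<k} x b\<close> in the
  exponent.\<close>

lemma tau_eq:
  assumes f[measurable]: "f \<in> borel_measurable borel" and f01: "\<And>x. 0 \<le> f x" "\<And>x. f x \<le> 1"
  shows "tau f y = PE L M (\<lambda>k x. ennreal ((\<Prod>i<k. f (x i)) * (kO {..<k} x * (1 - fO {..<k} x y))) *
      ennreal (exp (L * (\<integral>b. f b * fO {..<k} x b \<partial>M))))"
proof -
  have "ennreal ((\<Prod>i<n. f (x i)) * cO y {..<n} x) =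
    (\<Sum>C\<in>Pow {..<n}. ennreal ((\<Prod>i\<in>C. f (x i)) * (kO C x * (1 - fO C x y))) * ennreal (\<Prod>b\<in>{..<n} - C. f (x b) * fO C x (x b)))" for n x
  proof -
    have "(\<Prod>i<n. f (x i)) * cO y {..<n} x =
      (\<Sum>C\<in>Pow {..<n}. ((\<Prod>i\<in>C. f (x i)) * (kO C x * (1 - fO C x y))) * (\<Prod>b\<in>{..<n} - C. f (x b) * fO C x (x b)))"
      unfolding cO_eq[OF finite_lessThan] sum_distrib_left
    proof (rule sum.cong[OF refl])
      fix C assume "C \<in> Pow {..<n}"
      then have "(\<Prod>i<n. f (x i)) = (\<Prod>i\<in>{..<n} - C. f (x i)) * (\<Prod>i\<in>C. f (x i))"
        by (intro prod.subset_diff) auto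
      then show "(\<Prod>i<n. f (x i)) * (kO C x * (1 - fO C x y) * (\<Prod>b\<in>{..<n} - C. fO C x (x b))) =
        (\<Prod>i\<in>C. f (x i)) * (kO C x * (1 - fO C x y)) * (\<Prod>b\<in>{..<n} - C. f (x b) * fO C x (x b))"
        by (simp add: prod.distrib mult_ac)
    qed
    then show ?thesis using f01
      by (simp add: sum_ennreal[symmetric] ennreal_mult prod_nonneg)
  qed
  then have "tau f y = PE L M (\<lambda>n x. \<Sum>C\<in>Pow {..<n}. ennreal ((\<Prod>i\<in>C. f (x i)) * (kO C x * (1 - fO C x y))) * ennreal (\<Prod>b\<in>{..<n} - C. f (x b) * fO C x (x b)))"
    by (simp add: tau_def)
  also have "\<dots> = PE L M (\<lambda>k x. ennreal ((\<Prod>i<k. f (x i)) * (kO {..<k} x * (1 - fO {..<k} x y))) *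
      ennreal (exp (L * (\<integral>b. f b * fO {..<k} x b \<partial>M))))"
  proof (rule PE_split_weight)
    show "labf (\<lambda>A x. ennreal ((\<Prod>i\<in>A. f (x i)) * (kO A x * (1 - fO A x y))))"
      by (intro labf_map[where g=ennreal] labf_comb[where g="(*)"] labf_prod labf_kO labf_map[OF labf_fO, where g="\<lambda>q. 1 - q y"])
    show "labf (\<lambda>A x b. f b * fO A x b)"
      by (rule labf_map[OF labf_fO])
  qed (use f01 in \<open>auto intro!: mult_le_one\<close>)
  finally show ?thesis .
qed

section \<open>Adding a pivotal point\<close>

text \<open>The increment of \<open>cG_pivotal\<close> caused by a point at \<open>y\<close>,
  grouped so that in each summand the factor depending only on the explored cluster stands apart
  from what will be integrated over \<open>y\<close> and over the unexplored points.\<close>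

definition piv :: "(real^'d) set \<Rightarrow> nat \<Rightarrow> real^'d \<Rightarrow> (nat \<Rightarrow> real^'d) \<Rightarrow> ennreal" where
  "piv T n y x = (\<Sum>A\<in>Pow {..<n}. ennreal (kG T A x * fG T A x 0) * (ennreal (1 - fG T A x y) *
       ennreal ((\<Prod>b\<in>{..<n} - A. fG T A x (x b)) * cO y ({..<n} - A) x)))"

lemma measurable_piv:
  assumes [measurable]: "T \<in> sets borel"
  shows "(\<lambda>(y, x). piv T n y x) \<in> borel_measurable (M \<Otimes>\<^sub>M SQ M)"
  unfolding piv_def split_beta'
proof (intro borel_measurable_sum)
  fix A assume "A \<in> Pow {..<n}"
  then have [simp]: "finite A" by (auto intro: finite_subset)
  show "(\<lambda>z. ennreal (kG T A (snd z) * fG T A (snd z) 0) * (ennreal (1 - fG T A (snd z) (fst z)) *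
       ennreal ((\<Prod>b\<in>{..<n} - A. fG T A (snd z) (snd z b)) * cO (fst z) ({..<n} - A) (snd z)))) \<in> borel_measurable (M \<Otimes>\<^sub>M SQ M)"
    by measurable
qed

lemma measurable_piv_term:
  assumes [measurable]: "T \<in> sets borel"
  shows "(\<lambda>y. ennreal (1 - fG T A x y) * ennreal (c * cO y B x)) \<in> borel_measurable M"
  by (intro meas_intros assms) measurable

lemma measurable_piv_pair:
  assumes [measurable]: "T \<in> sets borel"
  shows "(\<lambda>(y, x'). ennreal (1 - fG T A x y) * ennreal ((\<Prod>b\<in>B. fG T A x (x' b)) * cO y B x')) \<in> borel_measurable (M \<Otimes>\<^sub>M SQ M)"
    "(\<lambda>(x', y). ennreal (1 - fG T A x y) * ennreal ((\<Prod>b\<in>B. fG T A x (x' b)) * cO y B x')) \<in> borel_measurable (SQ M \<Otimes>\<^sub>M M)"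
    "(\<lambda>x'. ennreal ((\<Prod>b\<in>B. fG T A x (x' b)) * cO y B x')) \<in> borel_measurable (SQ M)"
  unfolding split_beta' by (intro meas_intros assms; measurable)+

text \<open>The first of \<open>n + 1\<close> i.i.d. points plays the added point \<open>y\<close>,
  the remaining ones the configuration to which it is added.\<close>

lemma cG_increment:
  assumes [measurable]: "T \<in> sets borel"
  shows "(\<integral>\<^sup>+x. ennreal (cG T {..<n} x) \<partial>SQ M) + (\<integral>\<^sup>+x. \<integral>\<^sup>+y. piv T n y x \<partial>M \<partial>SQ M)
    \<le> (\<integral>\<^sup>+x. ennreal (cG T {..<Suc n} x) \<partial>SQ M)"
proof -
  note [measurable] = measurable_piv[OF assms, of n]
  interpret P: pair_sigma_finite M "SQ M" by unfold_locales
  have "ennreal (cG T {..<n} x) + piv T n y x \<le> ennreal (cG T {..<Suc n} (case_nat y x))" for x y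
  proof -
    have "piv T n y x = ennreal (\<Sum>A\<in>Pow {..<n}. kG T A x * fG T A x 0 * (1 - fG T A x y) *
       ((\<Prod>b\<in>{..<n} - A. fG T A x (x b)) * cO y ({..<n} - A) x))"
      unfolding piv_def by (subst sum_ennreal[symmetric]) (auto simp: ennreal_mult[symmetric] prod_nonneg mult_ac)
    then show ?thesis using ennreal_leI[OF cG_pivotal[of T n x y]]
      by (simp add: ennreal_plus sum_nonneg prod_nonneg)
  qed
  then have "(\<integral>\<^sup>+y. \<integral>\<^sup>+x. ennreal (cG T {..<n} x) + piv T n y x \<partial>SQ M \<partial>M) \<le>
    (\<integral>\<^sup>+y. \<integral>\<^sup>+x. ennreal (cG T {..<Suc n} (case_nat y x)) \<partial>SQ M \<partial>M)"
    by (intro nn_integral_mono)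
  also have "\<dots> = (\<integral>\<^sup>+x. ennreal (cG T {..<Suc n} x) \<partial>SQ M)"
    by (rule nn_integral_SQ_iter[symmetric]) measurable
  also have "(\<integral>\<^sup>+y. \<integral>\<^sup>+x. ennreal (cG T {..<n} x) + piv T n y x \<partial>SQ M \<partial>M) =
    (\<integral>\<^sup>+x. ennreal (cG T {..<n} x) \<partial>SQ M) + (\<integral>\<^sup>+y. \<integral>\<^sup>+x. piv T n y x \<partial>SQ M \<partial>M)"
    using M.emeasure_space_1 by (simp add: nn_integral_add)
  also have "(\<integral>\<^sup>+y. \<integral>\<^sup>+x. piv T n y x \<partial>SQ M \<partial>M) = (\<integral>\<^sup>+x. \<integral>\<^sup>+y. piv T n y x \<partial>M \<partial>SQ M)"
    by (rule P.Fubini'[symmetric]) measurable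
  finally show ?thesis .
qed

text \<open>Given the explored cluster, the unexplored points form a process thinned by
  \<open>fG\<close>, and integrating over them and over \<open>y\<close> produces
  \<open>tau\<close>. The hypothesis is the bound 1 on \<open>phi\<close> for this thinning
  function, multiplied by the normalising exponential; it compares the two sides cluster by cluster,
  because \<open>PE_one_minus_cG\<close> expresses non-connection with the same cluster
  weights.\<close>

lemma PE_piv_ge:
  assumes T[measurable]: "T \<in> sets borel"
    and hyp: "\<And>k x. ennreal (exp (L * (\<integral>b. fG T {..<k} x b \<partial>M))) \<le>
        ennreal L * (\<integral>\<^sup>+y. ennreal (1 - fG T {..<k} x y) * tau (fG T {..<k} x) y \<partial>M)"
  shows "PE L M (\<lambda>n x. ennreal (1 - cG T {..<n} x)) \<le> ennreal L * PE L M (\<lambda>n x. \<integral>\<^sup>+y. piv T n y x \<partial>M)"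
proof -
  define u where "u A B x = ennreal (kG T A x * fG T A x 0) * (\<integral>\<^sup>+y. ennreal (1 - fG T A x y) *
       ennreal ((\<Prod>b\<in>B. fG T A x (x b)) * cO y B x) \<partial>M)" for A B x
  have "(\<integral>\<^sup>+y. piv T n y x \<partial>M) = (\<Sum>A\<in>Pow {..<n}. u A ({..<n} - A) x)" for n x
  proof -
    have "(\<integral>\<^sup>+y. piv T n y x \<partial>M) = (\<Sum>A\<in>Pow {..<n}. (\<integral>\<^sup>+y. ennreal (kG T A x * fG T A x 0) * (ennreal (1 - fG T A x y) *
       ennreal ((\<Prod>b\<in>{..<n} - A. fG T A x (x b)) * cO y ({..<n} - A) x)) \<partial>M))"
      unfolding piv_def
      by (rule nn_integral_sum, rule borel_measurable_times_ennreal[OF borel_measurable_const measurable_piv_term[OF T]])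
    also have "\<dots> = (\<Sum>A\<in>Pow {..<n}. u A ({..<n} - A) x)"
      unfolding u_def by (intro sum.cong refl nn_integral_cmult measurable_piv_term[OF T])
    finally show ?thesis .
  qed
  then have "PE L M (\<lambda>n x. \<integral>\<^sup>+y. piv T n y x \<partial>M) = PE L M (\<lambda>n x. \<Sum>A\<in>Pow {..<n}. u A ({..<n} - A) x)" by simp
  also have "\<dots> = PE L M (\<lambda>k x. PE L M (\<lambda>m x'. u {..<k} {k..<k+m} (comb_seq k x x')))"
  proof (rule mecke_split[OF L0])
    fix A B :: "nat set" assume fin: "finite A" "finite B"
    then show "u A B \<in> borel_measurable (SQ M)" unfolding u_def by measurable
    fix \<pi> :: "nat \<Rightarrow> nat" and x assume \<pi>: "bij \<pi>"
    then have i: "inj_on \<pi> A" "inj_on \<pi> B" by (auto simp: bij_def intro: inj_on_subset)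
    show "u (\<pi> ` A) (\<pi> ` B) x = u A B (\<lambda>i. x (\<pi> i))"
      unfolding u_def labfD[OF labf_kG fin(1) i(1) refl] labfD[OF labf_fG fin(1) i(1) refl]
        labfD[OF labf_cO fin(2) i(2) refl] prod.reindex[OF i(2)] by simp
  qed
  also have "\<dots> = PE L M (\<lambda>k x. ennreal (kG T {..<k} x * fG T {..<k} x 0) *
      (\<integral>\<^sup>+y. ennreal (1 - fG T {..<k} x y) * tau (fG T {..<k} x) y \<partial>M))"
  proof -
    have "u {..<k} {k..<k+m} (comb_seq k x x') = ennreal (kG T {..<k} x * fG T {..<k} x 0) *
      (\<integral>\<^sup>+y. ennreal (1 - fG T {..<k} x y) * ennreal ((\<Prod>b<m. fG T {..<k} x (x' b)) * cO y {..<m} x') \<partial>M)" for k m x x'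
      unfolding u_def labf_comb_left[OF labf_kG] labf_comb_left[OF labf_fG] labf_comb_right[OF labf_cO]
        labf_comb_right[OF labf_prod[of "fG T {..<k} x"]] ..
    moreover have "PE L M (\<lambda>m x'. ennreal (kG T {..<k} x * fG T {..<k} x 0) *
      (\<integral>\<^sup>+y. ennreal (1 - fG T {..<k} x y) * ennreal ((\<Prod>b<m. fG T {..<k} x (x' b)) * cO y {..<m} x') \<partial>M)) =
      ennreal (kG T {..<k} x * fG T {..<k} x 0) * (\<integral>\<^sup>+y. ennreal (1 - fG T {..<k} x y) * tau (fG T {..<k} x) y \<partial>M)" for k x
    proof -
      have [measurable]: "(\<lambda>y. fG T {..<k} x y) \<in> borel_measurable borel" by measurable
      have "PE L M (\<lambda>m x'. (\<integral>\<^sup>+y. ennreal (1 - fG T {..<k} x y) * ennreal ((\<Prod>b<m. fG T {..<k} x (x' b)) * cO y {..<m} x') \<partial>M)) =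
        (\<integral>\<^sup>+y. PE L M (\<lambda>m x'. ennreal (1 - fG T {..<k} x y) * ennreal ((\<Prod>b<m. fG T {..<k} x (x' b)) * cO y {..<m} x')) \<partial>M)"
        by (rule PE_nn_integral[OF M.sigma_finite_measure_axioms measurable_piv_pair(1)[OF T]])
      also have "\<dots> = (\<integral>\<^sup>+y. ennreal (1 - fG T {..<k} x y) * tau (fG T {..<k} x) y \<partial>M)"
        unfolding tau_def by (intro nn_integral_cong PE_cmult measurable_piv_pair(3)[OF T])
      finally show ?thesis
        by (subst PE_cmult) (rule M.borel_measurable_nn_integral[OF measurable_piv_pair(2)[OF T]], simp)
    qed
    ultimately show ?thesis by simp
  qed
  finally have eq: "PE L M (\<lambda>n x. \<integral>\<^sup>+y. piv T n y x \<partial>M) = PE L M (\<lambda>k x. ennreal (kG T {..<k} x * fG T {..<k} x 0) *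
      (\<integral>\<^sup>+y. ennreal (1 - fG T {..<k} x y) * tau (fG T {..<k} x) y \<partial>M))" .
  have "ennreal (kG T {..<k} x * fG T {..<k} x 0) * ennreal (exp (L * (\<integral>b. fG T {..<k} x b \<partial>M))) \<le>
    ennreal L * (ennreal (kG T {..<k} x * fG T {..<k} x 0) *
      (\<integral>\<^sup>+y. ennreal (1 - fG T {..<k} x y) * tau (fG T {..<k} x) y \<partial>M))" for k x
  proof -
    have "ennreal (kG T {..<k} x * fG T {..<k} x 0) * ennreal (exp (L * (\<integral>b. fG T {..<k} x b \<partial>M))) \<le>
      ennreal (kG T {..<k} x * fG T {..<k} x 0) * (ennreal L *
      (\<integral>\<^sup>+y. ennreal (1 - fG T {..<k} x y) * tau (fG T {..<k} x) y \<partial>M))"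
      using hyp[of k x] by (rule mult_left_mono) simp
    then show ?thesis by (simp only: mult.left_commute)
  qed
  then have "PE L M (\<lambda>n x. ennreal (1 - cG T {..<n} x)) \<le> PE L M (\<lambda>k x. ennreal L * (ennreal (kG T {..<k} x * fG T {..<k} x 0) *
      (\<integral>\<^sup>+y. ennreal (1 - fG T {..<k} x y) * tau (fG T {..<k} x) y \<partial>M)))"
    unfolding PE_one_minus_cG[OF T] by (rule PE_mono)
  also have "\<dots> = ennreal L * PE L M (\<lambda>n x. \<integral>\<^sup>+y. piv T n y x \<partial>M)"
    unfolding eq by (rule PE_cmult) (unfold tau_def, measurable)
  finally show ?thesis .
qed

end

section \<open>Leaving the thinned cluster of the origin\<close>

context window
begin

text \<open>Points weighted by \<open>h\<close> behave, up to normalisation, like a thinned process,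
  from which the target is harder to reach. The exponential gained here is the one that completes
  \<open>tau\<close> in \<open>exit_bound\<close>.\<close>

lemma cE_weight_bound:
  assumes h[measurable]: "h \<in> borel_measurable borel" and h01: "\<And>x. 0 \<le> h x" "\<And>x. h x \<le> (1::real)"
    and T[measurable]: "T \<in> sets borel"
  shows "PE L M (\<lambda>m x. ennreal (\<Prod>i<m. h (x i)) * ennreal (cE T y {..<m} x))
    \<le> ennreal (exp (- (L * (\<integral>b. 1 - h b \<partial>M)))) * PE L M (\<lambda>m x. ennreal (cE T y {..<m} x))"
proof -
  let ?e = "L * (\<integral>b. 1 - h b \<partial>M)"
  have "PE L M (\<lambda>m x. ennreal (\<Prod>i<m. h (x i)) * ennreal (cE T y {..<m} x)) * ennreal (exp ?e)
    \<le> PE L M (\<lambda>m x. ennreal (cE T y {..<m} x))"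
    by (rule PE_thin_mono[where F="\<lambda>A x. ennreal (cE T y A x)"])
       (use h01 in \<open>auto intro!: labf_map[OF labf_cE] cE_mono ennreal_leI meas_intros\<close>)
  then have "ennreal (exp (- ?e)) * (PE L M (\<lambda>m x. ennreal (\<Prod>i<m. h (x i)) * ennreal (cE T y {..<m} x)) * ennreal (exp ?e))
    \<le> ennreal (exp (- ?e)) * PE L M (\<lambda>m x. ennreal (cE T y {..<m} x))"
    by (rule mult_left_mono) simp
  also have "ennreal (exp (- ?e)) * (PE L M (\<lambda>m x. ennreal (\<Prod>i<m. h (x i)) * ennreal (cE T y {..<m} x)) * ennreal (exp ?e)) =
     (ennreal (exp (- ?e)) * ennreal (exp ?e)) * PE L M (\<lambda>m x. ennreal (\<Prod>i<m. h (x i)) * ennreal (cE T y {..<m} x))"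
    by (simp add: mult_ac)
  also have "ennreal (exp (- ?e)) * ennreal (exp ?e) = 1"
    by (subst ennreal_mult[symmetric]) (auto simp: exp_minus field_simps)
  finally show ?thesis by simp
qed

text \<open>Two Mecke steps applied to \<open>cG_le_exit\<close>: \<open>mecke_split\<close>
  separates the cluster of the origin from the other points, and \<open>mecke_one\<close> then turns
  the sum over exit points into an integral over \<open>y\<close>.\<close>

lemma PE_cG_le_exit:
  assumes f[measurable]: "f \<in> borel_measurable borel" and f01: "\<And>x. 0 \<le> f x" "\<And>x. f x \<le> 1"
    and fT: "\<And>z. f z \<noteq> 0 \<Longrightarrow> z \<notin> T" and T0: "0 \<notin> T" and T[measurable]: "T \<in> sets borel"
  shows "PE L M (\<lambda>n x. ennreal (cG T {..<n} x)) \<le>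
    PE L M (\<lambda>k x. ennreal ((\<Prod>i<k. f (x i)) * kO {..<k} x) *
      (ennreal L * (\<integral>\<^sup>+y. PE L M (\<lambda>m x'. ennreal ((1 - f y) * (1 - fO {..<k} x y)) *
        (ennreal (\<Prod>i<m. 1 - f (x' i) * (1 - fO {..<k} x (x' i))) * ennreal (cE T y {..<m} x'))) \<partial>M)))"
proof -
  \<comment> \<open>The weight of a point that is neither in the cluster nor the exit point:
    everything except being kept and seen by the cluster is allowed.\<close>
  define h where "h C x b = 1 - f b * (1 - fO C x b)" for C x b
  have h01: "0 \<le> h C x b" "h C x b \<le> 1" for C x b
    using f01[of b] mult_le_one[of "f b" "1 - fO C x b"] by (auto simp: h_def)
  have hm[measurable]: "h C x \<in> borel_measurable borel" for C x unfolding h_def[abs_def] by measurable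
  have labh: "labf h" unfolding h_def[abs_def] using labf_map[OF labf_fO, of "\<lambda>q b. 1 - f b * (1 - q b)"] by simp
  have hmj: "(\<lambda>z. h C (x z) (b z)) \<in> borel_measurable N"
    if "\<And>i. (\<lambda>z. x z i) \<in> borel_measurable N" "b \<in> borel_measurable N" for C x b and N :: "'z measure"
    unfolding h_def by (intro meas_intros measurable_compose[OF _ f] that)
  define v where "v C x j B x' = ennreal ((1 - f (x' j)) * (1 - fO C x (x' j))) *
      (ennreal (\<Prod>b\<in>B. h C x (x' b)) * ennreal (cE T (x' j) B x'))" for C x j B x'
  define u where "u C B x = ennreal ((\<Prod>i\<in>C. f (x i)) * kO C x) * (\<Sum>j\<in>B. v C x j (B - {j}) x)" for C B x
  have vsym: "v C x (\<pi> j) (\<pi> ` B) x' = v C x j B (\<lambda>i. x' (\<pi> i))" if "finite B" "inj_on \<pi> B" for C x j B x' \<pi>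
    unfolding v_def labfD[OF labf_cE that refl] by (simp add: prod.reindex[OF that(2)])
  have vsym': "v C x j B x' = v C x'' j' B' x'''" if "finite B'" "inj_on \<pi> B'" "B = \<pi> ` B'" "\<And>i. i \<in> B' \<Longrightarrow> x' (\<pi> i) = x''' i"
     "x' j = x''' j'" "fO C x = fO C x''" for C x j B x' x'' j' B' x''' \<pi>
  proof -
    have "cE T (x' j) B x' = cE T (x''' j') B' x'''"
      unfolding that(3,5) by (rule labfD[OF labf_cE]) (use that(1,2,4) in auto)
    moreover have "(\<Prod>b\<in>B. h C x (x' b)) = (\<Prod>b\<in>B'. h C x'' (x''' b))"
      unfolding that(3) prod.reindex[OF that(2)] using that(4,6) by (intro prod.cong) (auto simp: h_def)
    ultimately show ?thesis using that(5,6) by (simp add: v_def)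
  qed
  have v_meas: "(\<lambda>z. v C (x z) j B (x' z)) \<in> borel_measurable N"
    if "\<And>i. (\<lambda>z. x z i) \<in> borel_measurable N" "\<And>i. (\<lambda>z. x' z i) \<in> borel_measurable N" for C x j B x' and N :: "'z measure"
    unfolding v_def by (intro meas_intros hmj that T measurable_compose[OF _ f]) 
  have "PE L M (\<lambda>n x. ennreal (cG T {..<n} x)) \<le> PE L M (\<lambda>n x. \<Sum>C\<in>Pow {..<n}. u C ({..<n} - C) x)"
  proof (rule PE_mono)
    fix n x
    have "(\<Sum>C\<in>Pow {..<n}. u C ({..<n} - C) x) =
      ennreal (\<Sum>C\<in>Pow {..<n}. (\<Prod>i\<in>C. f (x i)) * kO C x *
      (\<Sum>j\<in>{..<n} - C. (1 - f (x j)) * (1 - fO C x (x j)) *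
        ((\<Prod>b\<in>{..<n} - C - {j}. h C x (x b)) * cE T (x j) ({..<n} - C - {j}) x)))"
      unfolding u_def v_def using f01 h01
      by (simp add: sum_ennreal[symmetric] ennreal_mult sum_nonneg prod_nonneg)
    then show "ennreal (cG T {..<n} x) \<le> (\<Sum>C\<in>Pow {..<n}. u C ({..<n} - C) x)"
      using ennreal_leI[OF cG_le_exit[OF f01 fT T0, where n=n and x=x]] by (simp add: h_def)
  qed
  also have "\<dots> = PE L M (\<lambda>k x. PE L M (\<lambda>m x'. u {..<k} {k..<k+m} (comb_seq k x x')))"
  proof (rule mecke_split[OF L0])
    fix A B :: "nat set" assume fin: "finite A" "finite B"
    show "u A B \<in> borel_measurable (SQ M)"
      unfolding u_def by (intro borel_measurable_times_ennreal borel_measurable_sum v_meas meas_intros measurable_compose[OF _ f] fin) measurable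
    fix \<pi> :: "nat \<Rightarrow> nat" and x assume \<pi>: "bij \<pi>"
    then have i: "inj_on \<pi> C" for C by (auto simp: bij_def intro: inj_on_subset)
    have "(\<Sum>j\<in>\<pi> ` B. v (\<pi> ` A) x j (\<pi> ` B - {j}) x) = (\<Sum>j\<in>B. v A (\<lambda>i. x (\<pi> i)) j (B - {j}) (\<lambda>i. x (\<pi> i)))"
      unfolding sum.reindex[OF i]
    proof (rule sum.cong[OF refl], unfold o_def)
      fix j assume "j \<in> B"
      have "\<pi> ` B - {\<pi> j} = \<pi> ` (B - {j})" using \<pi> by (auto simp: bij_def inj_eq)
      then have "v (\<pi> ` A) x (\<pi> j) (\<pi> ` B - {\<pi> j}) x = v (\<pi> ` A) x j (B - {j}) (\<lambda>i. x (\<pi> i))"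
        using vsym[of "B - {j}" \<pi>] i fin by simp
      also have "\<dots> = v A (\<lambda>i. x (\<pi> i)) j (B - {j}) (\<lambda>i. x (\<pi> i))"
        unfolding v_def labfD[OF labf_fO fin(1) i refl] labfD[OF labh fin(1) i refl] ..
      finally show "v (\<pi> ` A) x (\<pi> j) (\<pi> ` B - {\<pi> j}) x = v A (\<lambda>i. x (\<pi> i)) j (B - {j}) (\<lambda>i. x (\<pi> i))" .
    qed
    then show "u (\<pi> ` A) (\<pi> ` B) x = u A B (\<lambda>i. x (\<pi> i))"
      unfolding u_def labfD[OF labf_kO fin(1) i refl] prod.reindex[OF i] by (simp add: o_def)
  qed
  also have "\<dots> = PE L M (\<lambda>k x. ennreal ((\<Prod>i<k. f (x i)) * kO {..<k} x) *
      PE L M (\<lambda>m x'. \<Sum>j<m. v {..<k} x j ({..<m} - {j}) x'))"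
  proof -
    have "u {..<k} {k..<k+m} (comb_seq k x x') = ennreal ((\<Prod>i<k. f (x i)) * kO {..<k} x) *
        (\<Sum>j<m. v {..<k} x j ({..<m} - {j}) x')" for k m x x'
    proof -
      have im: "{k..<k+m} = (\<lambda>i. k + i) ` {..<m}"
        by (simp add: lessThan_atLeast0 image_add_atLeastLessThan add.commute)
      have "(\<Sum>j\<in>{k..<k+m}. v {..<k} (comb_seq k x x') j ({k..<k+m} - {j}) (comb_seq k x x')) =
        (\<Sum>j<m. v {..<k} x j ({..<m} - {j}) x')"
        unfolding im
      proof (subst sum.reindex, simp, rule sum.cong[OF refl], unfold o_def)
        fix j
        show "v {..<k} (comb_seq k x x') (k + j) ((\<lambda>i. k + i) ` {..<m} - {k + j}) (comb_seq k x x') = v {..<k} x j ({..<m} - {j}) x'"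
          by (rule vsym'[of _ "\<lambda>i. k + i"]) (auto simp: labf_comb_left[OF labf_fO])
      qed
      then show ?thesis
        unfolding u_def labf_comb_left[OF labf_kO] labf_comb_left[OF labf_prod] by simp
    qed
    moreover have "PE L M (\<lambda>m x'. ennreal ((\<Prod>i<k. f (x i)) * kO {..<k} x) * (\<Sum>j<m. v {..<k} x j ({..<m} - {j}) x')) =
      ennreal ((\<Prod>i<k. f (x i)) * kO {..<k} x) * PE L M (\<lambda>m x'. \<Sum>j<m. v {..<k} x j ({..<m} - {j}) x')" for k x
      by (rule PE_cmult, intro borel_measurable_sum v_meas) measurable
    ultimately show ?thesis by simp
  qed
  also have "\<dots> = PE L M (\<lambda>k x. ennreal ((\<Prod>i<k. f (x i)) * kO {..<k} x) *
      (ennreal L * (\<integral>\<^sup>+y. PE L M (\<lambda>m x'. ennreal ((1 - f y) * (1 - fO {..<k} x y)) *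
        (ennreal (\<Prod>i<m. h {..<k} x (x' i)) * ennreal (cE T y {..<m} x'))) \<partial>M)))"
  proof -
    have "PE L M (\<lambda>m x'. \<Sum>j<m. v {..<k} x j ({..<m} - {j}) x') =
      ennreal L * (\<integral>\<^sup>+y. PE L M (\<lambda>m x'. v {..<k} x 0 {1..<1+m} (case_nat y x')) \<partial>M)" for k x
    proof (rule mecke_one[OF L0])
      show "v {..<k} x j B \<in> borel_measurable (SQ M)" for j B
        by (rule v_meas) measurable
      show "v {..<k} x (\<pi> j) (\<pi> ` B) x' = v {..<k} x j B (\<lambda>i. x' (\<pi> i))" if "bij \<pi>" "finite B" for \<pi> j B x'
        using that by (intro vsym) (auto simp: bij_def intro: inj_on_subset)
    qed
    moreover have "v {..<k} x 0 {1..<1+m} (case_nat y x') = ennreal ((1 - f y) * (1 - fO {..<k} x y)) *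
        (ennreal (\<Prod>i<m. h {..<k} x (x' i)) * ennreal (cE T y {..<m} x'))" for k x m y x'
      unfolding v_def labf_case_nat[OF labf_cE] labf_case_nat[OF labf_prod] by simp
    ultimately show ?thesis by simp
  qed
  finally show ?thesis by (simp add: h_def)
qed

text \<open>\<open>Y\<close> collects the possible locations of the exit point, which lie within the
  range of \<open>psi\<close> from the origin or from the support of \<open>f\<close>, and
  \<open>th\<close> bounds the cost of reaching the target from any of them. What remains after
  extracting \<open>th\<close> is the integral defining \<open>phi\<close>.\<close>

lemma exit_bound:
  assumes f[measurable]: "f \<in> borel_measurable borel" and f01: "\<And>x. 0 \<le> f x" "\<And>x. f x \<le> 1"
    and fT: "\<And>z. f z \<noteq> 0 \<Longrightarrow> z \<notin> T" and T0: "0 \<notin> T" and T[measurable]: "T \<in> sets borel"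
    and Y: "\<And>y. psi y \<noteq> 0 \<Longrightarrow> y \<in> Y" "\<And>y z. f z \<noteq> 0 \<Longrightarrow> psi (y - z) \<noteq> 0 \<Longrightarrow> y \<in> Y"
    and th: "\<And>y. y \<in> Y \<Longrightarrow> PE L M (\<lambda>m x. ennreal (cE T y {..<m} x)) \<le> th"
  shows "PE L M (\<lambda>n x. ennreal (cG T {..<n} x)) \<le>
    th * (ennreal L * (ennreal (exp (- (L * (\<integral>b. f b \<partial>M)))) * (\<integral>\<^sup>+y. ennreal (1 - f y) * tau f y \<partial>M)))"
proof -
  define K where "K k x y = ennreal ((\<Prod>i<k. f (x i)) * (kO {..<k} x * (1 - fO {..<k} x y))) *
     ennreal (exp (L * (\<integral>b. f b * fO {..<k} x b \<partial>M)))" for k x y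
  let ?e = "ennreal (exp (- (L * (\<integral>b. f b \<partial>M))))"
  have intO: "integrable M (\<lambda>b. f b * fO {..<k} x b)" "integrable M f" for k x
    using f01 by (auto intro!: integrable_01 mult_le_one)
  have le: "ennreal ((\<Prod>i<k. f (x i)) * kO {..<k} x) *
      (ennreal L * (\<integral>\<^sup>+y. PE L M (\<lambda>m x'. ennreal ((1 - f y) * (1 - fO {..<k} x y)) *
        (ennreal (\<Prod>i<m. 1 - f (x' i) * (1 - fO {..<k} x (x' i))) * ennreal (cE T y {..<m} x'))) \<partial>M)) \<le>
    (th * ennreal L * ?e) * (\<integral>\<^sup>+y. ennreal (1 - f y) * K k x y \<partial>M)" for k x
  proof -
    let ?a = "ennreal ((\<Prod>i<k. f (x i)) * kO {..<k} x)"
    let ?P = "\<lambda>y. PE L M (\<lambda>m x'. ennreal ((1 - f y) * (1 - fO {..<k} x y)) *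
        (ennreal (\<Prod>i<m. 1 - f (x' i) * (1 - fO {..<k} x (x' i))) * ennreal (cE T y {..<m} x')))"
    \<comment> \<open>Either the point \<open>y\<close> cannot be seen from the cluster, or the
      cluster does not survive the thinning, and then the left side is 0; otherwise \<open>y\<close>
      lies in \<open>Y\<close> and \<open>th\<close> applies.\<close>
    have pt: "?a * ?P y \<le> th * ?e * (ennreal (1 - f y) * K k x y)" for y
    proof (cases "(\<Prod>i<k. f (x i)) * (1 - fO {..<k} x y) = 0")
      case True
      then have "(\<Prod>i<k. f (x i)) * kO {..<k} x = 0 \<or> 1 - fO {..<k} x y = 0" by auto
      then have "?a * ennreal ((1 - f y) * (1 - fO {..<k} x y)) = 0"
        by (elim disjE) (simp_all only: mult_zero_right mult_zero_left ennreal_0)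
      moreover have "?a * ?P y = ?a * ennreal ((1 - f y) * (1 - fO {..<k} x y)) * PE L M (\<lambda>m x'.
        (ennreal (\<Prod>i<m. 1 - f (x' i) * (1 - fO {..<k} x (x' i))) * ennreal (cE T y {..<m} x')))"
        by (subst PE_cmult) (auto simp: mult.assoc intro!: meas_intros measurable_compose[OF _ f])
      ultimately have "?a * ?P y = 0" by (simp only: mult_zero_left)
      then show ?thesis by (simp only: zero_le)
    next
      case False
      have "y \<in> Y"
      proof (rule ccontr)
        assume y: "y \<notin> Y"
        then have "psi y = 0" using Y(1) by blast
        moreover have "psi (y - x i) = 0" if "i < k" for i
        proof -
          have "f (x i) \<noteq> 0" using False that by (auto simp: prod_zero_iff)
          then show ?thesis using Y(2) y by blast
        qed
        ultimately show False using False by (simp add: fO_def)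
      qed
      let ?h = "\<lambda>b. 1 - f b * (1 - fO {..<k} x b)"
      have h01: "0 \<le> ?h b" "?h b \<le> 1" for b
        using f01[of b] mult_le_one[of "f b" "1 - fO {..<k} x b"] by auto
      have "?P y = ennreal ((1 - f y) * (1 - fO {..<k} x y)) * PE L M (\<lambda>m x'. ennreal (\<Prod>i<m. ?h (x' i)) * ennreal (cE T y {..<m} x'))"
        by (rule PE_cmult) (intro meas_intros measurable_compose[OF _ f] T; measurable)
      also have "\<dots> \<le> ennreal ((1 - f y) * (1 - fO {..<k} x y)) *
          (ennreal (exp (- (L * (\<integral>b. 1 - ?h b \<partial>M)))) * PE L M (\<lambda>m x. ennreal (cE T y {..<m} x)))"
        by (intro mult_left_mono cE_weight_bound h01 T) auto
      also have "\<dots> \<le> ennreal ((1 - f y) * (1 - fO {..<k} x y)) * (ennreal (exp (- (L * (\<integral>b. 1 - ?h b \<partial>M)))) * th)"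
        by (intro mult_left_mono th \<open>y \<in> Y\<close>) auto
      finally have "?a * ?P y \<le> ?a * (ennreal ((1 - f y) * (1 - fO {..<k} x y)) * (ennreal (exp (- (L * (\<integral>b. 1 - ?h b \<partial>M)))) * th))"
        by (rule mult_left_mono) simp
      \<comment> \<open>The exponent splits: the integral of \<open>f\<close> gives the
        normalisation of the thinned process, and that of \<open>f * fO\<close> is the exponential
        occurring in \<open>tau_eq\<close>.\<close>
      also have "(\<integral>b. 1 - ?h b \<partial>M) = (\<integral>b. f b \<partial>M) - (\<integral>b. f b * fO {..<k} x b \<partial>M)"
        by (simp add: right_diff_distrib Bochner_Integration.integral_diff[OF intO(2) intO(1)])
      also have "ennreal (exp (- (L * ((\<integral>b. f b \<partial>M) - (\<integral>b. f b * fO {..<k} x b \<partial>M))))) =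
          ?e * ennreal (exp (L * (\<integral>b. f b * fO {..<k} x b \<partial>M)))"
        by (simp add: ennreal_mult[symmetric] exp_add[symmetric] algebra_simps)
      also have "?a * (ennreal ((1 - f y) * (1 - fO {..<k} x y)) * (?e * ennreal (exp (L * (\<integral>b. f b * fO {..<k} x b \<partial>M))) * th)) =
         th * ?e * (ennreal (1 - f y) * K k x y)"
        unfolding K_def using f01 by (simp add: ennreal_mult prod_nonneg mult_ac)
      finally show ?thesis .
    qed
    have Pm: "?P \<in> borel_measurable M"
      by (rule measurable_PE, unfold split_beta') (intro meas_intros measurable_compose[OF _ f] T; measurable)
    have "?a * (ennreal L * (\<integral>\<^sup>+y. ?P y \<partial>M)) = ennreal L * (\<integral>\<^sup>+y. ?a * ?P y \<partial>M)"
      by (subst nn_integral_cmult[OF Pm]) (simp add: mult_ac)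
    also have "\<dots> \<le> ennreal L * (\<integral>\<^sup>+y. th * ?e * (ennreal (1 - f y) * K k x y) \<partial>M)"
      by (intro mult_left_mono nn_integral_mono pt) auto
    also have "\<dots> = (th * ennreal L * ?e) * (\<integral>\<^sup>+y. ennreal (1 - f y) * K k x y \<partial>M)"
      unfolding K_def by (subst nn_integral_cmult) (auto simp: mult_ac)
    finally show ?thesis .
  qed
  have lm: "(\<lambda>z. \<integral>b. f b * fO A (x z) b \<partial>M) \<in> borel_measurable N"
    if [measurable]: "\<And>i. (\<lambda>z. x z i) \<in> borel_measurable N" for A x and N :: "'z measure"
  proof (rule M.borel_measurable_lebesgue_integral, unfold split_beta')
    show "(\<lambda>z. f (snd z) * fO A (x (fst z)) (snd z)) \<in> borel_measurable (N \<Otimes>\<^sub>M M)"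
      by (intro meas_intros measurable_compose[OF _ f] measurable_compose[OF measurable_fst that]) measurable
  qed
  have Kj: "(\<lambda>z. K k (x z) (y z)) \<in> borel_measurable N"
    if [measurable]: "\<And>i. (\<lambda>z. x z i) \<in> borel_measurable N" "y \<in> borel_measurable N" for k x y and N :: "'z measure"
    unfolding K_def
    by (intro meas_intros measurable_compose[OF _ f] that measurable_compose[OF _ borel_measurable_exp] lm) auto
  have "PE L M (\<lambda>n x. ennreal (cG T {..<n} x)) \<le> PE L M (\<lambda>k x. (th * ennreal L * ?e) * (\<integral>\<^sup>+y. ennreal (1 - f y) * K k x y \<partial>M))"
    by (rule order_trans[OF PE_cG_le_exit[OF f f01 fT T0 T] PE_mono[OF le]])
  also have "\<dots> = (th * ennreal L * ?e) * PE L M (\<lambda>k x. \<integral>\<^sup>+y. ennreal (1 - f y) * K k x y \<partial>M)"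
    by (rule PE_cmult, rule M.borel_measurable_nn_integral, unfold split_beta', intro meas_intros Kj measurable_compose[OF _ f]) measurable
  also have "PE L M (\<lambda>k x. \<integral>\<^sup>+y. ennreal (1 - f y) * K k x y \<partial>M) = (\<integral>\<^sup>+y. PE L M (\<lambda>k x. ennreal (1 - f y) * K k x y) \<partial>M)"
    by (rule PE_nn_integral[OF M.sigma_finite_measure_axioms], unfold split_beta', intro meas_intros Kj measurable_compose[OF _ f]) measurable
  also have "\<dots> = (\<integral>\<^sup>+y. ennreal (1 - f y) * tau f y \<partial>M)"
    unfolding tau_eq[OF f f01] K_def[symmetric] by (intro nn_integral_cong PE_cmult Kj) measurable
  finally show ?thesis by (simp add: mult_ac)
qed

end

section \<open>A differential inequality for exponential series\<close>

text \<open>If \<open>g n\<close> is the probability of the event with \<open>n\<close> points and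
  \<open>x\<close> the mean number of points, then theta(x) = exp(-x) times the series is the
  Poisson average, and its derivative is the average of \<open>g (Suc n) - g n\<close>. So
  \<open>H\<close> says, without the exponential factor, that 1 - theta <= x theta', and the
  derivative of x (1 - theta) is (1 - theta) - x theta' <= 0.\<close>

lemma exp_series_decr:
  fixes g :: "nat \<Rightarrow> real"
  assumes g: "\<And>n. \<bar>g n\<bar> \<le> 1" and ab: "a \<le> b"
    and H: "\<And>x. a \<le> x \<Longrightarrow> x \<le> b \<Longrightarrow> (\<Sum>n. x ^ n / fact n * (1 - g n)) \<le> x * (\<Sum>n. x ^ n / fact n * (g (Suc n) - g n))"
  shows "b * (1 - exp (- b) * (\<Sum>n. b ^ n / fact n * g n)) \<le> a * (1 - exp (- a) * (\<Sum>n. a ^ n / fact n * g n))"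
proof -
  define S where "S x = (\<Sum>n. x ^ n / fact n * g n)" for x
  define S' where "S' x = (\<Sum>n. x ^ n / fact n * g (Suc n))" for x
  have sume: "summable (\<lambda>n. \<bar>x\<bar> ^ n / fact n :: real)" for x
    using summable_exp_generic[of "\<bar>x\<bar>"] by (simp add: scaleR_conv_of_real field_simps)
  have sumg: "summable (\<lambda>n. x ^ n / fact n * h n)" if "\<And>n. \<bar>h n\<bar> \<le> 1" for h and x :: real
  proof (rule summable_comparison_test'[OF sume[of x]])
    fix n :: nat
    have "norm (x ^ n / fact n * h n) = \<bar>x\<bar> ^ n / fact n * \<bar>h n\<bar>" by (simp add: abs_mult power_abs)
    also have "\<dots> \<le> \<bar>x\<bar> ^ n / fact n * 1" by (intro mult_left_mono that) auto
    finally show "norm (x ^ n / fact n * h n) \<le> \<bar>x\<bar> ^ n / fact n" by simp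
  qed
  have expS: "exp x = (\<Sum>n. x ^ n / fact n)" for x :: real
    by (simp add: exp_def scaleR_conv_of_real field_simps)
  have D: "(S has_field_derivative S' x) (at x)" for x
  proof -
    have "((\<lambda>x. \<Sum>n. (g n / fact n) * x ^ n) has_field_derivative (\<Sum>n. diffs (\<lambda>n. g n / fact n) n * x ^ n)) (at x)"
    proof (rule termdiffs_strong_converges_everywhere)
      show "summable (\<lambda>n. g n / fact n * y ^ n)" for y
        using sumg[of g y] g by (simp add: mult_ac)
    qed
    also have "(\<lambda>x. \<Sum>n. (g n / fact n) * x ^ n) = S" by (simp add: S_def fun_eq_iff mult_ac)
    also have "(\<Sum>n. diffs (\<lambda>n. g n / fact n) n * x ^ n) = S' x"
    proof -
      have "diffs (\<lambda>n. g n / fact n) n * x ^ n = x ^ n / fact n * g (Suc n)" for n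
        unfolding diffs_def by (simp add: field_simps del: of_nat_Suc)
      then show ?thesis by (simp add: S'_def)
    qed
    finally show ?thesis .
  qed
  have D2: "((\<lambda>x. x * (1 - exp (- x) * S x)) has_field_derivative
      (1 - exp (- x) * S x) + x * (exp (- x) * (S x - S' x))) (at x)" for x
    by (rule derivative_eq_intros D refl)+ (simp add: algebra_simps)
  have "b * (1 - exp (- b) * S b) \<le> a * (1 - exp (- a) * S a)"
  proof (rule DERIV_nonpos_imp_nonincreasing[OF ab], intro exI conjI, rule D2)
    fix x assume x: "a \<le> x" "x \<le> b"
    have s: "summable (\<lambda>n. x ^ n / fact n * 1)" "summable (\<lambda>n. x ^ n / fact n * g n)"
      "summable (\<lambda>n. x ^ n / fact n * g (Suc n))"
      using sumg[of "\<lambda>_. 1" x] sumg[of g x] sumg[of "\<lambda>n. g (Suc n)" x] g by auto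
    have 1: "(\<Sum>n. x ^ n / fact n * (1 - g n)) = exp x - S x"
      using suminf_diff[OF s(1,2)] unfolding right_diff_distrib S_def by (simp add: expS)
    have 2: "(\<Sum>n. x ^ n / fact n * (g (Suc n) - g n)) = S' x - S x"
      using suminf_diff[OF s(3,2)] unfolding right_diff_distrib S_def S'_def by simp
    have "exp x - S x \<le> x * (S' x - S x)" using H[OF x] 1 2 by simp
    then have "exp (- x) * (exp x - S x) \<le> exp (- x) * (x * (S' x - S x))" by (rule mult_left_mono) simp
    then show "(1 - exp (- x) * S x) + x * (exp (- x) * (S x - S' x)) \<le> 0"
      by (simp add: algebra_simps exp_minus)
  qed
  then show ?thesis by (simp add: S_def)
qed

subsection \<open>Changing the window\<close>

lemma PE_change:
  fixes M1 :: "'b measure" and M2 :: "'a measure"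
  assumes iid: "iid_seq M1" "iid_seq M2"
    and \<tau>: "\<tau> \<in> measurable M2 M1" and w: "w \<in> borel_measurable M2"
    and H: "\<And>g. g \<in> borel_measurable M1 \<Longrightarrow> (\<integral>\<^sup>+x. w x * g (\<tau> x) \<partial>M2) = ennreal r * (\<integral>\<^sup>+x. g x \<partial>M1)"
    and r: "0 \<le> r" and L: "0 \<le> L"
    and F: "\<And>n. F n \<in> borel_measurable (SQ M1)" "\<And>n. depends {..<n} (F n)"
  shows "PE L M2 (\<lambda>n x. (\<Prod>i<n. w (x i)) * F n (\<lambda>i. \<tau> (x i))) = PE (L * r) M1 F"
  unfolding PE_def
proof (rule suminf_cong)
  fix n
  have "(\<integral>\<^sup>+x. (\<Prod>i<n. w (x i)) * F n (\<lambda>i. \<tau> (x i)) \<partial>SQ M2) = ennreal r ^ n * (\<integral>\<^sup>+x. F n x \<partial>SQ M1)"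
    by (rule nn_integral_SQ_change[OF iid \<tau> w H F])
  moreover have "ennreal ((L * r) ^ n / fact n) = ennreal (L ^ n / fact n) * ennreal r ^ n"
    using r L by (simp add: power_mult_distrib ennreal_power ennreal_mult[symmetric])
  ultimately show "ennreal (L ^ n / fact n) * (\<integral>\<^sup>+x. (\<Prod>i<n. w (x i)) * F n (\<lambda>i. \<tau> (x i)) \<partial>SQ M2) =
      ennreal ((L * r) ^ n / fact n) * (\<integral>\<^sup>+x. F n x \<partial>SQ M1)"
    by (simp add: mult.assoc)
qed

lemma sets_SQ: "sets M = sets borel \<Longrightarrow> sets (SQ M) = sets (PiM UNIV (\<lambda>_. borel))"
  by (rule sets_PiM_cong) auto

lemma measurable_SQ_eq: "sets M = sets borel \<Longrightarrow> borel_measurable (SQ M) = borel_measurable (PiM UNIV (\<lambda>_. borel))"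
  by (rule measurable_cong_sets[OF sets_SQ refl])

text \<open>Colour each point with the first colour with probability \<open>w1\<close> and the
  second with probability \<open>w2\<close>. The two colour classes are independent Poisson
  processes, and changing variables turns their intensities into \<open>M1\<close> and
  \<open>M2\<close>. This merges a single cube with the remaining ones.\<close>

lemma PE_superpose:
  fixes M M1 M2 :: "'a :: topological_space measure"
  assumes iid: "iid_seq M" "iid_seq M1" "iid_seq M2"
    and sets: "sets M = sets borel" "sets M1 = sets borel" "sets M2 = sets borel"
    and w[measurable]: "w1 \<in> borel_measurable borel" "w2 \<in> borel_measurable borel" and w1: "\<And>x. w1 x + w2 x = 1"
    and H1: "\<And>g. g \<in> borel_measurable borel \<Longrightarrow> (\<integral>\<^sup>+x. w1 x * g x \<partial>M) = ennreal r1 * (\<integral>\<^sup>+x. g x \<partial>M1)"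
    and H2: "\<And>g. g \<in> borel_measurable borel \<Longrightarrow> (\<integral>\<^sup>+x. w2 x * g x \<partial>M) = ennreal r2 * (\<integral>\<^sup>+x. g x \<partial>M2)"
    and r: "0 \<le> r1" "0 \<le> r2" and L: "0 \<le> L"
    and F: "labf F" "\<And>A. finite A \<Longrightarrow> F A \<in> borel_measurable (PiM UNIV (\<lambda>_. borel))"
  shows "PE L M (\<lambda>n x. F {..<n} x) = PE (L * r1) M1 (\<lambda>k x. PE (L * r2) M2 (\<lambda>m x'. F {..<k+m} (comb_seq k x x')))"
proof -
  interpret M: iid_seq M by fact
  interpret M1: iid_seq M1 by fact
  interpret M2: iid_seq M2 by fact
  note [measurable_cong] = sets
  \<comment> \<open>The weight of the colouring in which \<open>A\<close> has the first and
    \<open>B\<close> the second colour; since \<open>w1 + w2 = 1\<close>, the sum over all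
    colourings is \<open>F\<close> itself.\<close>
  define u where "u A B x = (\<Prod>i\<in>A. w1 (x i)) * ((\<Prod>i\<in>B. w2 (x i)) * F (A \<union> B) x)" for A B x
  have FM: "F A \<in> borel_measurable (SQ M)" "F A \<in> borel_measurable (SQ M1)" "F A \<in> borel_measurable (SQ M2)" if "finite A" for A
    using F(2)[OF that] by (simp_all only: measurable_SQ_eq[OF sets(1)] measurable_SQ_eq[OF sets(2)] measurable_SQ_eq[OF sets(3)])
  have cb: "(\<lambda>z. F {..<k} (comb_seq i (f z) (g z))) \<in> borel_measurable N"
    if "f \<in> measurable N (PiM UNIV (\<lambda>_. borel))" "g \<in> measurable N (PiM UNIV (\<lambda>_. borel))" for k i f g and N :: "'z measure"
    by (rule measurable_compose[OF measurable_comb_seq'[OF that] F(2)]) simp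
  have sqm: "(\<lambda>x. x) \<in> measurable (SQ M1) (PiM UNIV (\<lambda>_. borel))" "(\<lambda>x. x) \<in> measurable (SQ M2) (PiM UNIV (\<lambda>_. borel))"
    "(\<lambda>x. x) \<in> measurable (SQ M) (PiM UNIV (\<lambda>_. borel))"
    by (rule measurable_ident_sets, rule sets_SQ, rule sets)+
 have constM: "(\<lambda>_. c) \<in> measurable N (PiM UNIV (\<lambda>_. borel))" for c :: "nat \<Rightarrow> 'a" and N :: "'z measure"
    by (rule measurable_const) (simp add: space_PiM)
  have wm[measurable]: "w1 \<in> borel_measurable M" "w2 \<in> borel_measurable M"
    by (simp_all cong: measurable_cong_sets add: sets w)
  have "PE L M (\<lambda>n x. F {..<n} x) = PE L M (\<lambda>n x. \<Sum>A\<in>Pow {..<n}. u A ({..<n} - A) x)"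
  proof -
    have "F {..<n} x = (\<Sum>A\<in>Pow {..<n}. u A ({..<n} - A) x)" for n x
    proof -
      have "(\<Sum>A\<in>Pow {..<n}. u A ({..<n} - A) x) = (\<Sum>A\<in>Pow {..<n}. (\<Prod>i\<in>A. w1 (x i)) * (\<Prod>i\<in>{..<n} - A. w2 (x i)) * F {..<n} x)"
        by (intro sum.cong refl) (auto simp: u_def Un_absorb1 mult.assoc)
      also have "\<dots> = F {..<n} x"
        by (simp add: sum_distrib_right[symmetric] prod_Pow_add w1)
      finally show ?thesis ..
    qed
    then show ?thesis by simp
  qed
  also have "\<dots> = PE L M (\<lambda>k x. PE L M (\<lambda>m x'. u {..<k} {k..<k+m} (comb_seq k x x')))"
  proof (rule M.mecke_split[OF L])
    fix A B :: "nat set" assume fin: "finite A" "finite B"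
    have [measurable]: "F (A \<union> B) \<in> borel_measurable (SQ M)" by (rule FM) (use fin in auto)
    show "u A B \<in> borel_measurable (SQ M)" unfolding u_def by measurable
    fix \<pi> :: "nat \<Rightarrow> nat" and x assume \<pi>: "bij \<pi>"
    then have i: "inj_on \<pi> C" for C by (auto simp: bij_def intro: inj_on_subset)
    have "F (\<pi> ` A \<union> \<pi> ` B) x = F (A \<union> B) (\<lambda>i. x (\<pi> i))"
      unfolding image_Un[symmetric] by (rule labfD[OF F(1)]) (use fin i in auto)
    then show "u (\<pi> ` A) (\<pi> ` B) x = u A B (\<lambda>i. x (\<pi> i))"
      unfolding u_def prod.reindex[OF i] by (simp add: o_def)
  qed
  also have "\<dots> = PE L M (\<lambda>k x. (\<Prod>i<k. w1 (x i)) * PE (L * r2) M2 (\<lambda>m x'. F {..<k+m} (comb_seq k x x')))"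
  proof -
    have "u {..<k} {k..<k+m} (comb_seq k x x') = (\<Prod>i<k. w1 (x i)) * ((\<Prod>i<m. w2 (x' i)) * F {..<k+m} (comb_seq k x x'))" for k m x x'
    proof -
      have "{..<k} \<union> {k..<k+m} = {..<k+m}" by auto
      then show ?thesis unfolding u_def labf_comb_left[OF labf_prod] labf_comb_right[OF labf_prod] by simp
    qed
    moreover have "PE L M (\<lambda>m x'. (\<Prod>i<k. w1 (x i)) * ((\<Prod>i<m. w2 (x' i)) * F {..<k+m} (comb_seq k x x'))) =
      (\<Prod>i<k. w1 (x i)) * PE L M (\<lambda>m x'. (\<Prod>i<m. w2 (x' i)) * F {..<k+m} (comb_seq k x x'))" for k x
      by (rule M.PE_cmult) (intro borel_measurable_times_ennreal cb sqm constM; measurable)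
    moreover have "PE L M (\<lambda>m x'. (\<Prod>i<m. w2 (x' i)) * F {..<k+m} (comb_seq k x x')) = PE (L * r2) M2 (\<lambda>m x'. F {..<k+m} (comb_seq k x x'))" for k x
    proof (rule PE_change[where \<tau>="\<lambda>x. x", OF iid(3,1)])
      show "depends {..<n} (\<lambda>x'. F {..<k+n} (comb_seq k x x'))" for n
        unfolding depends_def by (intro allI impI labf_cong[OF F(1)]) (auto simp: comb_seq_def)
      show "(\<lambda>x'. F {..<k+n} (comb_seq k x x')) \<in> borel_measurable (SQ M2)" for n
        by (intro cb sqm constM)
    qed (use H2 r L in \<open>auto cong: measurable_cong_sets simp: sets\<close>)
    ultimately show ?thesis by simp
  qed
  also have "\<dots> = PE (L * r1) M1 (\<lambda>k x. PE (L * r2) M2 (\<lambda>m x'. F {..<k+m} (comb_seq k x x')))"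
  proof (rule PE_change[where \<tau>="\<lambda>x. x", OF iid(2,1)])
    show "depends {..<n} (\<lambda>x. PE (L * r2) M2 (\<lambda>m x'. F {..<n+m} (comb_seq n x x')))" for n
      unfolding depends_def PE_def
    proof (intro allI impI suminf_cong arg_cong2[where f="(*)"] refl nn_integral_cong labf_cong[OF F(1)])
      fix y y' :: "nat \<Rightarrow> 'a" and m i x' assume "\<forall>i\<in>{..<n}. y i = y' i" "i \<in> {..<n+m}"
      then show "comb_seq n y x' i = comb_seq n y' x' i" by (auto simp: comb_seq_def)
    qed simp
    show "(\<lambda>x. PE (L * r2) M2 (\<lambda>m x'. F {..<n+m} (comb_seq n x x'))) \<in> borel_measurable (SQ M1)" for n
      by (rule M2.measurable_PE, unfold split_beta', intro cb measurable_compose[OF measurable_fst sqm(1)] measurable_compose[OF measurable_snd sqm(2)])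
  qed (use H1 r L in \<open>auto cong: measurable_cong_sets simp: sets\<close>)
  finally show ?thesis .
qed

section \<open>Unit cubes and uniform laws on finite unions of cubes\<close>

text \<open>The model uses closed cubes, which overlap in their faces. The open ones are disjoint
  and carry the same uniform laws.\<close>

definition obox :: "int ^ 'd \<Rightarrow> (real ^ ('d::finite)) set" where
  "obox k = box (\<chi> i. of_int (k $ i)) (\<chi> i. of_int (k $ i) + 1)"

definition OS :: "(int ^ 'd) set \<Rightarrow> (real ^ ('d::finite)) set" where
  "OS S = (\<Union>k\<in>S. obox k)"

text \<open>For the empty family any probability measure serves: the total mass
  \<open>card S\<close> is then 0 and no point is ever drawn.\<close>

definition muS :: "(int ^ 'd) set \<Rightarrow> (real ^ ('d::finite)) measure" where
  "muS S = uniform_measure lborel (if S = {} then obox 0 else OS S)"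

lemma in_obox: "x \<in> obox k \<longleftrightarrow> (\<forall>i. of_int (k $ i) < x $ i \<and> x $ i < of_int (k $ i) + 1)"
  by (simp add: obox_def mem_box_cart)

lemma obox_sets[measurable, simp]: "obox k \<in> sets borel"
  by (simp add: obox_def)

lemma OS_sets[measurable, simp]: "finite S \<Longrightarrow> OS S \<in> sets borel"
  unfolding OS_def by (intro sets.finite_UN) auto

lemma inner_Basis_plus_1:
  fixes f :: "'d::finite \<Rightarrow> real"
  shows "b \<in> Basis \<Longrightarrow> (\<chi> i. f i + 1) \<bullet> b = (\<chi> i. f i) \<bullet> b + 1"
  by (auto simp: Basis_vec_def inner_axis)

lemma emeasure_obox: "emeasure lborel (obox k) = 1"
  unfolding obox_def by (subst emeasure_lborel_box) (simp_all add: inner_Basis_plus_1 inner_diff_left)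

lemma emeasure_unit_cube: "emeasure lborel (unit_cube k) = 1"
  unfolding unit_cube_def by (subst emeasure_lborel_cbox) (simp_all add: inner_Basis_plus_1 inner_diff_left)

lemma obox_disjoint: "k \<noteq> k' \<Longrightarrow> obox k \<inter> obox k' = {}"
proof (rule ccontr)
  assume "k \<noteq> k'" "obox k \<inter> obox k' \<noteq> {}"
  then obtain x where x: "x \<in> obox k" "x \<in> obox k'" by auto
  have "k $ i = k' $ i" for i
  proof -
    have "of_int (k $ i) < x $ i" "x $ i < of_int (k $ i) + 1" "of_int (k' $ i) < x $ i" "x $ i < of_int (k' $ i) + 1"
      using x by (auto simp: in_obox)
    then show ?thesis by linarith
  qed
  with \<open>k \<noteq> k'\<close> show False by (simp add: vec_eq_iff)
qed

lemma uniform_unit_cube: "uniform_measure lborel (unit_cube k) = uniform_measure lborel (obox k)"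
proof (rule measure_eqI)
  fix A :: "(real^'a) set" assume "A \<in> sets (uniform_measure lborel (unit_cube k))"
  then have A[measurable]: "A \<in> sets borel" by simp
  have c[measurable]: "unit_cube k \<in> sets borel" by (simp add: unit_cube_def)
  have sub: "obox k \<subseteq> unit_cube k" by (auto simp: obox_def unit_cube_def mem_box_cart less_imp_le)
  have n: "unit_cube k - obox k \<in> null_sets lborel"
    using emeasure_Diff[of lborel "obox k" "unit_cube k"] sub
    by (intro null_setsI) (auto simp: emeasure_obox emeasure_unit_cube)
  have "emeasure lborel (unit_cube k \<inter> A) = emeasure lborel ((obox k \<inter> A) \<union> ((unit_cube k - obox k) \<inter> A))"
    using sub by (intro arg_cong[where f="emeasure lborel"]) auto
  also have "\<dots> = emeasure lborel (obox k \<inter> A)"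
    by (rule emeasure_Un_null_set) (auto intro!: null_set_Int2 n)
  finally show "emeasure (uniform_measure lborel (unit_cube k)) A = emeasure (uniform_measure lborel (obox k)) A"
    by (simp add: emeasure_obox emeasure_unit_cube)
qed simp

lemma nn_integral_OS:
  assumes "finite S" and [measurable]: "g \<in> borel_measurable borel"
  shows "(\<integral>\<^sup>+x. g x * indicator (OS S) x \<partial>lborel) = (\<Sum>k\<in>S. (\<integral>\<^sup>+x. g x * indicator (obox k) x \<partial>lborel))"
  using assms(1)
proof (induction S)
  case empty then show ?case by (simp add: OS_def)
next
  case (insert k S)
  have "obox k \<inter> obox k' = {}" if "k' \<in> S" for k'
    using that insert.hyps by (intro obox_disjoint) auto
  then have "obox k \<inter> OS S = {}" by (simp add: OS_def Int_UN_distrib)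
  moreover have "OS (insert k S) = obox k \<union> OS S" by (simp add: OS_def)
  ultimately have "g x * indicator (OS (insert k S)) x = g x * indicator (obox k) x + g x * indicator (OS S) x" for x
    by (cases "x \<in> obox k"; cases "x \<in> OS S") auto
  then have "(\<integral>\<^sup>+x. g x * indicator (OS (insert k S)) x \<partial>lborel) =
     (\<integral>\<^sup>+x. g x * indicator (obox k) x \<partial>lborel) + (\<integral>\<^sup>+x. g x * indicator (OS S) x \<partial>lborel)"
    using insert.hyps by (simp add: nn_integral_add)
  then show ?case using insert by simp
qed

lemma emeasure_OS: "finite S \<Longrightarrow> emeasure lborel (OS S) = of_nat (card S)"
  using nn_integral_OS[of S "\<lambda>_. 1"] by (simp add: emeasure_obox)

lemma sets_muS[simp]: "sets (muS S) = sets borel" and space_muS[simp]: "space (muS S) = UNIV"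
  by (auto simp: muS_def)

lemma iid_muS: "finite S \<Longrightarrow> iid_seq (muS S)"
proof -
  assume S: "finite S"
  have "prob_space (muS S)"
    unfolding muS_def by (rule prob_space_uniform_measure) (use S in \<open>auto simp: emeasure_OS emeasure_obox\<close>)
  then show ?thesis by (simp add: iid_seq_def iid_seq_axioms_def)
qed

lemma nn_integral_muS:
  assumes "finite S" and [measurable]: "g \<in> borel_measurable borel"
  shows "of_nat (card S) * (\<integral>\<^sup>+x. g x \<partial>muS S) = (\<integral>\<^sup>+x. g x * indicator (OS S) x \<partial>lborel)"
proof (cases "S = {}")
  case True then show ?thesis by (simp add: OS_def)
next
  case False
  then have "(\<integral>\<^sup>+x. g x \<partial>muS S) = (\<integral>\<^sup>+x. g x * indicator (OS S) x \<partial>lborel) / of_nat (card S)"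
    unfolding muS_def using assms by (simp add: nn_integral_uniform_measure emeasure_OS)
  then have "of_nat (card S) * (\<integral>\<^sup>+x. g x \<partial>muS S) =
      ((\<integral>\<^sup>+x. g x * indicator (OS S) x \<partial>lborel) * of_nat (card S)) / of_nat (card S)"
    by (simp only: ennreal_times_divide mult.commute)
  also have "\<dots> = (\<integral>\<^sup>+x. g x * indicator (OS S) x \<partial>lborel)"
    by (rule mult_divide_eq_ennreal) (use False assms in auto)
  finally show ?thesis .
qed

lemma muS_singleton: "muS {k} = uniform_measure lborel (obox k)"
  by (simp add: muS_def OS_def)

text \<open>The exceptional points lie on countably many hyperplanes, where some coordinate is an
  integer.\<close>

lemma AE_obox: "AE x in lborel. x \<in> obox (\<chi> i. \<lfloor>x $ i :: real\<rfloor>)"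
proof -
  have "AE x :: real^'a in lborel. x $ i \<noteq> c" for i c
  proof -
    have "negligible {x :: real^'a. x \<bullet> axis i 1 = c}"
      by (rule negligible_standard_hyperplane) (auto simp: Basis_vec_def)
    then have "{x :: real^'a. x $ i = c} \<in> null_sets lebesgue"
      by (simp add: negligible_iff_null_sets inner_axis)
    moreover have "{x :: real^'a. x $ i = c} \<in> sets lborel"
      using closed_hyperplane[of "axis i 1 :: real^'a" c] by (simp add: inner_axis' inner_commute)
    ultimately have "{x :: real^'a. x $ i = c} \<in> null_sets lborel"
      by (simp add: null_sets_completion_iff)
    from AE_not_in[OF this] show ?thesis by simp
  qed
  then have "AE x :: real^'a in lborel. \<forall>i. \<forall>c::int. x $ i \<noteq> of_int c"
    by (simp add: AE_all_countable)
  then show ?thesis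
  proof eventually_elim
    case (elim x)
    have "of_int \<lfloor>x $ i\<rfloor> < x $ i" "x $ i < of_int \<lfloor>x $ i\<rfloor> + 1" for i
      using elim of_int_floor_le[of "x $ i"] real_of_int_floor_add_one_gt[of "x $ i"] by (auto simp: less_le)
    then show ?case by (simp add: in_obox)
  qed
qed

text \<open>The lower bound is attained and the upper one is not, because \<open>k\<close> is the
  lower corner of its cube: these cubes tile the box of half side \<open>N\<close> around 0.\<close>

definition KN :: "nat \<Rightarrow> (int ^ ('d::finite)) set" where
  "KN N = {k. \<forall>i. - int N \<le> k $ i \<and> k $ i < int N}"

lemma finite_KN: "finite (KN N :: (int ^ ('d::finite)) set)"
proof -
  have "finite (PiE UNIV (\<lambda>_ :: 'd. {- int N..<int N}))" by (intro finite_PiE) auto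
  moreover have "KN N \<subseteq> vec_lambda ` PiE UNIV (\<lambda>_ :: 'd. {- int N..<int N})"
  proof
    fix k :: "int^'d" assume "k \<in> KN N"
    then have "k = vec_lambda (\<lambda>i. k $ i)" "(\<lambda>i. k $ i) \<in> PiE UNIV (\<lambda>_ :: 'd. {- int N..<int N})"
      by (auto simp: KN_def)
    then show "k \<in> vec_lambda ` PiE UNIV (\<lambda>_ :: 'd. {- int N..<int N})" by blast
  qed
  ultimately show ?thesis by (meson finite_imageI finite_subset)
qed

lemma AE_in_OS_KN: "AE x in lborel. (\<forall>i. \<bar>x $ i\<bar> < real N) \<longrightarrow> x \<in> OS (KN N)"
  using AE_obox
proof eventually_elim
  case (elim x)
  show ?case
  proof
    assume x: "\<forall>i. \<bar>x $ i\<bar> < real N"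
    have "(\<chi> i. \<lfloor>x $ i\<rfloor>) \<in> KN N"
      unfolding KN_def
    proof (rule CollectI, rule allI)
      fix i have "\<bar>x $ i\<bar> < real N" using x by simp
      then show "- int N \<le> (\<chi> i. \<lfloor>x $ i\<rfloor>) $ i \<and> (\<chi> i. \<lfloor>x $ i\<rfloor>) $ i < int N"
        by (simp add: floor_less_iff le_floor_iff abs_less_iff)
    qed
    with elim show "x \<in> OS (KN N)" by (auto simp: OS_def)
  qed
qed

lemma OS_KN_bound: "x \<in> OS (KN N) \<Longrightarrow> \<bar>x $ i\<bar> < real N"
proof -
  assume "x \<in> OS (KN N)"
  then obtain k where k: "k \<in> KN N" "x \<in> obox k" by (auto simp: OS_def)
  then have "- int N \<le> k $ i" "k $ i < int N" "of_int (k $ i) < x $ i" "x $ i < of_int (k $ i) + 1"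
    by (auto simp: KN_def in_obox)
  then show ?thesis by linarith
qed

context rcm
begin

lemma window_muS: "finite S \<Longrightarrow> 0 \<le> L \<Longrightarrow> window psi (muS S) L"
  by (intro window.intro window_axioms.intro iid_muS rcm_axioms) auto

text \<open>Translate by \<open>- y\<close>. The window \<open>S\<close> moves, up to a null set,
  into \<open>S'\<close>, so the translated process is the process of \<open>S'\<close> thinned by
  the indicator \<open>h\<close> of the moved window. The shifted target is contained in
  \<open>T'\<close>, and the connection probability is monotone in both points and target.\<close>

lemma PE_cE_le:
  fixes lam :: real
  assumes S: "finite S" "finite S'" "S' \<noteq> {}" and lam: "0 \<le> lam"
    and sub: "AE x in lborel. x + y \<in> OS S \<longrightarrow> x \<in> OS S'"
    and T[measurable]: "T \<in> sets borel" "T' \<in> sets borel" and TT': "\<And>z. z \<in> T \<Longrightarrow> z - y \<in> T'"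
  shows "ennreal (exp (- (lam * card S))) * PE (lam * card S) (muS S) (\<lambda>m x. ennreal (cE T y {..<m} x)) \<le>
    ennreal (exp (- (lam * card S'))) * PE (lam * card S') (muS S') (\<lambda>m x. ennreal (cG T' {..<m} x))"
proof -
  define L where "L = lam * card S"
  define L' where "L' = lam * card S'"
  \<comment> \<open>The proportion of the mass of \<open>S'\<close> kept by \<open>h\<close>, so
    that the total masses are related by \<open>L' * r = L\<close>.\<close>
  define r where "r = real (card S) / real (card S')"
  define h :: "real^'d \<Rightarrow> real" where "h x = indicator (OS S) (x + y)" for x
  have c': "card S' \<noteq> 0" using S by simp
  have r: "0 \<le> r" "L' * r = L" using c' by (auto simp: r_def L_def L'_def)
  have L0: "0 \<le> L" "0 \<le> L'" using lam by (auto simp: L_def L'_def)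
  interpret W: window psi "muS S'" L' by (rule window_muS) (use S L0 in auto)
  interpret W1: window psi "muS S" L by (rule window_muS) (use S L0 in auto)
  have hm[measurable]: "h \<in> borel_measurable borel" unfolding h_def using S by measurable
  have H: "(\<integral>\<^sup>+x. ennreal (h x) * g (x + y) \<partial>muS S') = ennreal r * (\<integral>\<^sup>+x. g x \<partial>muS S)"
    if [measurable]: "g \<in> borel_measurable borel" for g
  proof -
    have "of_nat (card S') * (\<integral>\<^sup>+x. ennreal (h x) * g (x + y) \<partial>muS S') =
      (\<integral>\<^sup>+x. ennreal (h x) * g (x + y) * indicator (OS S') x \<partial>lborel)"
      by (rule nn_integral_muS) (use S in auto)
    also have "\<dots> = (\<integral>\<^sup>+x. indicator (OS S) (y + x) * g (y + x) \<partial>lborel)"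
      using sub by (intro nn_integral_cong_AE) (auto elim!: eventually_mono simp: h_def indicator_def add.commute)
    also have "\<dots> = (\<integral>\<^sup>+x. indicator (OS S) x * g x \<partial>distr lborel borel ((+) y))"
      using S by (subst nn_integral_distr) auto
    also have "distr lborel borel ((+) y) = lborel" by (rule lborel_distr_plus)
    also have "(\<integral>\<^sup>+x. indicator (OS S) x * g x \<partial>lborel) = of_nat (card S) * (\<integral>\<^sup>+x. g x \<partial>muS S)"
      using S by (subst nn_integral_muS) (auto simp: mult.commute)
    finally have *: "of_nat (card S') * (\<integral>\<^sup>+x. ennreal (h x) * g (x + y) \<partial>muS S') = of_nat (card S) * (\<integral>\<^sup>+x. g x \<partial>muS S)" .
    have "ennreal (1 / real (card S')) * of_nat (card S') = 1"
      using c' by (simp add: ennreal_of_nat_eq_real_of_nat ennreal_mult[symmetric])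
    then have "(\<integral>\<^sup>+x. ennreal (h x) * g (x + y) \<partial>muS S') = ennreal (1 / real (card S')) * (of_nat (card S') * (\<integral>\<^sup>+x. ennreal (h x) * g (x + y) \<partial>muS S'))"
      by (simp add: mult.assoc[symmetric])
    also have "\<dots> = ennreal r * (\<integral>\<^sup>+x. g x \<partial>muS S)"
      unfolding * r_def by (simp add: ennreal_of_nat_eq_real_of_nat ennreal_mult[symmetric] mult.assoc[symmetric])
    finally show ?thesis .
  qed
  have h01: "0 \<le> h x" "h x \<le> 1" for x by (auto simp: h_def indicator_def)
  have inth: "(\<integral>b. 1 - h b \<partial>muS S') = 1 - r"
  proof -
    have "ennreal (\<integral>b. h b \<partial>muS S') = (\<integral>\<^sup>+b. ennreal (h b) \<partial>muS S')"
      by (rule nn_integral_eq_integral[symmetric]) (use h01 in \<open>auto intro!: W.integrable_01\<close>)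
    also have "\<dots> = ennreal r" using H[of "\<lambda>_. 1"] W1.M.emeasure_space_1 by simp
    finally have "(\<integral>b. h b \<partial>muS S') = r" using r by (simp add: h01)
    then show ?thesis
      using W.integrable_01[OF hm h01] W.M.prob_space by (simp add: Bochner_Integration.integral_diff)
  qed
  have "PE L (muS S) (\<lambda>m x. ennreal (cE T y {..<m} x)) = PE L' (muS S') (\<lambda>m x. (\<Prod>i<m. ennreal (h (x i))) * ennreal (cE T y {..<m} (\<lambda>i. x i + y)))"
    unfolding r(2)[symmetric]
  proof (rule PE_change[symmetric])
    show "(\<lambda>x. x + y) \<in> muS S' \<rightarrow>\<^sub>M muS S" by (simp cong: measurable_cong_sets)
    show "(\<lambda>x. ennreal (h x)) \<in> borel_measurable (muS S')" by (simp cong: measurable_cong_sets)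
    show "depends {..<n} (\<lambda>x. ennreal (cE T y {..<n} x))" for n
      unfolding depends_def by (intro allI impI arg_cong[where f=ennreal] labf_cong[OF labf_cE]) auto
    show "(\<lambda>x. ennreal (cE T y {..<n} x)) \<in> borel_measurable (SQ (muS S))" for n
      by (intro W1.meas_intros T) measurable
  qed (use H r L0 W.iid_seq_axioms W1.iid_seq_axioms in \<open>auto cong: measurable_cong_sets\<close>)
  also have "\<dots> \<le> PE L' (muS S') (\<lambda>m x. ennreal (\<Prod>i<m. h (x i)) * ennreal (cG T' {..<m} x))"
  proof (rule W.PE_mono)
    fix m x
    have "cE T y {..<m} (\<lambda>i. x i + y) \<le> cG T' {..<m} x"
      unfolding cE_translate using TT' by (auto intro!: cG_mono)
    then show "(\<Prod>i<m. ennreal (h (x i))) * ennreal (cE T y {..<m} (\<lambda>i. x i + y)) \<le> ennreal (\<Prod>i<m. h (x i)) * ennreal (cG T' {..<m} x)"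
      by (simp add: prod_ennreal h01 mult_left_mono ennreal_leI)
  qed
  finally have 1: "PE L (muS S) (\<lambda>m x. ennreal (cE T y {..<m} x)) \<le> PE L' (muS S') (\<lambda>m x. ennreal (\<Prod>i<m. h (x i)) * ennreal (cG T' {..<m} x))" .
  have 2: "PE L' (muS S') (\<lambda>m x. ennreal (\<Prod>i<m. h (x i)) * ennreal (cG T' {..<m} x)) * ennreal (exp (L' * (1 - r))) \<le>
     PE L' (muS S') (\<lambda>m x. ennreal (cG T' {..<m} x))"
    unfolding inth[symmetric]
    by (rule W.PE_thin_mono[where F="\<lambda>A x. ennreal (cG T' A x)"])
       (use h01 in \<open>auto intro!: labf_map[OF labf_cG] cG_mono ennreal_leI measurable_cG measurable_compose[OF _ measurable_ennreal] W.measurable_SQ_comp\<close>)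
  have "ennreal (exp (- L)) * PE L (muS S) (\<lambda>m x. ennreal (cE T y {..<m} x)) =
    ennreal (exp (- L')) * (PE L (muS S) (\<lambda>m x. ennreal (cE T y {..<m} x)) * ennreal (exp (L' * (1 - r))))"
  proof -
    have "exp (- L) = exp (- L') * exp (L' * (1 - r))"
      using r(2) by (simp add: exp_add[symmetric] algebra_simps)
    then show ?thesis by (simp add: ennreal_mult mult_ac)
  qed
  also have "\<dots> \<le> ennreal (exp (- L')) * PE L' (muS S') (\<lambda>m x. ennreal (cG T' {..<m} x))"
    using order_trans[OF mult_right_mono[OF 1] 2] by (intro mult_left_mono) auto
  finally show ?thesis by (simp add: L_def L'_def)
qed

end

subsection \<open>The random connection model restricted to finitely many cubes\<close>

instance vtx :: (finite) countable by countable_datatype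

abbreviation NN :: "real \<Rightarrow> (int ^ ('d::finite) \<Rightarrow> nat) measure" where
  "NN lam \<equiv> PiM UNIV (\<lambda>k. measure_pmf (poisson_pmf lam))"

abbreviation XX :: "((int ^ 'd) \<times> nat \<Rightarrow> real ^ ('d::finite)) measure" where
  "XX \<equiv> PiM UNIV (\<lambda>ki. uniform_measure lborel (unit_cube (fst ki)))"

lemma prob_unit_cube: "prob_space (uniform_measure lborel (unit_cube k))"
  by (rule prob_space_uniform_measure) (auto simp: emeasure_unit_cube)

interpretation NN: prob_space "NN lam"
  by (intro prob_space_PiM prob_space_measure_pmf)

interpretation XX: prob_space XX
  by (intro prob_space_PiM prob_unit_cube)

lemma RCM_eq: "RCM_space lam = NN lam \<Otimes>\<^sub>M (XX \<Otimes>\<^sub>M (UM \<Otimes>\<^sub>M UM))"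
  by (simp add: RCM_space_def UM_def U01_def)

lemma space_NN[simp]: "space (NN lam) = UNIV" and space_XX[simp]: "space XX = UNIV"
  by (simp_all add: space_PiM)

lemma space_RCM[simp]: "space (RCM_space lam) = UNIV"
  by (simp add: RCM_eq space_pair_measure)

lemma prob_space_RCM: "prob_space (RCM_space lam)"
proof -
  interpret A: pair_prob_space UM UM by unfold_locales
  interpret B: pair_prob_space XX "UM \<Otimes>\<^sub>M UM" by unfold_locales
  interpret C: pair_prob_space "NN lam" "XX \<Otimes>\<^sub>M (UM \<Otimes>\<^sub>M UM)" by unfold_locales
  show ?thesis unfolding RCM_eq by unfold_locales
qed

lemma measurable_NN_comp[measurable]: "(\<lambda>n. n k) \<in> measurable (NN lam) (count_space UNIV)"
  using measurable_component_singleton[of k UNIV "\<lambda>_. measure_pmf (poisson_pmf lam)"]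
  by (simp cong: measurable_cong_sets)

lemma measurable_XX_comp[measurable]: "(\<lambda>x. x ki) \<in> borel_measurable XX"
  using measurable_component_singleton[of ki UNIV "\<lambda>ki. uniform_measure lborel (unit_cube (fst ki))"]
  by (simp cong: measurable_cong_sets)

text \<open>Edge marks are integrated innermost, so that for fixed counts, positions and thinning
  marks the problem is a connection probability in a graph with fixed vertices.\<close>

lemma emeasure_RCM:
  assumes Q: "Measurable.pred (RCM_space lam) Q"
  shows "emeasure (RCM_space lam) {\<omega> \<in> space (RCM_space lam). Q \<omega>} =
    (\<integral>\<^sup>+n. \<integral>\<^sup>+x. \<integral>\<^sup>+u. ennreal (prU (\<lambda>e. Q (n, x, e, u))) \<partial>UM \<partial>XX \<partial>NN lam)"
proof -
  interpret A: pair_prob_space UM UM by unfold_locales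
  interpret B: pair_prob_space XX "UM \<Otimes>\<^sub>M UM" by unfold_locales
  have S: "{\<omega>. Q \<omega>} \<in> sets (NN lam \<Otimes>\<^sub>M (XX \<Otimes>\<^sub>M (UM \<Otimes>\<^sub>M UM)))"
    unfolding RCM_eq[symmetric] using Q by (simp add: pred_def)
  have S1: "Pair n -` {\<omega>. Q \<omega>} \<in> sets (XX \<Otimes>\<^sub>M (UM \<Otimes>\<^sub>M UM))" for n
    using sets_Pair1[OF S] .
  have S2: "Pair x -` (Pair n -` {\<omega>. Q \<omega>}) \<in> sets (UM \<Otimes>\<^sub>M UM)" for n x
    using sets_Pair1[OF S1] .
  have "emeasure (RCM_space lam) {\<omega>. Q \<omega>} = (\<integral>\<^sup>+n. emeasure (XX \<Otimes>\<^sub>M (UM \<Otimes>\<^sub>M UM)) (Pair n -` {\<omega>. Q \<omega>}) \<partial>NN lam)"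
    unfolding RCM_eq by (rule B.emeasure_pair_measure_alt[OF S])
  also have "\<dots> = (\<integral>\<^sup>+n. \<integral>\<^sup>+x. emeasure (UM \<Otimes>\<^sub>M UM) (Pair x -` (Pair n -` {\<omega>. Q \<omega>})) \<partial>XX \<partial>NN lam)"
    by (intro nn_integral_cong A.emeasure_pair_measure_alt S1)
  also have "\<dots> = (\<integral>\<^sup>+n. \<integral>\<^sup>+x. \<integral>\<^sup>+u. ennreal (prU (\<lambda>e. Q (n, x, e, u))) \<partial>UM \<partial>XX \<partial>NN lam)"
  proof (intro nn_integral_cong)
    fix n x
    have "(\<lambda>e. (e, u)) -` (Pair x -` (Pair n -` {\<omega>. Q \<omega>})) = {e. Q (n, x, e, u)}" for u by auto
    then show "emeasure (UM \<Otimes>\<^sub>M UM) (Pair x -` (Pair n -` {\<omega>. Q \<omega>})) = (\<integral>\<^sup>+u. ennreal (prU (\<lambda>e. Q (n, x, e, u))) \<partial>UM)"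
      by (subst A.emeasure_pair_measure_alt2[OF S2]) (simp add: UM.emeasure_eq_measure)
  qed
  finally show ?thesis by simp
qed

section \<open>Merging cubes into one window\<close>

text \<open>Numbers the points of finitely many cubes consecutively, cube after cube; the second
  list holds the numbers of points. Indices beyond the total are never read.\<close>

fun cat :: "'k list \<Rightarrow> nat list \<Rightarrow> nat \<Rightarrow> 'k \<times> nat" where
  "cat (k # ks) (a # as) i = (if i < a then (k, i) else cat ks as (i - a))"
| "cat _ _ i = undefined"

lemma cat_bij:
  "distinct ks \<Longrightarrow> bij_betw (cat ks (map n ks)) {..<sum_list (map n ks)} {(k, i). k \<in> set ks \<and> i < n k}"
proof (induction ks)
  case Nil then show ?case by (simp add: bij_betw_def)
next
  case (Cons k ks)
  let ?c = "cat (k # ks) (map n (k # ks))" and ?s = "sum_list (map n ks)"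
  have 1: "bij_betw ?c {..<n k} ({k} \<times> {..<n k})"
    by (subst bij_betw_cong[of _ _ "Pair k"]) (auto simp: bij_betw_def inj_on_def)
  have "bij_betw (\<lambda>i. i - n k) {n k..<n k + ?s} {..<?s}"
    by (rule bij_betw_byWitness[where f'="\<lambda>i. i + n k"]) auto
  from bij_betw_trans[OF this Cons.IH] Cons.prems
  have "bij_betw (cat ks (map n ks) \<circ> (\<lambda>i. i - n k)) {n k..<n k + ?s} {(k, i). k \<in> set ks \<and> i < n k}" by simp
  then have 2: "bij_betw ?c {n k..<n k + ?s} {(k, i). k \<in> set ks \<and> i < n k}"
    by (subst bij_betw_cong[of _ _ "cat ks (map n ks) \<circ> (\<lambda>i. i - n k)"]) auto
  have "bij_betw ?c ({..<n k} \<union> {n k..<n k + ?s}) (({k} \<times> {..<n k}) \<union> {(k, i). k \<in> set ks \<and> i < n k})"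
    by (rule bij_betw_combine[OF 1 2]) (use Cons.prems in auto)
  moreover have "{..<n k} \<union> {n k..<n k + ?s} = {..<sum_list (map n (k # ks))}" by auto
  moreover have "(({k} \<times> {..<n k}) \<union> {(k, i). k \<in> set ks \<and> i < n k}) = {(j, i). j \<in> set (k # ks) \<and> i < n j}" by auto
  ultimately show ?case by (simp only:)
qed

lemma cat_fst: "length as = length ks \<Longrightarrow> i < sum_list as \<Longrightarrow> fst (cat ks as i) \<in> set ks"
proof (induction ks as arbitrary: i rule: list_induct2')
  case (4 k ks a as)
  then show ?case by (cases "i < a") auto
qed auto

lemma measurable_map_NN: "(\<lambda>n. map n ks) \<in> measurable (NN lam) (count_space UNIV)"
proof (induction ks)
  case (Cons k ks)
  have "(\<lambda>n. a # map n ks) \<in> measurable (NN lam) (count_space UNIV)" for a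
    by (rule measurable_compose[OF Cons]) simp
  then have "(\<lambda>n. n k # map n ks) \<in> measurable (NN lam) (count_space UNIV)"
    by (rule measurable_compose_countable[where f="\<lambda>a n. a # map n ks" and g="\<lambda>n. n k"]) simp
  then show ?case by simp
qed simp

text \<open>Once the first \<open>a\<close> points are frozen, the functional of the others is still
  label-invariant. This is what lets the induction hypothesis of \<open>process_window\<close> be
  applied.\<close>

lemma labf_shift:
  assumes F: "labf F"
  shows "labf (\<lambda>B y. F ({..<a} \<union> (\<lambda>i. a + i) ` B) (comb_seq a z y))"
  unfolding labf_def
proof (intro allI impI)
  fix B :: "nat set" and \<pi> and x x' :: "nat \<Rightarrow> 'a"
  assume B: "finite B" "inj_on \<pi> B" "\<forall>i\<in>B. x (\<pi> i) = x' i"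
  define \<pi>' where "\<pi>' i = (if i < a then i else a + \<pi> (i - a))" for i
  have "{..<a} \<union> (\<lambda>i. a + i) ` \<pi> ` B = \<pi>' ` ({..<a} \<union> (\<lambda>i. a + i) ` B)"
  proof -
    have "\<pi>' ` {..<a} = {..<a}" by (simp add: \<pi>'_def)
    moreover have "\<pi>' ` (\<lambda>i. a + i) ` B = (\<lambda>i. a + i) ` \<pi> ` B"
      unfolding image_image by (rule image_cong) (simp_all add: \<pi>'_def)
    ultimately show ?thesis by (simp only: image_Un)
  qed
  moreover have "F (\<pi>' ` ({..<a} \<union> (\<lambda>i. a + i) ` B)) (comb_seq a z x) = F ({..<a} \<union> (\<lambda>i. a + i) ` B) (comb_seq a z x')"
  proof (rule labfD[OF F])
    show "inj_on \<pi>' ({..<a} \<union> (\<lambda>i. a + i) ` B)"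
    proof (rule inj_onI)
      fix i j assume ij: "i \<in> {..<a} \<union> (\<lambda>i. a + i) ` B" "j \<in> {..<a} \<union> (\<lambda>i. a + i) ` B" "\<pi>' i = \<pi>' j"
      show "i = j"
      proof (cases "i < a \<or> j < a")
        case True then show ?thesis using ij(3) by (auto simp: \<pi>'_def split: if_splits)
      next
        case False
        then obtain i' j' where "i = a + i'" "j = a + j'" "i' \<in> B" "j' \<in> B" using ij(1,2) by auto
        then show ?thesis using ij(3) inj_onD[OF B(2), of i' j'] by (simp add: \<pi>'_def)
      qed
    qed
    show "comb_seq a z x (\<pi>' i) = comb_seq a z x' i" if mem: "i \<in> {..<a} \<union> (\<lambda>i. a + i) ` B" for i
    proof (cases "i < a")
      case False
      then obtain i' where "i = a + i'" "i' \<in> B" using mem by auto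
      then show ?thesis using B(3) by (simp add: \<pi>'_def)
    qed (simp add: \<pi>'_def)
  qed (use B in auto)
  ultimately show "F ({..<a} \<union> (\<lambda>i. a + i) ` \<pi> ` B) (comb_seq a z x) = F ({..<a} \<union> (\<lambda>i. a + i) ` B) (comb_seq a z x')"
    by simp
qed

lemma measurable_muS_comp: "(\<lambda>x. x j) \<in> borel_measurable (SQ (muS S))"
  using measurable_component_singleton[of j UNIV "\<lambda>_. muS S"] by (simp cong: measurable_cong_sets)

lemma measurable_comb_muS: "(\<lambda>x. comb_seq a (fst x) (snd x) i) \<in> borel_measurable (SQ (muS S) \<Otimes>\<^sub>M SQ (muS S'))"
  by (cases "i < a") (simp_all add: comb_seq_def measurable_compose[OF measurable_fst measurable_muS_comp]
      measurable_compose[OF measurable_snd measurable_muS_comp])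

lemma nn_integral_NN_component:
  assumes lam: "0 < lam"
  shows "(\<integral>\<^sup>+n. R (n k) \<partial>NN lam) = (\<Sum>a. ennreal (lam ^ a / fact a * exp (- lam)) * R a)"
proof -
  have "(\<integral>\<^sup>+n. R (n k) \<partial>NN lam) = (\<integral>\<^sup>+a. R a \<partial>distr (NN lam) (measure_pmf (poisson_pmf lam)) (\<lambda>n. n k))"
    by (rule nn_integral_distr[symmetric]) simp_all
  also have "distr (NN lam) (measure_pmf (poisson_pmf lam)) (\<lambda>n. n k) = measure_pmf (poisson_pmf lam)"
    by (rule distr_PiM_component) (auto intro: prob_space_measure_pmf)
  also have "(\<integral>\<^sup>+a. R a \<partial>measure_pmf (poisson_pmf lam)) = (\<Sum>a. ennreal (pmf (poisson_pmf lam) a) * R a)"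
    by (simp add: nn_integral_measure_pmf nn_integral_count_space_nat)
  finally show ?thesis using lam by simp
qed

text \<open>Independent Poisson numbers of uniform points in single cubes amount to one Poisson
  number of points uniform on the union. Induction on the list of cubes: separate the first cube by
  resampling, apply the induction hypothesis to the others with the points of the first cube frozen,
  and merge by superposition.\<close>

lemma process_window:
  fixes ks :: "(int ^ ('d::finite)) list" and F :: "nat set \<Rightarrow> (nat \<Rightarrow> real ^ 'd) \<Rightarrow> ennreal"
  assumes lam: "0 < lam" and "distinct ks"
    and "labf F" "\<And>A. finite A \<Longrightarrow> F A \<in> borel_measurable (PiM UNIV (\<lambda>_. borel))"
  shows "(\<integral>\<^sup>+n. \<integral>\<^sup>+x. F {..<sum_list (map n ks)} (\<lambda>i. x (cat ks (map n ks) i)) \<partial>XX \<partial>NN lam) =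
    ennreal (exp (- (lam * length ks))) * PE (lam * length ks) (muS (set ks)) (\<lambda>n x. F {..<n} x)"
  using assms(2-)
proof (induction ks arbitrary: F)
  case Nil
  interpret iid_seq "muS {} :: (real^'d) measure" by (rule iid_muS) simp
  define c where "c = F {} undefined"
  have c: "F {} x = c" for x unfolding c_def by (rule labf_cong[OF Nil.prems(2)]) auto
  have "PE 0 (muS {}) (\<lambda>n x. F {..<n} x) = (\<Sum>n\<in>{0}. ennreal (0 ^ n / fact n) * (\<integral>\<^sup>+x. F {..<n} x \<partial>SQ (muS {})))"
    unfolding PE_def by (rule suminf_finite) auto
  then show ?case by (simp add: c XX.emeasure_space_1[simplified] NN.emeasure_space_1[simplified])
next
  case (Cons k ks)
  let ?r = "length ks"
  note F = Cons.prems(2,3)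
  have k: "k \<notin> set ks" "distinct ks" using Cons.prems by auto
  have finS: "finite (set (k # ks))" by simp
  have Fm: "(\<lambda>z. F {..<s} (x z)) \<in> borel_measurable N" if "\<And>i. (\<lambda>z. x z i) \<in> borel_measurable N" for s x and N :: "'z measure"
  proof -
    have "x \<in> measurable N (PiM UNIV (\<lambda>_. borel))"
      by (rule measurable_PiM_single') (use that in \<open>auto simp: space_PiM\<close>)
    then show ?thesis by (rule measurable_compose[OF _ F(2)]) simp
  qed
  define g where "g a as = (\<integral>\<^sup>+x. F {..<a + sum_list as} (\<lambda>i. x (cat (k # ks) (a # as) i)) \<partial>(XX :: ((int^'d)\<times>nat \<Rightarrow> real^'d) measure))" for a as
  define h where "h a as z = (\<integral>\<^sup>+x. F {..<a + sum_list as} (comb_seq a (\<lambda>i. z (k, i)) (\<lambda>i. x (cat ks as i))) \<partial>(XX :: ((int^'d)\<times>nat \<Rightarrow> real^'d) measure))" for a as z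
  have hm: "h a as \<in> borel_measurable XX" for a as
    unfolding h_def
  proof (rule XX.borel_measurable_nn_integral, unfold split_beta', rule Fm)
    fix i show "(\<lambda>y. comb_seq a (\<lambda>i. fst y (k, i)) (\<lambda>i. snd y (cat ks as i)) i) \<in> borel_measurable (XX \<Otimes>\<^sub>M XX)"
      by (cases "i < a") (simp_all add: comb_seq_def measurable_compose[OF measurable_fst measurable_XX_comp] measurable_compose[OF measurable_snd measurable_XX_comp])
  qed
  \<comment> \<open>Positions outside cube \<open>k\<close> are replaced by an independent copy, so
    the points of the first cube and the others come from two separate integrals.\<close>
  have gh: "g a as = (\<integral>\<^sup>+z. h a as z \<partial>XX)" if as: "length as = ?r" for a as
  proof -
    have "g a as = (\<integral>\<^sup>+z. \<integral>\<^sup>+x. F {..<a + sum_list as} (\<lambda>i. (\<lambda>j. if j \<in> - ({k} \<times> UNIV) then x j else z j) (cat (k # ks) (a # as) i)) \<partial>XX \<partial>(XX :: ((int^'d)\<times>nat \<Rightarrow> real^'d) measure))"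
      unfolding g_def
      by (rule nn_integral_PiM_resample[OF prob_unit_cube]) (rule Fm, rule measurable_XX_comp)
    also have "\<dots> = (\<integral>\<^sup>+z. h a as z \<partial>XX)"
      unfolding h_def
    proof (intro nn_integral_cong labf_cong[OF F(1)])
      fix z x :: "(int^'d)\<times>nat \<Rightarrow> real^'d" and i assume i: "i \<in> {..<a + sum_list as}"
      show "(if cat (k # ks) (a # as) i \<in> - ({k} \<times> UNIV) then x (cat (k # ks) (a # as) i) else z (cat (k # ks) (a # as) i)) =
        comb_seq a (\<lambda>i. z (k, i)) (\<lambda>i. x (cat ks as i)) i"
      proof (cases "i < a")
        case False
        then have "i - a < sum_list as" using i by auto
        then have "fst (cat ks as (i - a)) \<noteq> k" using cat_fst[of as ks "i - a"] as k by auto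
        with False show ?thesis by (cases "cat ks as (i - a)") (simp add: comb_seq_def)
      qed (simp add: comb_seq_def)
    qed simp
    finally show ?thesis .
  qed
  have mg: "(\<lambda>n. g (n k) (map n ks)) \<in> borel_measurable (NN lam)"
  proof (rule measurable_compose_countable[where f="\<lambda>a n. g a (map n ks)" and g="\<lambda>n. n k"])
    show "(\<lambda>n. g a (map n ks)) \<in> borel_measurable (NN lam)" for a
      by (rule measurable_compose[OF measurable_map_NN]) simp
  qed simp
  have "(\<integral>\<^sup>+n. \<integral>\<^sup>+x. F {..<sum_list (map n (k # ks))} (\<lambda>i. x (cat (k # ks) (map n (k # ks)) i)) \<partial>XX \<partial>NN lam) =
     (\<integral>\<^sup>+n. g (n k) (map n ks) \<partial>NN lam)"
    by (simp add: g_def)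
  \<comment> \<open>The same resampling for the counts: that of cube \<open>k\<close> is kept from
    \<open>\<omega>\<close>, the others are drawn afresh.\<close>
  also have "\<dots> = (\<integral>\<^sup>+\<omega>. \<integral>\<^sup>+n. g (\<omega> k) (map n ks) \<partial>NN lam \<partial>NN lam)"
  proof -
    have "map (\<lambda>i. if i \<noteq> k then n i else \<omega> i) ks = map n ks" for n \<omega> :: "int^'d \<Rightarrow> nat"
      using k by (auto intro!: map_cong)
    then show ?thesis
      by (subst nn_integral_PiM_resample[OF prob_space_measure_pmf mg, where S="- {k}"]) (simp only: Compl_iff singleton_iff not_not if_False simp_thms if_True)
  qed
  also have "\<dots> = (\<integral>\<^sup>+\<omega>. \<integral>\<^sup>+n. \<integral>\<^sup>+z. h (\<omega> k) (map n ks) z \<partial>XX \<partial>NN lam \<partial>NN lam)"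
    by (simp add: gh)
  also have "\<dots> = (\<integral>\<^sup>+\<omega>. \<integral>\<^sup>+z. \<integral>\<^sup>+n. h (\<omega> k) (map n ks) z \<partial>NN lam \<partial>XX \<partial>NN lam)"
  proof (intro nn_integral_cong)
    fix \<omega> :: "int^'d \<Rightarrow> nat"
    interpret P: pair_sigma_finite XX "NN lam :: (int^'d \<Rightarrow> nat) measure" by unfold_locales
    show "(\<integral>\<^sup>+n. \<integral>\<^sup>+z. h (\<omega> k) (map n ks) z \<partial>XX \<partial>NN lam) = (\<integral>\<^sup>+z. \<integral>\<^sup>+n. h (\<omega> k) (map n ks) z \<partial>NN lam \<partial>XX)"
    proof (rule P.Fubini', unfold split_beta')
      show "(\<lambda>x. h (\<omega> k) (map (snd x) ks) (fst x)) \<in> borel_measurable (XX \<Otimes>\<^sub>M (NN lam :: (int^'d \<Rightarrow> nat) measure))"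
        by (rule measurable_compose_countable[where f="\<lambda>as x. h (\<omega> k) as (fst x)" and g="\<lambda>x. map (snd x) ks"])
           (rule measurable_compose[OF measurable_fst hm], rule measurable_compose[OF measurable_snd measurable_map_NN])
    qed
  qed
  also have "\<dots> = (\<integral>\<^sup>+\<omega>. \<integral>\<^sup>+z. ennreal (exp (- (lam * ?r))) * PE (lam * ?r) (muS (set ks)) (\<lambda>m y. F {..<\<omega> k + m} (comb_seq (\<omega> k) (\<lambda>i. z (k, i)) y)) \<partial>XX \<partial>NN lam)"
  proof (intro nn_integral_cong)
    fix \<omega> :: "int^'d \<Rightarrow> nat" and z :: "(int^'d)\<times>nat \<Rightarrow> real^'d"
    let ?a = "\<omega> k"
    let ?F = "\<lambda>B y. F ({..<?a} \<union> (\<lambda>i. ?a + i) ` B) (comb_seq ?a (\<lambda>i. z (k, i)) y)"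
    have un: "{..<?a} \<union> (\<lambda>i. ?a + i) ` {..<s} = {..<?a + s}" for s
    proof -
      have "(\<lambda>i. ?a + i) ` {..<s} = {?a..<?a + s}"
        by (simp add: lessThan_atLeast0 image_add_atLeastLessThan add.commute)
      then show ?thesis by auto
    qed
    have "(\<integral>\<^sup>+n. \<integral>\<^sup>+x. ?F {..<sum_list (map n ks)} (\<lambda>i. x (cat ks (map n ks) i)) \<partial>XX \<partial>NN lam) =
      ennreal (exp (- (lam * ?r))) * PE (lam * ?r) (muS (set ks)) (\<lambda>n x. ?F {..<n} x)"
    proof (rule Cons.IH[OF k(2) labf_shift[OF F(1)]])
      fix A :: "nat set" assume "finite A"
      have "(\<lambda>y. comb_seq ?a (\<lambda>i. z (k, i)) y) \<in> measurable (PiM UNIV (\<lambda>_. borel)) (PiM UNIV (\<lambda>_. borel))"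
        by (rule measurable_PiM_single') (auto simp: space_PiM comb_seq_def)
      then show "(\<lambda>y. ?F A y) \<in> borel_measurable (PiM UNIV (\<lambda>_. borel))"
        by (rule measurable_compose[OF _ F(2)]) (use \<open>finite A\<close> in simp)
    qed
    then show "(\<integral>\<^sup>+n. h ?a (map n ks) z \<partial>NN lam) = ennreal (exp (- (lam * ?r))) * PE (lam * ?r) (muS (set ks)) (\<lambda>m y. F {..<?a + m} (comb_seq ?a (\<lambda>i. z (k, i)) y))"
      unfolding un h_def .
  qed
  also have "\<dots> = (\<integral>\<^sup>+\<omega>. \<integral>\<^sup>+z. ennreal (exp (- (lam * ?r))) * PE (lam * ?r) (muS (set ks)) (\<lambda>m y. F {..<\<omega> k + m} (comb_seq (\<omega> k) z y)) \<partial>SQ (muS {k}) \<partial>NN lam)"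
  proof (intro nn_integral_cong)
    fix \<omega> :: "int^'d \<Rightarrow> nat"
    interpret I: iid_seq "muS (set ks)" by (rule iid_muS) simp
    interpret K: iid_seq "muS {k}" by (rule iid_muS) simp
    have "(\<lambda>z. PE (lam * ?r) (muS (set ks)) (\<lambda>m y. F {..<\<omega> k + m} (comb_seq (\<omega> k) z y))) \<in> borel_measurable (SQ (muS {k}))"
      by (rule I.measurable_PE, unfold split_beta', rule Fm, rule measurable_comb_muS)
    then show "(\<integral>\<^sup>+z. ennreal (exp (- (lam * ?r))) * PE (lam * ?r) (muS (set ks)) (\<lambda>m y. F {..<\<omega> k + m} (comb_seq (\<omega> k) (\<lambda>i. z (k, i)) y)) \<partial>XX) =
      (\<integral>\<^sup>+z. ennreal (exp (- (lam * ?r))) * PE (lam * ?r) (muS (set ks)) (\<lambda>m y. F {..<\<omega> k + m} (comb_seq (\<omega> k) z y)) \<partial>SQ (muS {k}))"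
      by (intro nn_integral_PiM_reindex[where I=UNIV, symmetric])
         (auto simp: prob_unit_cube[unfolded uniform_unit_cube] inj_on_def depends_def muS_singleton uniform_unit_cube fun_eq_iff[symmetric])
  qed
  also have "\<dots> = (\<Sum>a. ennreal (lam ^ a / fact a * exp (- lam)) *
      (\<integral>\<^sup>+z. ennreal (exp (- (lam * ?r))) * PE (lam * ?r) (muS (set ks)) (\<lambda>m y. F {..<a + m} (comb_seq a z y)) \<partial>SQ (muS {k})))"
    by (rule nn_integral_NN_component[OF lam])
  also have "\<dots> = ennreal (exp (- lam)) * PE lam (muS {k}) (\<lambda>a z. ennreal (exp (- (lam * ?r))) * PE (lam * ?r) (muS (set ks)) (\<lambda>m y. F {..<a + m} (comb_seq a z y)))"
  proof -
    have "ennreal (lam ^ a / fact a * exp (- lam)) * X = ennreal (exp (- lam)) * (ennreal (lam ^ a / fact a) * X)" for a X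
      using lam by (simp add: ennreal_mult mult_ac del: times_divide_eq_left times_divide_eq_right)
    then show ?thesis unfolding PE_def[of lam] by (simp only: ennreal_suminf_cmult)
  qed
  also have "\<dots> = ennreal (exp (- lam)) * (ennreal (exp (- (lam * ?r))) * PE lam (muS {k}) (\<lambda>a z. PE (lam * ?r) (muS (set ks)) (\<lambda>m y. F {..<a + m} (comb_seq a z y))))"
  proof -
    interpret I: iid_seq "muS (set ks)" by (rule iid_muS) simp
    interpret K: iid_seq "muS {k}" by (rule iid_muS) simp
    have "(\<lambda>z. PE (lam * ?r) (muS (set ks)) (\<lambda>m y. F {..<a + m} (comb_seq a z y))) \<in> borel_measurable (SQ (muS {k}))" for a
      by (rule I.measurable_PE, unfold split_beta', rule Fm, rule measurable_comb_muS)
    then show ?thesis by (subst K.PE_cmult) auto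
  qed
  also have "\<dots> = ennreal (exp (- (lam * length (k # ks)))) * PE lam (muS {k}) (\<lambda>a z. PE (lam * ?r) (muS (set ks)) (\<lambda>m y. F {..<a + m} (comb_seq a z y)))"
    by (simp add: mult.assoc[symmetric] ennreal_mult[symmetric] exp_add[symmetric] algebra_simps)
  also have "PE lam (muS {k}) (\<lambda>a z. PE (lam * ?r) (muS (set ks)) (\<lambda>m y. F {..<a + m} (comb_seq a z y))) =
     PE (lam * length (k # ks)) (muS (set (k # ks))) (\<lambda>n x. F {..<n} x)"
  proof -
    let ?R = "real (length (k # ks))"
    have R: "0 < ?R" by simp
    have cR: "card (set (k # ks)) = length (k # ks)" "card (set ks) = ?r"
      using Cons.prems(1) by (simp_all add: distinct_card)
    have inv: "ennreal (1 / ?R) * of_nat (card (set (k # ks))) = 1"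
      using R unfolding cR by (simp add: ennreal_of_nat_eq_real_of_nat ennreal_mult[symmetric] del: of_nat_Suc)
    have mu: "(\<integral>\<^sup>+x. q x \<partial>muS (set (k # ks))) = ennreal (1 / ?R) * (\<integral>\<^sup>+x. q x * indicator (OS (set (k # ks))) x \<partial>lborel)"
      if "q \<in> borel_measurable borel" for q
      unfolding nn_integral_muS[OF finS that, symmetric] mult.assoc[symmetric] inv by simp
    have dis: "obox k \<inter> OS (set ks) = {}"
      unfolding OS_def using obox_disjoint[of k] k by fastforce
    \<comment> \<open>The colour of a point of the union is determined by whether it lies in cube
      \<open>k\<close>; the two classes carry the fractions 1 and \<open>?r\<close> out of
      \<open>?R\<close> cubes.\<close>
    have "PE (lam * ?R) (muS (set (k # ks))) (\<lambda>n x. F {..<n} x) =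
      PE (lam * ?R * (1 / ?R)) (muS {k}) (\<lambda>a z. PE (lam * ?R * (?r / ?R)) (muS (set ks)) (\<lambda>m y. F {..<a + m} (comb_seq a z y)))"
    proof (rule PE_superpose[where ?w1.0="indicator (obox k)" and ?w2.0="indicator (- obox k)"])
      fix q :: "real^'d \<Rightarrow> ennreal" assume [measurable]: "q \<in> borel_measurable borel"
      have i1: "indicator (obox k) x * q x * indicator (OS (set (k # ks))) x = q x * indicator (obox k) x" for x
        by (auto simp: OS_def indicator_def)
      have i2: "indicator (- obox k) x * q x * indicator (OS (set (k # ks))) x = q x * indicator (OS (set ks)) x" for x
      proof -
        have "OS (set (k # ks)) = obox k \<union> OS (set ks)" by (simp add: OS_def)
        then show ?thesis using dis by (cases "x \<in> obox k"; cases "x \<in> OS (set ks)") auto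
      qed
      have "(\<integral>\<^sup>+x. indicator (obox k) x * q x \<partial>muS (set (k # ks))) = ennreal (1 / ?R) * (\<integral>\<^sup>+x. q x * indicator (obox k) x \<partial>lborel)"
        by (subst mu) (simp_all only: i1, measurable)
      also have "(\<integral>\<^sup>+x. q x * indicator (obox k) x \<partial>lborel) = (\<integral>\<^sup>+x. q x \<partial>muS {k})"
        using nn_integral_muS[of "{k}" q] by (simp add: OS_def)
      finally show "(\<integral>\<^sup>+x. indicator (obox k) x * q x \<partial>muS (set (k # ks))) = ennreal (1 / ?R) * (\<integral>\<^sup>+x. q x \<partial>muS {k})" .
      have "(\<integral>\<^sup>+x. indicator (- obox k) x * q x \<partial>muS (set (k # ks))) = ennreal (1 / ?R) * (\<integral>\<^sup>+x. q x * indicator (OS (set ks)) x \<partial>lborel)"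
        by (subst mu) (simp_all only: i2, measurable)
      also have "(\<integral>\<^sup>+x. q x * indicator (OS (set ks)) x \<partial>lborel) = of_nat ?r * (\<integral>\<^sup>+x. q x \<partial>muS (set ks))"
        using nn_integral_muS[of "set ks" q] cR by simp
      finally show "(\<integral>\<^sup>+x. indicator (- obox k) x * q x \<partial>muS (set (k # ks))) = ennreal (?r / ?R) * (\<integral>\<^sup>+x. q x \<partial>muS (set ks))"
        by (simp add: ennreal_of_nat_eq_real_of_nat mult.assoc[symmetric] ennreal_mult[symmetric])
    qed (use lam F in \<open>auto simp: iid_muS indicator_def split: if_splits\<close>)
    then show ?thesis using R by simp
  qed
  finally show ?case .
qed

section \<open>Events of the model as events of finite graphs\<close>

fun vloc :: "real ^ 'd \<Rightarrow> ((int ^ 'd) \<times> nat \<Rightarrow> real ^ 'd) \<Rightarrow> ('d::finite) vtx \<Rightarrow> real ^ 'd" where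
  "vloc y x Orig = 0"
| "vloc y x Extra = y"
| "vloc y x (Pt k i) = x (k, i)"

lemma loc_eq: "loc y (n, x, r) v = vloc y x v"
  by (cases v) auto

lemma adj_eq: "adj psi y (n, x, e, u) W = gadj (\<lambda>a b. psi (vloc y x a - vloc y x b)) e W"
  by (auto simp: fun_eq_iff adj_def gadj_def loc_eq edge_mark_def)

lemma Pts_eq: "Pts (n, r) = {Pt k i | k i. i < n k}"
  by (simp add: Pts_def)

lemma thinned_eq: "thinned f (n, x, e, u) = {v \<in> {Pt k i | k i. i < n k}. u v \<le> f (vloc 0 x v)}"
  by (simp add: thinned_def Pts_eq loc_eq thin_mark_def)

lemma measurable_RCM_comps:
  "(\<lambda>\<omega>. fst \<omega> k) \<in> measurable (RCM_space lam) (count_space UNIV)"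
  "(\<lambda>\<omega>. fst (snd \<omega>) ki) \<in> borel_measurable (RCM_space lam)"
  "(\<lambda>\<omega>. fst (snd (snd \<omega>)) S) \<in> borel_measurable (RCM_space lam)"
  "(\<lambda>\<omega>. snd (snd (snd \<omega>)) v) \<in> borel_measurable (RCM_space lam)"
  unfolding RCM_eq
  by (rule measurable_compose[OF _ measurable_NN_comp] measurable_compose[OF _ measurable_XX_comp] measurable_compose[OF _ measurable_UM_component]; measurable)+

lemma measurable_loc: "(\<lambda>\<omega>. loc y \<omega> v) \<in> borel_measurable (RCM_space lam)"
  by (cases v) (simp_all add: measurable_RCM_comps)

lemma pred_Pts: "Measurable.pred (RCM_space lam) (\<lambda>\<omega>. v \<in> Pts \<omega>)"
proof (cases v)
  case (Pt k i)
  have "Measurable.pred (RCM_space lam) (\<lambda>\<omega>. i < fst \<omega> k)"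
    by (rule measurable_compose[OF measurable_RCM_comps(1)]) simp
  then show ?thesis using Pt by (simp add: Pts_def)
qed (simp_all add: Pts_def)

lemma pred_adj_star:
  assumes [measurable]: "psi \<in> borel_measurable borel" and W[measurable]: "\<And>v. Measurable.pred (RCM_space lam) (\<lambda>\<omega>. v \<in> W \<omega>)"
  shows "Measurable.pred (RCM_space lam) (\<lambda>\<omega>. (adj psi y \<omega> (W \<omega>))\<^sup>*\<^sup>* a b)"
proof (rule measurable_rtranclp)
  fix a b
  note [measurable] = measurable_RCM_comps measurable_loc
  show "Measurable.pred (RCM_space lam) (\<lambda>\<omega>. adj psi y \<omega> (W \<omega>) a b)"
    unfolding adj_def edge_mark_def by measurable
qed

lemma box_t_borel[measurable]: "box_t t \<in> sets borel"
proof -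
  have eq: "box_t t = (\<Inter>i. {x. \<bar>x $ i\<bar> \<le> t / 2})" by (auto simp: box_t_def)
  show ?thesis unfolding eq
    by (intro borel_closed closed_INT ballI closed_Collect_le continuous_intros)
qed

lemma pred_theta:
  assumes "psi \<in> borel_measurable borel"
  shows "Measurable.pred (RCM_space lam) (\<lambda>\<omega>. \<exists>v\<in>Pts \<omega>. loc 0 \<omega> v \<notin> box_t t \<and>
         (adj psi 0 \<omega> (insert Orig (Pts \<omega>)))\<^sup>*\<^sup>* Orig v)"
proof -
  note [measurable] = pred_Pts measurable_loc
  have [measurable]: "Measurable.pred (RCM_space lam) (\<lambda>\<omega>. (adj psi 0 \<omega> (insert Orig (Pts \<omega>)))\<^sup>*\<^sup>* Orig v)" for v
    by (rule pred_adj_star[OF assms]) (simp, measurable)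
  show ?thesis unfolding Bex_def by measurable
qed

lemma pred_conn:
  assumes "psi \<in> borel_measurable borel" and [measurable]: "f \<in> borel_measurable borel"
  shows "Measurable.pred (RCM_space lam) (\<lambda>\<omega>. (adj psi y \<omega> ({Orig, Extra} \<union> thinned f \<omega>))\<^sup>*\<^sup>* Orig Extra)"
proof (rule pred_adj_star[OF assms(1)])
  note [measurable] = pred_Pts measurable_loc measurable_RCM_comps
  fix v
  show "Measurable.pred (RCM_space lam) (\<lambda>\<omega>. v \<in> {Orig, Extra} \<union> thinned f \<omega>)"
    unfolding thinned_def thin_mark_def by simp
qed

lemma emeasure_UM_UNIV[simp]: "emeasure UM UNIV = 1"
  using UM.emeasure_space_1 by simp

lemma AE_UM_gt0: "AE \<omega> in UM. \<omega> e > (0::real)"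
proof (rule UM.AE_I_eq_1)
  have "prU (\<lambda>\<omega>. \<not> \<omega> e \<le> 0) = 1"
    using prU_single[of "\<lambda>x. \<not> x \<le> 0" e] measure_U01_gt[of 0] by simp
  then show "emeasure UM {\<omega> \<in> space UM. 0 < \<omega> e} = 1"
    by (simp add: not_le UM.emeasure_eq_measure)
  show "{\<omega> \<in> space UM. 0 < \<omega> e} \<in> UM.events" by measurable
qed

lemma AE_UM_le1: "AE \<omega> in UM. \<omega> e \<le> (1::real)"
proof (rule UM.AE_I_eq_1)
  have "prU (\<lambda>\<omega>. \<omega> e \<le> 1) = 1"
    using prU_single[of "\<lambda>x. x \<le> 1" e] measure_U01_le[of 1] by simp
  then show "emeasure UM {\<omega> \<in> space UM. \<omega> e \<le> 1} = 1"
    by (simp add: UM.emeasure_eq_measure)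
  show "{\<omega> \<in> space UM. \<omega> e \<le> 1} \<in> UM.events" by measurable
qed

lemma AE_XX_cubes: "AE x in XX. \<forall>k i. x (k, i) \<in> unit_cube k"
proof -
  have "AE x in XX. x ki \<in> unit_cube (fst ki)" for ki :: "(int^'a) \<times> nat"
  proof (rule AE_PiM_component)
    show "AE z in uniform_measure lborel (unit_cube (fst ki)). z \<in> unit_cube (fst ki)"
      by (rule AE_uniform_measureI) (auto simp: unit_cube_def)
  qed (auto intro: prob_unit_cube)
  from this[of "(k, i)" for k i] show ?thesis by (simp add: AE_all_countable)
qed

definition VK :: "(int ^ ('d::finite)) list \<Rightarrow> (int ^ 'd \<Rightarrow> nat) \<Rightarrow> 'd vtx set" where
  "VK ks n = {Pt k i | k i. k \<in> set ks \<and> i < n k}"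

definition enum :: "(int ^ ('d::finite)) list \<Rightarrow> (int ^ 'd \<Rightarrow> nat) \<Rightarrow> nat \<Rightarrow> 'd vtx" where
  "enum ks n i = (case cat ks (map n ks) i of (k, j) \<Rightarrow> Pt k j)"

lemma enum_bij: "distinct ks \<Longrightarrow> bij_betw (enum ks n) {..<sum_list (map n ks)} (VK ks n)"
proof -
  assume "distinct ks"
  have "bij_betw (\<lambda>(k, j). Pt k j) {(k, i). k \<in> set ks \<and> i < n k} (VK ks n)"
    unfolding bij_betw_def VK_def by (auto simp: inj_on_def)
  from bij_betw_trans[OF cat_bij[OF \<open>distinct ks\<close>] this] show ?thesis
    by (simp add: enum_def[abs_def] o_def)
qed

lemma enum_Pt: "enum ks n i \<noteq> Orig" "enum ks n i \<noteq> Extra"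
  by (auto simp: enum_def split: prod.split)

lemma vloc_enum: "vloc y x (enum ks n i) = x (cat ks (map n ks) i)"
  by (auto simp: enum_def split: prod.split)

context rcm
begin

text \<open>The edge to the ghost has probability 1 from points of \<open>T\<close> and 0 from all
  others. Since marks are almost surely in (0, 1], such edges are open and closed accordingly, and
  reaching the ghost means reaching a point of \<open>T\<close>. The assumption on 0 excludes
  entering the ghost straight from the origin.\<close>

lemma ghost:
  assumes A: "finite A" and T: "0 \<notin> T"
  shows "prU (\<lambda>\<omega>. \<exists>i\<in>A. z i \<in> T \<and> reach (ep psi T 0 z) \<omega> (insert Or (Pn ` A)) Or (Pn i)) = cG T A z"
proof -
  let ?p = "ep psi T 0 z"
  have "AE \<omega> in UM. \<forall>e\<in>(\<lambda>a. {a, Gh}) ` insert Or (Pn ` A). \<omega> e > (0::real) \<and> \<omega> e \<le> 1"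
    using A by (subst AE_finite_all) (auto intro: AE_UM_gt0 AE_UM_le1)
  then have "AE \<omega> in UM. \<omega> \<in> {\<omega>. \<exists>i\<in>A. z i \<in> T \<and> reach ?p \<omega> (insert Or (Pn ` A)) Or (Pn i)} \<longleftrightarrow>
     \<omega> \<in> {\<omega>. reach ?p \<omega> (insert Gh (insert Or (Pn ` A))) Or Gh}"
  proof eventually_elim
    case (elim \<omega>)
    have "reach ?p \<omega> (insert Gh (insert Or (Pn ` A))) Or Gh"
      if "i \<in> A" "z i \<in> T" "reach ?p \<omega> (insert Or (Pn ` A)) Or (Pn i)" for i
    proof -
      have "reach ?p \<omega> (insert Gh (insert Or (Pn ` A))) Or (Pn i)"
        using that(3) by (rule reach_mono) auto
      moreover have "gadj ?p \<omega> (insert Gh (insert Or (Pn ` A))) (Pn i) Gh"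
        using elim that by (auto simp: gadj_def ep_def)
      ultimately show ?thesis by (rule rtranclp.rtrancl_into_rtrancl)
    qed
    moreover have "\<exists>i\<in>A. z i \<in> T \<and> reach ?p \<omega> (insert Or (Pn ` A)) Or (Pn i)"
      if r: "reach ?p \<omega> (insert Gh (insert Or (Pn ` A))) Or Gh"
    proof (rule ccontr)
      assume no: "\<not> ?thesis"
      \<comment> \<open>If no point of \<open>T\<close> is reached, a path can never step onto the
        ghost and therefore uses ordinary vertices only.\<close>
      have "v \<noteq> Gh \<and> reach ?p \<omega> (insert Or (Pn ` A)) Or v" if "reach ?p \<omega> (insert Gh (insert Or (Pn ` A))) Or v" for v
        using that
      proof (induction rule: rtranclp_induct)
        case (step v w)
        then have vw: "v \<in> insert Or (Pn ` A)" "w \<in> insert Gh (insert Or (Pn ` A))" "v \<noteq> w" "\<omega> {v, w} \<le> ?p v w"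
          by (auto simp: gadj_def)
        have "w \<noteq> Gh"
        proof
          assume w: "w = Gh"
          with elim vw have "0 < ?p v Gh" by force
          then obtain i where "v = Pn i" "i \<in> A" "z i \<in> T"
            using vw(1) T by (auto simp: ep_def indicator_def split: if_splits)
          then show False using no step.IH by blast
        qed
        then have "gadj ?p \<omega> (insert Or (Pn ` A)) v w" using vw by (auto simp: gadj_def)
        then show ?case using step.IH \<open>w \<noteq> Gh\<close> by (meson rtranclp.rtrancl_into_rtrancl)
      qed simp
      from this[OF r] show False by simp
    qed
    ultimately show ?case by blast
  qed
  then show ?thesis
    unfolding cG_def con_def
    by (rule UM.finite_measure_eq_AE) (use A in \<open>auto simp: pred_UM[symmetric] intro!: pred_intros_finite\<close>)
qed

abbreviation vpsi :: "real^'d \<Rightarrow> ((int ^ 'd) \<times> nat \<Rightarrow> real ^ 'd) \<Rightarrow> 'd vtx \<Rightarrow> 'd vtx \<Rightarrow> real" where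
  "vpsi y x a b \<equiv> psi (vloc y x a - vloc y x b)"

abbreviation lv :: "(int ^ 'd) list \<Rightarrow> (int ^ 'd \<Rightarrow> nat) \<Rightarrow> lab \<Rightarrow> 'd vtx" where
  "lv ks n l \<equiv> (case l of Gh \<Rightarrow> undefined | Or \<Rightarrow> Orig | Ex \<Rightarrow> Extra | Pn i \<Rightarrow> enum ks n i)"

lemma inj_lv:
  assumes "distinct ks" "A \<subseteq> {..<sum_list (map n ks)}"
  shows "inj_on (lv ks n) ({Or, Ex} \<union> Pn ` A)"
proof -
  have "inj_on (enum ks n) A" using enum_bij[OF assms(1), of n] assms(2) by (auto simp: bij_betw_def intro: inj_on_subset)
  then show ?thesis using enum_Pt[of ks n] enum_Pt[of ks n, symmetric] by (auto simp: inj_on_def)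
qed

lemma con_enum:
  assumes "distinct ks" "A \<subseteq> {..<sum_list (map n ks)}"
  shows "con (vpsi y x) ({Orig, Extra} \<union> enum ks n ` A) Orig Extra = cO y A (\<lambda>i. x (cat ks (map n ks) i))"
proof -
  have "con (\<lambda>a b. pp psi {} (Some (vloc y x a)) (Some (vloc y x b))) (lv ks n ` ({Or, Ex} \<union> Pn ` A)) (lv ks n Or) (lv ks n Ex) =
    con (\<lambda>a b. pp psi {} (lpos y (\<lambda>i. x (cat ks (map n ks) i)) a) (lpos y (\<lambda>i. x (cat ks (map n ks) i)) b)) ({Or, Ex} \<union> Pn ` A) Or Ex"
    by (rule con_pp_reindex[OF inj_lv[OF assms]]) (auto simp: vloc_enum)
  then show ?thesis by (simp add: cO_def ep_def[abs_def] image_image)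
qed

lemma prU_enum:
  assumes "distinct ks" "0 \<notin> T"
  shows "prU (\<lambda>e. \<exists>v\<in>VK ks n. vloc 0 x v \<in> T \<and> reach (vpsi 0 x) e (insert Orig (VK ks n)) Orig v) =
    cG T {..<sum_list (map n ks)} (\<lambda>i. x (cat ks (map n ks) i))"
proof -
  let ?A = "{..<sum_list (map n ks)}" and ?z = "\<lambda>i. x (cat ks (map n ks) i)" and ?\<pi> = "lv ks n"
  let ?V = "insert Or (Pn ` {..<sum_list (map n ks)})"
  define Q where "Q \<omega> = (\<exists>i\<in>?A. ?z i \<in> T \<and> reach (ep psi T 0 ?z) \<omega> ?V Or (Pn i))" for \<omega>
  have inj: "inj_on ?\<pi> ?V" by (rule inj_on_subset[OF inj_lv[OF assms(1) subset_refl]]) auto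
  have im: "?\<pi> ` ?V = insert Orig (VK ks n)"
    using enum_bij[OF assms(1), of n] by (simp add: image_image bij_betw_def)
  have "cG T ?A ?z = prU Q" unfolding Q_def by (rule ghost[symmetric]) (use assms in auto)
  also have "\<dots> = prU (\<lambda>\<omega>. Q (\<lambda>S. \<omega> (?\<pi> ` S)))"
  proof (rule prU_reindex[where I="Pow ?V - {{}}"])
    show "Measurable.pred UM Q" unfolding Q_def by (intro pred_intros_finite) auto
    show "depends (Pow ?V - {{}}) Q" unfolding Q_def
      using depends_reach[of ?V "ep psi T 0 ?z"] unfolding depends_def by blast
    show "inj_on ((`) ?\<pi>) (Pow ?V - {{}})" by (rule inj_on_image_Pow'[OF inj])
  qed
  also have "\<dots> = prU (\<lambda>e. \<exists>v\<in>VK ks n. vloc 0 x v \<in> T \<and> reach (vpsi 0 x) e (insert Orig (VK ks n)) Orig v)"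
  proof (intro arg_cong[where f="measure UM"] Collect_cong)
    fix \<omega> :: "'d vtx set \<Rightarrow> real"
    have g: "gadj (ep psi T 0 ?z) (\<lambda>S. \<omega> (?\<pi> ` S)) ?V = gadj (\<lambda>a b. vpsi 0 x (?\<pi> a) (?\<pi> b)) (\<lambda>S. \<omega> (?\<pi> ` S)) ?V"
      by (auto simp: fun_eq_iff gadj_def ep_def vloc_enum)
    have "reach (ep psi T 0 ?z) (\<lambda>S. \<omega> (?\<pi> ` S)) ?V Or (Pn i) \<longleftrightarrow> reach (vpsi 0 x) \<omega> (insert Orig (VK ks n)) Orig (enum ks n i)"
      if "i \<in> ?A" for i
      unfolding g using reach_image[OF inj, of Or "Pn i" "vpsi 0 x" \<omega>] that im by simp
    moreover have "VK ks n = enum ks n ` ?A" using enum_bij[OF assms(1), of n] by (simp add: bij_betw_def)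
    ultimately show "Q (\<lambda>S. \<omega> (?\<pi> ` S)) \<longleftrightarrow> (\<exists>v\<in>VK ks n. vloc 0 x v \<in> T \<and> reach (vpsi 0 x) \<omega> (insert Orig (VK ks n)) Orig v)"
      unfolding Q_def by (auto simp: vloc_enum)
  qed
  finally show ?thesis ..
qed

lemma in_cube_KN:
  assumes "x (k, i) \<in> unit_cube k" "\<And>j. \<bar>x (k, i) $ j\<bar> < real N"
  shows "k \<in> KN N"
  unfolding KN_def
proof (rule CollectI, rule allI)
  fix j
  have "of_int (k $ j) \<le> x (k, i) $ j" "x (k, i) $ j \<le> of_int (k $ j) + 1"
    using assms(1) by (auto simp: unit_cube_def mem_box_cart)
  moreover have "\<bar>x (k, i) $ j\<bar> < real N" by (rule assms(2))
  ultimately show "- int N \<le> k $ j \<and> k $ j < int N" by linarith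
qed

lemma psi_pos_near: "0 < psi (a - b) \<Longrightarrow> \<bar>a $ j - b $ j\<bar> \<le> 1"
proof -
  assume "0 < psi (a - b)"
  then have "norm (a - b) \<le> 1" using psi_range[of "a - b"] by force
  then show ?thesis using component_le_norm_cart[of "a - b" j] by simp
qed

text \<open>Edges have length at most 1, so a path stays within distance 1 of the box up to and
  including its first vertex outside. Such vertices have coordinates smaller than \<open>N\<close>
  and belong to cubes of \<open>KN N\<close>; the rest of the configuration does not influence the
  event.\<close>

lemma prU_theta:
  assumes x: "\<forall>k i. x (k, i) \<in> unit_cube k" and t: "0 \<le> t" "t / 2 + 1 < real N"
    and ks: "distinct ks" "set ks = KN N"
  shows "prU (\<lambda>e. \<exists>v\<in>Pts (n, x, e, u). loc 0 (n, x, e, u) v \<notin> box_t t \<and>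
      (adj psi 0 (n, x, e, u) (insert Orig (Pts (n, x, e, u))))\<^sup>*\<^sup>* Orig v) =
    cG (- box_t t) {..<sum_list (map n ks)} (\<lambda>i. x (cat ks (map n ks) i))"
proof -
  let ?P = "{Pt k i | k i. i < n k}" and ?T = "- box_t t :: (real^'d) set"
  let ?V = "VK ks n"
  have VP: "?V \<subseteq> ?P" by (auto simp: VK_def)
  have "AE e in UM. \<forall>a b :: 'd vtx. e {a, b} > (0::real)"
    by (simp add: AE_all_countable AE_UM_gt0)
  then have "AE e in UM. e \<in> {e. \<exists>v\<in>?P. vloc 0 x v \<in> ?T \<and> reach (vpsi 0 x) e (insert Orig ?P) Orig v} \<longleftrightarrow>
     e \<in> {e. \<exists>v\<in>?V. vloc 0 x v \<in> ?T \<and> reach (vpsi 0 x) e (insert Orig ?V) Orig v}"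
  proof eventually_elim
    case (elim e)
    have "\<exists>v\<in>?P. vloc 0 x v \<in> ?T \<and> reach (vpsi 0 x) e (insert Orig ?P) Orig v"
      if "v \<in> ?V" "vloc 0 x v \<in> ?T" "reach (vpsi 0 x) e (insert Orig ?V) Orig v" for v
      using that VP reach_mono[OF that(3), of "insert Orig ?P"] by blast
    moreover have "\<exists>v\<in>?V. vloc 0 x v \<in> ?T \<and> reach (vpsi 0 x) e (insert Orig ?V) Orig v"
      if v: "v \<in> ?P" "vloc 0 x v \<in> ?T" "reach (vpsi 0 x) e (insert Orig ?P) Orig v" for v
    proof (rule ccontr)
      assume no: "\<not> ?thesis"
      \<comment> \<open>Under \<open>no\<close>, a vertex in the box has all its neighbours in the
        window, and a reached vertex of the window lies in the box. So the path never gets out of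
        the box.\<close>
      have "v \<in> insert Orig ?V \<and> vloc 0 x v \<in> box_t t \<and> reach (vpsi 0 x) e (insert Orig ?V) Orig v"
        if "reach (vpsi 0 x) e (insert Orig ?P) Orig v" for v
        using that
      proof (induction rule: rtranclp_induct)
        case base
        show ?case using t by (simp add: box_t_def)
      next
        case (step v w)
        have vw: "v \<noteq> w" "w \<in> insert Orig ?P" "e {v, w} \<le> vpsi 0 x v w"
          using step.hyps(2) by (auto simp: gadj_def)
        have pos: "0 < vpsi 0 x v w" using elim vw(3) by (metis less_le_trans)
        have w: "w \<in> insert Orig ?V"
        proof (cases "w = Orig")
          case False
          then obtain k i where ki: "w = Pt k i" "i < n k" using vw(2) by auto
          have xN: "\<bar>x (k, i) $ j\<bar> < real N" for j
          proof -
            have "\<bar>vloc 0 x v $ j\<bar> \<le> t / 2" using step.IH by (simp add: box_t_def)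
            moreover have "\<bar>vloc 0 x v $ j - x (k, i) $ j\<bar> \<le> 1" using psi_pos_near[OF pos, of j] ki by simp
            ultimately show ?thesis using t(2) by linarith
          qed
          have "x (k, i) \<in> unit_cube k" using x by blast
          then have "k \<in> KN N" by (rule in_cube_KN[where x=x]) (rule xN)
          then show ?thesis using ki ks by (auto simp: VK_def)
        qed simp
        have "gadj (vpsi 0 x) e (insert Orig ?V) v w"
          using vw w step.IH by (auto simp: gadj_def)
        then have r: "reach (vpsi 0 x) e (insert Orig ?V) Orig w"
          using step.IH by (meson rtranclp.rtrancl_into_rtrancl)
        have "vloc 0 x w \<in> box_t t"
        proof (cases "w = Orig")
          case True then show ?thesis using t by (simp add: box_t_def)
        next
          case False
          then show ?thesis using no r w by blast
        qed
        with r w show ?case by blast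
      qed
      from this[OF v(3)] v(2) show False by simp
    qed
    ultimately show ?case by blast
  qed
  then have "prU (\<lambda>e. \<exists>v\<in>?P. vloc 0 x v \<in> ?T \<and> reach (vpsi 0 x) e (insert Orig ?P) Orig v) =
     prU (\<lambda>e. \<exists>v\<in>?V. vloc 0 x v \<in> ?T \<and> reach (vpsi 0 x) e (insert Orig ?V) Orig v)"
  proof (rule UM.finite_measure_eq_AE)
    have "{e. \<exists>v\<in>W. vloc 0 x v \<in> ?T \<and> reach (vpsi 0 x) e (insert Orig W) Orig v} \<in> sets UM" for W
      by (subst pred_UM[symmetric]) (unfold Bex_def, measurable)
    then show "{e. \<exists>v\<in>?P. vloc 0 x v \<in> ?T \<and> reach (vpsi 0 x) e (insert Orig ?P) Orig v} \<in> UM.events"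
      "{e. \<exists>v\<in>?V. vloc 0 x v \<in> ?T \<and> reach (vpsi 0 x) e (insert Orig ?V) Orig v} \<in> UM.events" by blast+
  qed
  also have "\<dots> = cG ?T {..<sum_list (map n ks)} (\<lambda>i. x (cat ks (map n ks) i))"
    by (rule prU_enum[OF ks(1)]) (use t in \<open>simp add: box_t_def\<close>)
  finally show ?thesis by (simp add: adj_eq Pts_eq loc_eq)
qed

lemma obtain_cubes: obtains ks :: "(int^'d) list" where "distinct ks" "set ks = KN N" "length ks = card (KN N :: (int^'d) set)"
  using finite_distinct_list[OF finite_KN, of N] distinct_card by metis

text \<open>For fixed \<open>t\<close> and \<open>N\<close>, \<open>theta_t\<close> is now an
  explicit exponential series in \<open>lam\<close> whose coefficients do not involve
  \<open>lam\<close>; this is what makes it differentiable.\<close>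

lemma theta_t_window:
  assumes lam: "0 < lam" and t: "0 \<le> t" "t / 2 + 1 < real N"
  defines "L \<equiv> lam * real (card (KN N :: (int^'d) set))"
  shows "ennreal (theta_t lam psi t) = ennreal (exp (- L)) * PE L (muS (KN N)) (\<lambda>n x. ennreal (cG (- box_t t) {..<n} x))"
proof -
  interpret R: prob_space "RCM_space lam :: 'd sample measure" by (rule prob_space_RCM)
  obtain ks :: "(int^'d) list" where ks: "distinct ks" "set ks = KN N" "length ks = card (KN N :: (int^'d) set)"
    by (rule obtain_cubes)
  let ?Q = "\<lambda>\<omega> :: 'd sample. \<exists>v\<in>Pts \<omega>. loc 0 \<omega> v \<notin> box_t t \<and> (adj psi 0 \<omega> (insert Orig (Pts \<omega>)))\<^sup>*\<^sup>* Orig v"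
  have "ennreal (theta_t lam psi t) = emeasure (RCM_space lam) {\<omega> \<in> space (RCM_space lam). ?Q \<omega>}"
    by (simp add: theta_t_def R.emeasure_eq_measure)
  also have "\<dots> = (\<integral>\<^sup>+n. \<integral>\<^sup>+x. \<integral>\<^sup>+u. ennreal (prU (\<lambda>e. ?Q (n, x, e, u))) \<partial>UM \<partial>XX \<partial>NN lam)"
    by (rule emeasure_RCM[OF pred_theta[OF psi_meas]])
  also have "\<dots> = (\<integral>\<^sup>+n. \<integral>\<^sup>+x. ennreal (cG (- box_t t) {..<sum_list (map n ks)} (\<lambda>i. x (cat ks (map n ks) i))) \<partial>XX \<partial>NN lam)"
  proof (rule nn_integral_cong, rule nn_integral_cong_AE)
    fix n :: "int^'d \<Rightarrow> nat"
    show "AE x in XX. (\<integral>\<^sup>+u. ennreal (prU (\<lambda>e. ?Q (n, x, e, u))) \<partial>UM) =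
      ennreal (cG (- box_t t) {..<sum_list (map n ks)} (\<lambda>i. x (cat ks (map n ks) i)))"
      using AE_XX_cubes
    proof eventually_elim
      case (elim x)
      show ?case unfolding prU_theta[OF elim t ks(1,2)] by simp
    qed
  qed
  also have "\<dots> = ennreal (exp (- (lam * length ks))) * PE (lam * length ks) (muS (set ks)) (\<lambda>n x. ennreal (cG (- box_t t) {..<n} x))"
  proof (rule process_window[OF lam ks(1), where F="\<lambda>A z. ennreal (cG (- box_t t) A z)"])
    show "labf (\<lambda>A z. ennreal (cG (- box_t t) A z))" by (rule labf_map[OF labf_cG])
    show "(\<lambda>z. ennreal (cG (- box_t t) A z)) \<in> borel_measurable (PiM UNIV (\<lambda>_. borel))" for A
      by (intro measurable_compose[OF _ measurable_ennreal] measurable_cG) simp_all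
  qed
  finally show ?thesis by (simp add: ks L_def)
qed

section \<open>Thinned connections and \<open>phi\<close> in a window\<close>

lemma nn_integral_thin_marks:
  fixes c :: "nat \<Rightarrow> 'v" and g :: "nat set \<Rightarrow> ennreal" and r :: "nat \<Rightarrow> real"
  assumes c: "inj_on c {..<s}" and r: "\<And>i. 0 \<le> r i" "\<And>i. r i \<le> 1"
  shows "(\<integral>\<^sup>+u. g {i\<in>{..<s}. u (c i) \<le> r i} \<partial>UM) =
    (\<Sum>A\<in>Pow {..<s}. g A * (ennreal (\<Prod>i\<in>A. r i) * ennreal (\<Prod>i\<in>{..<s} - A. 1 - r i)))"
proof -
  define Q where "Q A i v = (if i \<in> A then v \<le> r i else \<not> v \<le> r i)" for A i v
  have Qm: "{v. Q A i v} \<in> sets borel" for A i unfolding Q_def by (cases "i \<in> A") simp_all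
  have ev: "{i\<in>{..<s}. u (c i) \<le> r i} = A \<longleftrightarrow> (\<forall>i\<in>{..<s}. Q A i (u (c i)))" if "A \<in> Pow {..<s}" for A u
    using that by (auto simp: Q_def split: if_splits)
  have "Measurable.pred UM (\<lambda>u. Q A i (u (c i)))" for A i
    using Qm[of A i] by (intro measurable_compose[OF measurable_UM_component]) (simp add: pred_def)
  then have [measurable]: "{u. \<forall>i\<in>{..<s}. Q A i (u (c i))} \<in> sets UM" for A
    by (subst pred_UM[symmetric]) (rule pred_intros_finite, auto)
  have "(\<integral>\<^sup>+u. g {i\<in>{..<s}. u (c i) \<le> r i} \<partial>UM) =
     (\<integral>\<^sup>+u. (\<Sum>A\<in>Pow {..<s}. g A * indicator {u. \<forall>i\<in>{..<s}. Q A i (u (c i))} u) \<partial>UM)"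
  proof (rule nn_integral_cong)
    fix u :: "'v \<Rightarrow> real"
    let ?A = "{i\<in>{..<s}. u (c i) \<le> r i}"
    have "(\<Sum>A\<in>Pow {..<s}. g A * indicator {u. \<forall>i\<in>{..<s}. Q A i (u (c i))} u) = (\<Sum>A\<in>Pow {..<s}. if A = ?A then g A else 0)"
    proof (rule sum.cong[OF refl])
      fix A assume "A \<in> Pow {..<s}"
      note e = ev[OF this, of u]
      show "g A * indicator {u. \<forall>i\<in>{..<s}. Q A i (u (c i))} u = (if A = ?A then g A else 0)"
      proof (cases "A = ?A")
        case True
        then have "\<forall>i\<in>{..<s}. Q A i (u (c i))" using e by metis
        then have "u \<in> {u. \<forall>i\<in>{..<s}. Q A i (u (c i))}" by simp
        then show ?thesis using True by (simp only: indicator_simps simp_thms if_True mult_1_right)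
      next
        case False
        then have "u \<notin> {u. \<forall>i\<in>{..<s}. Q A i (u (c i))}" using e by (simp only: mem_Collect_eq) metis
        then have "indicator {u. \<forall>i\<in>{..<s}. Q A i (u (c i))} u = (0 :: ennreal)" by (rule indicator_simps(2))
        then show ?thesis using False by (simp only: if_False mult_zero_right)
      qed
    qed
    also have "\<dots> = g ?A" by (subst sum.delta) auto
    finally show "g ?A = (\<Sum>A\<in>Pow {..<s}. g A * indicator {u. \<forall>i\<in>{..<s}. Q A i (u (c i))} u)" ..
  qed
  also have "\<dots> = (\<Sum>A\<in>Pow {..<s}. g A * ennreal (prU (\<lambda>u. \<forall>i\<in>{..<s}. Q A i (u (c i)))))"
    by (subst nn_integral_sum) (auto simp: nn_integral_cmult UM.emeasure_eq_measure intro!: sum.cong)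
  also have "\<dots> = (\<Sum>A\<in>Pow {..<s}. g A * (ennreal (\<Prod>i\<in>A. r i) * ennreal (\<Prod>i\<in>{..<s} - A. 1 - r i)))"
  proof (rule sum.cong[OF refl])
    fix A assume A: "A \<in> Pow {..<s}"
    have "prU (\<lambda>u. \<forall>i\<in>{..<s}. Q A i (u (c i))) = (\<Prod>i<s. measure U01 {v. Q A i v})"
      by (rule prU_all[OF _ c Qm]) simp
    also have "\<dots> = (\<Prod>i<s. if i \<in> A then r i else 1 - r i)"
      by (rule prod.cong) (auto simp: Q_def measure_U01_le measure_U01_gt[unfolded not_le] not_le r)
    also have "\<dots> = (\<Prod>i\<in>A. r i) * (\<Prod>i\<in>{..<s} - A. 1 - r i)"
      using A by (subst prod.If_cases) (auto intro!: arg_cong2[where f="(*)"] prod.cong)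
    finally show "g A * ennreal (prU (\<lambda>u. \<forall>i\<in>{..<s}. Q A i (u (c i)))) =
      g A * (ennreal (\<Prod>i\<in>A. r i) * ennreal (\<Prod>i\<in>{..<s} - A. 1 - r i))"
      using r by (simp add: ennreal_mult prod_nonneg)
  qed
  finally show ?thesis .
qed

lemma labf_sum_Pow:
  fixes H :: "nat set \<Rightarrow> (nat \<Rightarrow> 'z) \<Rightarrow> ennreal"
  assumes H: "labf H"
  shows "labf (\<lambda>A z. \<Sum>B\<in>Pow A. H B z * ennreal (\<Prod>i\<in>A - B. g (z i)))"
  unfolding labf_def
proof (intro allI impI)
  fix A \<pi> and x x' :: "nat \<Rightarrow> 'z" assume A: "finite A" "inj_on \<pi> A" "\<forall>i\<in>A. x (\<pi> i) = x' i"
  have "(\<Sum>B\<in>Pow (\<pi> ` A). H B x * ennreal (\<Prod>i\<in>\<pi> ` A - B. g (x i))) =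
    (\<Sum>B\<in>Pow A. H (\<pi> ` B) x * ennreal (\<Prod>i\<in>\<pi> ` A - \<pi> ` B. g (x i)))"
    unfolding image_Pow_surj[OF refl, symmetric] by (subst sum.reindex[OF inj_on_image_Pow[OF A(2)]]) simp
  also have "\<dots> = (\<Sum>B\<in>Pow A. H B x' * ennreal (\<Prod>i\<in>A - B. g (x' i)))"
  proof (rule sum.cong[OF refl])
    fix B assume B: "B \<in> Pow A"
    have iB: "inj_on \<pi> B" "inj_on \<pi> (A - B)" "finite B" using A B by (auto intro: inj_on_subset finite_subset)
    have "H (\<pi> ` B) x = H B x'" by (rule labfD[OF H]) (use A B iB in auto)
    moreover have "\<pi> ` A - \<pi> ` B = \<pi> ` (A - B)" using inj_on_image_set_diff[OF A(2), of A B] B by auto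
    ultimately show "H (\<pi> ` B) x * ennreal (\<Prod>i\<in>\<pi> ` A - \<pi> ` B. g (x i)) = H B x' * ennreal (\<Prod>i\<in>A - B. g (x' i))"
      using A(3) by (simp add: prod.reindex[OF iB(2)])
  qed
  finally show "(\<Sum>B\<in>Pow (\<pi> ` A). H B x * ennreal (\<Prod>i\<in>\<pi> ` A - B. g (x i))) = (\<Sum>B\<in>Pow A. H B x' * ennreal (\<Prod>i\<in>A - B. g (x' i)))" .
qed

text \<open>The thinned process has points only where \<open>f\<close> is positive, hence only in
  the window. Averaging over the thinning marks sums over the sets of kept points, and the rejected
  ones integrate to an exponential that combines with \<open>exp (- L)\<close> to the stated
  normalisation.\<close>

lemma conn_window:
  assumes lam: "0 < lam" and f[measurable]: "f \<in> borel_measurable borel" and f01: "\<And>z. 0 \<le> f z" "\<And>z. f z \<le> 1"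
    and supp: "\<And>z j. f z \<noteq> 0 \<Longrightarrow> \<bar>z $ j\<bar> < real N"
  defines "L \<equiv> lam * real (card (KN N :: (int^'d) set))"
  shows "ennreal (measure (RCM_space lam :: 'd sample measure)
        {\<omega> \<in> space (RCM_space lam). (adj psi y \<omega> ({Orig, Extra} \<union> thinned f \<omega>))\<^sup>*\<^sup>* Orig Extra}) =
    ennreal (exp (- (L * (\<integral>b. f b \<partial>muS (KN N))))) * window.tau psi (muS (KN N)) L f y"
proof -
  interpret R: prob_space "RCM_space lam :: 'd sample measure" by (rule prob_space_RCM)
  have L0: "0 \<le> L" using lam by (simp add: L_def)
  interpret W: window psi "muS (KN N)" L by (rule window_muS[OF finite_KN L0])
  obtain ks :: "(int^'d) list" where ks: "distinct ks" "set ks = KN N" "length ks = card (KN N :: (int^'d) set)"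
    by (rule obtain_cubes)
  let ?Q = "\<lambda>\<omega> :: 'd sample. (adj psi y \<omega> ({Orig, Extra} \<union> thinned f \<omega>))\<^sup>*\<^sup>* Orig Extra"
  define H where "H B z = ennreal ((\<Prod>i\<in>B. f (z i)) * cO y B z)" for B and z :: "nat \<Rightarrow> real^'d"
  define F where "F A z = (\<Sum>B\<in>Pow A. H B z * ennreal (\<Prod>i\<in>A - B. 1 - f (z i)))" for A and z :: "nat \<Rightarrow> real^'d"
  have labH: "labf H" unfolding H_def[abs_def]
    by (rule labf_comb[OF labf_prod labf_cO, where g="\<lambda>a b. ennreal (a * b)"])
  have Hm: "H B \<in> borel_measurable N'" if "\<And>i. (\<lambda>z. z i) \<in> borel_measurable N'" for B N'
    unfolding H_def by (intro measurable_compose[OF _ measurable_ennreal] borel_measurable_times borel_measurable_prod measurable_cO measurable_compose[OF _ f] that borel_measurable_const)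
  have "ennreal (measure (RCM_space lam) {\<omega> \<in> space (RCM_space lam). ?Q \<omega>}) = emeasure (RCM_space lam) {\<omega> \<in> space (RCM_space lam). ?Q \<omega>}"
    by (simp add: R.emeasure_eq_measure)
  also have "\<dots> = (\<integral>\<^sup>+n. \<integral>\<^sup>+x. \<integral>\<^sup>+u. ennreal (prU (\<lambda>e. ?Q (n, x, e, u))) \<partial>UM \<partial>XX \<partial>NN lam)"
    by (rule emeasure_RCM[OF pred_conn[OF psi_meas f]])
  also have "\<dots> = (\<integral>\<^sup>+n. \<integral>\<^sup>+x. F {..<sum_list (map n ks)} (\<lambda>i. x (cat ks (map n ks) i)) \<partial>XX \<partial>NN lam)"
  proof (rule nn_integral_cong, rule nn_integral_cong_AE)
    fix n :: "int^'d \<Rightarrow> nat"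
    let ?s = "sum_list (map n ks)"
    show "AE x in XX. (\<integral>\<^sup>+u. ennreal (prU (\<lambda>e. ?Q (n, x, e, u))) \<partial>UM) = F {..<?s} (\<lambda>i. x (cat ks (map n ks) i))"
      using AE_XX_cubes
    proof eventually_elim
      case (elim x)
      let ?z = "\<lambda>i. x (cat ks (map n ks) i)" and ?c = "enum ks n"
      have cinj: "inj_on ?c {..<?s}" and cim: "?c ` {..<?s} = VK ks n"
        using enum_bij[OF ks(1), of n] by (auto simp: bij_betw_def)
      \<comment> \<open>Where \<open>f\<close> vanishes a point is kept only if its mark is at most
        0, so positive marks are needed to confine the thinned set to the window.\<close>
      have "AE u in UM. \<forall>v :: 'd vtx. u v > (0::real)"
        by (simp add: AE_all_countable AE_UM_gt0)
      then have "AE u in UM. ennreal (prU (\<lambda>e. ?Q (n, x, e, u))) = ennreal (cO y {i\<in>{..<?s}. u (?c i) \<le> f (?z i)} ?z)"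
      proof eventually_elim
        case (elim u)
        have "thinned f (n, x, e, u) = ?c ` {i\<in>{..<?s}. u (?c i) \<le> f (?z i)}" for e
        proof -
          have "v \<in> VK ks n" if v: "v \<in> {Pt k i | k i. i < n k}" "u v \<le> f (vloc 0 x v)" for v
          proof -
            from v(1) obtain k i where ki: "v = Pt k i" "i < n k" by auto
            have "f (x (k, i)) \<noteq> 0" using v(2) spec[OF elim, of v] ki by auto
            then have xN: "\<bar>x (k, i) $ j\<bar> < real N" for j by (rule supp)
            have "x (k, i) \<in> unit_cube k" using \<open>\<forall>k i. x (k, i) \<in> unit_cube k\<close> by blast
            then have "k \<in> KN N" by (rule in_cube_KN[where x=x]) (rule xN)
            then show ?thesis using ki ks by (auto simp: VK_def)
          qed
          moreover have "v \<in> {Pt k i | k i. i < n k}" if "v \<in> VK ks n" for v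
            using that by (auto simp: VK_def)
          ultimately have "thinned f (n, x, e, u) = {v \<in> VK ks n. u v \<le> f (vloc 0 x v)}"
            unfolding thinned_eq by blast
          also have "\<dots> = ?c ` {i\<in>{..<?s}. u (?c i) \<le> f (?z i)}"
            unfolding cim[symmetric] by (auto simp: vloc_enum)
          finally show ?thesis .
        qed
        moreover have "{i\<in>{..<?s}. u (?c i) \<le> f (?z i)} \<subseteq> {..<?s}" by auto
        ultimately show ?case
          using con_enum[OF ks(1), where A="{i\<in>{..<?s}. u (?c i) \<le> f (?z i)}" and n=n and y=y and x=x]
          by (simp add: adj_eq con_def)
      qed
      then have "(\<integral>\<^sup>+u. ennreal (prU (\<lambda>e. ?Q (n, x, e, u))) \<partial>UM) = (\<integral>\<^sup>+u. ennreal (cO y {i\<in>{..<?s}. u (?c i) \<le> f (?z i)} ?z) \<partial>UM)"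
        by (rule nn_integral_cong_AE)
      also have "\<dots> = (\<Sum>A\<in>Pow {..<?s}. ennreal (cO y A ?z) * (ennreal (\<Prod>i\<in>A. f (?z i)) * ennreal (\<Prod>i\<in>{..<?s} - A. 1 - f (?z i))))"
        by (rule nn_integral_thin_marks[OF cinj]) (use f01 in auto)
      also have "\<dots> = F {..<?s} ?z"
        unfolding F_def H_def using f01 by (simp add: ennreal_mult prod_nonneg mult_ac)
      finally show ?case .
    qed
  qed
  also have "\<dots> = ennreal (exp (- (lam * length ks))) * PE (lam * length ks) (muS (set ks)) (\<lambda>n x. F {..<n} x)"
  proof (rule process_window[OF lam ks(1)])
    show "labf F" unfolding F_def[abs_def] by (rule labf_sum_Pow[OF labH])
    show "F A \<in> borel_measurable (PiM UNIV (\<lambda>_. borel))" for A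
      unfolding F_def
      by (intro borel_measurable_sum borel_measurable_times_ennreal Hm measurable_compose[OF _ measurable_ennreal]
          borel_measurable_prod borel_measurable_diff borel_measurable_const measurable_compose[OF _ f]) simp_all
  qed
  also have "\<dots> = ennreal (exp (- L)) * PE L (muS (KN N)) (\<lambda>n x. F {..<n} x)"
    by (simp add: ks L_def)
  also have "PE L (muS (KN N)) (\<lambda>n x. F {..<n} x) = PE L (muS (KN N)) (\<lambda>k x. H {..<k} x * ennreal (exp (L * (\<integral>b. 1 - f b \<partial>muS (KN N)))))"
    unfolding F_def
    by (rule W.PE_split_weight[where w="\<lambda>A x b. 1 - f b"])
       (use f01 in \<open>auto intro!: labH Hm W.measurable_SQ_comp labf_const\<close>)
  also have "\<dots> = PE L (muS (KN N)) (\<lambda>k x. ennreal (exp (L * (\<integral>b. 1 - f b \<partial>muS (KN N)))) * H {..<k} x)"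
    by (simp add: mult.commute)
  also have "\<dots> = ennreal (exp (L * (\<integral>b. 1 - f b \<partial>muS (KN N)))) * W.tau f y"
    unfolding W.tau_def H_def[symmetric] by (rule W.PE_cmult) (rule Hm, rule W.measurable_SQ_comp)
  also have "(\<integral>b. 1 - f b \<partial>muS (KN N)) = 1 - (\<integral>b. f b \<partial>muS (KN N))"
    using W.integrable_01[OF f f01] W.M.prob_space by (simp add: Bochner_Integration.integral_diff)
  also have "ennreal (exp (- L)) * (ennreal (exp (L * (1 - (\<integral>b. f b \<partial>muS (KN N))))) * W.tau f y) =
     ennreal (exp (- (L * (\<integral>b. f b \<partial>muS (KN N))))) * W.tau f y"
    by (simp add: mult.assoc[symmetric] ennreal_mult[symmetric] exp_add[symmetric] algebra_simps)
  finally show ?thesis .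
qed

end

subsection \<open>The critical intensity\<close>

context rcm
begin

text \<open>A point \<open>y\<close> beyond the range of \<open>psi\<close> from the origin and from
  the support of \<open>f\<close> is seen by no cluster that the thinning can produce.\<close>

lemma tau_eq_0:
  assumes "window psi M L" and "psi y = 0" and "\<And>z. f z \<noteq> 0 \<Longrightarrow> psi (y - z) = 0"
  shows "window.tau psi M L f y = 0"
proof -
  interpret W: window psi M L by fact
  have z: "(\<Prod>i<m. f (x i)) * cO y {..<m} x = 0" for m x
  proof (cases "\<exists>i<m. f (x i) = 0")
    case True then show ?thesis by auto
  next
    case False
    then have "psi (y - x i) = 0" if "i < m" for i using that assms(3) by blast
    then have "fO C x y = 1" if "C \<in> Pow {..<m}" for C
      using that assms(2) unfolding fO_def by (auto intro!: prod.neutral)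
    then show ?thesis by (simp add: cO_eq)
  qed
  show ?thesis unfolding W.tau_def z PE_def by simp
qed

text \<open>The margin \<open>R + 1 < N\<close> leaves room for the last edge to \<open>y\<close>:
  outside the window the connection probability is 0, so the integral over the whole space is one
  over the window.\<close>

lemma phi_window:
  assumes lam: "0 < lam" and f[measurable]: "f \<in> borel_measurable borel" and f01: "\<And>z. 0 \<le> f z" "\<And>z. f z \<le> 1"
    and supp: "\<And>z j. f z \<noteq> 0 \<Longrightarrow> \<bar>z $ j\<bar> \<le> R" and R: "0 \<le> R" "R + 1 < real N"
  defines "L \<equiv> lam * real (card (KN N :: (int^'d) set))"
  shows "phi lam psi f = ennreal L * (ennreal (exp (- (L * (\<integral>b. f b \<partial>muS (KN N))))) *
    (\<integral>\<^sup>+y. ennreal (1 - f y) * window.tau psi (muS (KN N)) L f y \<partial>muS (KN N)))"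
proof -
  have L0: "0 \<le> L" using lam by (simp add: L_def)
  note win = window_muS[OF finite_KN L0, of N]
  interpret W: window psi "muS (KN N)" L by (rule win)
  let ?E = "ennreal (exp (- (L * (\<integral>b. f b \<partial>muS (KN N)))))"
  have taum[measurable]: "W.tau f \<in> borel_measurable borel" by (rule W.measurable_tau[OF f])
  have supp': "\<bar>z $ j\<bar> < real N" if "f z \<noteq> 0" for z j
    using supp[OF that, of j] R by linarith
  have "phi lam psi f = ennreal lam * (\<integral>\<^sup>+y. ennreal (1 - f y) * (?E * W.tau f y) \<partial>lborel)"
    unfolding phi_def using f01
    by (simp add: ennreal_mult conn_window[OF lam f f01 supp', folded L_def, symmetric])
  also have "(\<integral>\<^sup>+y. ennreal (1 - f y) * (?E * W.tau f y) \<partial>lborel) =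
      (\<integral>\<^sup>+y. ?E * (ennreal (1 - f y) * W.tau f y) * indicator (OS (KN N)) y \<partial>lborel)"
  proof (rule nn_integral_cong_AE, use AE_in_OS_KN[of N] in eventually_elim)
    case (elim y)
    show ?case
    proof (cases "\<forall>j. \<bar>y $ j\<bar> < real N")
      case True
      then show ?thesis using elim by (simp add: mult_ac)
    next
      case False
      then obtain j where j: "real N \<le> \<bar>y $ j\<bar>" by (auto simp: not_less)
      have far: "psi (y - z) = 0" if "\<bar>z $ j\<bar> \<le> R" for z
      proof (rule psi_range)
        have "1 < \<bar>(y - z) $ j\<bar>" using that j R(2) by simp
        then show "1 < norm (y - z)" using component_le_norm_cart[of "y - z" j] by linarith
      qed
      have "W.tau f y = 0"
        by (rule tau_eq_0[OF win]) (use far[of 0] far supp R in auto)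
      then show ?thesis by simp
    qed
  qed
  also have "\<dots> = of_nat (card (KN N :: (int^'d) set)) * (\<integral>\<^sup>+y. ?E * (ennreal (1 - f y) * W.tau f y) \<partial>muS (KN N))"
    by (rule nn_integral_muS[OF finite_KN, symmetric]) measurable
  also have "(\<integral>\<^sup>+y. ?E * (ennreal (1 - f y) * W.tau f y) \<partial>muS (KN N)) = ?E * (\<integral>\<^sup>+y. ennreal (1 - f y) * W.tau f y \<partial>muS (KN N))"
    by (rule nn_integral_cmult) (simp cong: measurable_cong_sets)
  finally show ?thesis
    using lam by (simp add: L_def ennreal_mult ennreal_of_nat_eq_real_of_nat mult_ac)
qed

lemma KN_card_pos: "0 < N \<Longrightarrow> 0 < card (KN N :: (int^'d) set)"
  using finite_KN[of N, where 'd='d] by (auto simp: card_gt_0_iff KN_def intro!: exI[of _ 0])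

section \<open>Monotonicity in the intensity and exponential decay\<close>

text \<open>The process of intensity \<open>lam\<close> is obtained from that of intensity
  \<open>lam'\<close> by keeping each point with the constant probability
  \<open>lam / lam'\<close>.\<close>

lemma theta_t_mono_lam:
  assumes lam: "0 < lam" "lam \<le> lam'" and t: "0 \<le> t"
  shows "theta_t lam psi t \<le> theta_t lam' psi t"
proof -
  obtain N :: nat where N: "t / 2 + 1 < real N" using reals_Archimedean2 by blast
  define c where "c = real (card (KN N :: (int^'d) set))"
  have c: "0 < c" using KN_card_pos[of N] N t by (simp add: c_def)
  define r where "r = lam / lam'"
  have r: "0 \<le> r" "r \<le> 1" "lam' * r = lam" using lam by (auto simp: r_def)
  let ?M = "muS (KN N) :: (real^'d) measure" and ?T = "- box_t t :: (real^'d) set"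
  interpret W: window psi ?M "lam' * c" by (rule window_muS[OF finite_KN]) (use lam c in auto)
  have "PE (lam' * c) ?M (\<lambda>k x. ennreal (\<Prod>i<k. r) * ennreal (cG ?T {..<k} x)) * ennreal (exp (lam' * c * (\<integral>b. 1 - r \<partial>?M)))
    \<le> PE (lam' * c) ?M (\<lambda>n x. ennreal (cG ?T {..<n} x))"
    by (rule W.PE_thin_mono[where F="\<lambda>A x. ennreal (cG ?T A x)"])
       (use r in \<open>auto intro!: labf_map[OF labf_cG] cG_mono ennreal_leI measurable_cG measurable_compose[OF _ measurable_ennreal] W.measurable_SQ_comp\<close>)
  moreover have "PE (lam' * c) ?M (\<lambda>k x. ennreal (\<Prod>i<k. r) * ennreal (cG ?T {..<k} x)) = PE (lam * c) ?M (\<lambda>n x. ennreal (cG ?T {..<n} x))"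
    unfolding PE_def
  proof (rule suminf_cong)
    fix n
    have "(\<lambda>x. ennreal (cG ?T {..<n} x)) \<in> borel_measurable (SQ ?M)"
      by (intro measurable_cG measurable_compose[OF _ measurable_ennreal] W.measurable_SQ_comp) simp
    then have "(\<integral>\<^sup>+x. ennreal (\<Prod>i<n. r) * ennreal (cG ?T {..<n} x) \<partial>SQ ?M) = ennreal (r ^ n) * (\<integral>\<^sup>+x. ennreal (cG ?T {..<n} x) \<partial>SQ ?M)"
      by (simp add: nn_integral_cmult)
    moreover have "ennreal ((lam' * c) ^ n / fact n) * ennreal (r ^ n) = ennreal ((lam * c) ^ n / fact n)"
      using r lam c by (subst ennreal_mult[symmetric]) (auto simp: r(3)[symmetric] power_mult_distrib mult_ac)
    ultimately show "ennreal ((lam' * c) ^ n / fact n) * (\<integral>\<^sup>+x. ennreal (\<Prod>i<n. r) * ennreal (cG ?T {..<n} x) \<partial>SQ ?M) =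
      ennreal ((lam * c) ^ n / fact n) * (\<integral>\<^sup>+x. ennreal (cG ?T {..<n} x) \<partial>SQ ?M)"
      by (simp add: mult.assoc[symmetric])
  qed
  moreover have "(\<integral>b. 1 - r \<partial>?M) = 1 - r" using W.M.prob_space by simp
  ultimately have "ennreal (exp (- (lam' * c))) * (PE (lam * c) ?M (\<lambda>n x. ennreal (cG ?T {..<n} x)) * ennreal (exp (lam' * c * (1 - r)))) \<le>
     ennreal (exp (- (lam' * c))) * PE (lam' * c) ?M (\<lambda>n x. ennreal (cG ?T {..<n} x))"
    by (intro mult_left_mono) auto
  also have "ennreal (exp (- (lam' * c))) * (PE (lam * c) ?M (\<lambda>n x. ennreal (cG ?T {..<n} x)) * ennreal (exp (lam' * c * (1 - r)))) =
     ennreal (exp (- (lam * c))) * PE (lam * c) ?M (\<lambda>n x. ennreal (cG ?T {..<n} x))"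
  proof -
    have "exp (- (lam' * c)) * exp (lam' * c * (1 - r)) = exp (- (lam * c))"
      unfolding exp_add[symmetric] r(3)[symmetric] by (simp add: algebra_simps)
    then have "ennreal (exp (- (lam' * c))) * ennreal (exp (lam' * c * (1 - r))) = ennreal (exp (- (lam * c)))"
      by (simp add: ennreal_mult[symmetric])
    moreover have "a * (b * d) = (a * d) * b" for a b d :: ennreal by (simp only: mult_ac)
    ultimately show ?thesis by (simp only:)
  qed
  finally have "ennreal (theta_t lam psi t) \<le> ennreal (theta_t lam' psi t)"
    unfolding theta_t_window[OF lam(1) t N, folded c_def]
    by (subst theta_t_window[OF _ t N, folded c_def]) (use lam in auto)
  then show ?thesis by (simp add: theta_t_def)
qed

text \<open>With no point in the window, the origin is isolated. This keeps \<open>theta_t\<close>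
  away from 1 for small \<open>t\<close>, as required by a decay bound without a prefactor.\<close>

lemma theta_t_le_isolated:
  assumes lam: "0 < lam" and t: "0 \<le> t" and N: "t / 2 + 1 < real N"
  shows "theta_t lam psi t \<le> 1 - exp (- (lam * real (card (KN N :: (int^'d) set))))"
proof -
  define L where "L = lam * real (card (KN N :: (int^'d) set))"
  have L0: "0 \<le> L" using lam by (simp add: L_def)
  let ?M = "muS (KN N) :: (real^'d) measure" and ?T = "- box_t t :: (real^'d) set"
  interpret W: window psi ?M L by (rule window_muS[OF finite_KN L0])
  have 0: "cG ?T {..<0} x = 0" for x
  proof -
    have "kG ?T {} x = 1" by (simp add: kG_def kap_def spans_def measure_def)
    then have "1 - cG ?T {} x = 1" using t by (simp add: one_minus_cG fG_def box_t_def)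
    then show ?thesis by simp
  qed
  have "PE L ?M (\<lambda>n x. ennreal (cG ?T {..<n} x)) + PE L ?M (\<lambda>n x. if n = 0 then 1 else 0) =
    PE L ?M (\<lambda>n x. ennreal (cG ?T {..<n} x) + (if n = 0 then 1 else 0))"
    by (rule W.PE_add[symmetric]) (auto intro!: measurable_cG measurable_compose[OF _ measurable_ennreal] W.measurable_SQ_comp)
  also have "\<dots> \<le> PE L ?M (\<lambda>m x. ennreal (\<Prod>i<m. 1))"
    using 0 by (intro W.PE_mono) (auto simp: ennreal_1[symmetric] simp del: ennreal_1 intro: ennreal_leI)
  also have "\<dots> = ennreal (exp L)"
    using W.PE_prod_real[of "\<lambda>_. 1"] W.M.prob_space by simp
  also have "PE L ?M (\<lambda>n x. if n = 0 then 1 else 0) = 1"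
    unfolding PE_def by (subst suminf_finite[of "{0}"]) auto
  finally have "ennreal (exp (- L)) * (PE L ?M (\<lambda>n x. ennreal (cG ?T {..<n} x)) + 1) \<le> ennreal (exp (- L)) * ennreal (exp L)"
    by (rule mult_left_mono) simp
  also have "ennreal (exp (- L)) * ennreal (exp L) = 1"
    by (simp add: ennreal_mult[symmetric] exp_add[symmetric])
  also have "ennreal (exp (- L)) * (PE L ?M (\<lambda>n x. ennreal (cG ?T {..<n} x)) + 1) = ennreal (theta_t lam psi t + exp (- L))"
    using theta_t_window[OF lam t N, folded L_def, symmetric] by (simp add: distrib_left ennreal_plus theta_t_def)
  finally show ?thesis by (simp add: L_def)
qed

text \<open>The exit point \<open>y\<close> has coordinates of size at most \<open>R + 1\<close>, so
  from \<open>y\<close> one still has to leave a box of half side \<open>t / 2 - (R + 1)\<close>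
  centred at \<open>y\<close>. In terms of the side this is the loss
  \<open>2 * R + 2\<close>.\<close>

lemma theta_t_step:
  assumes lam: "0 < lam" and f: "f \<in> borel_measurable borel" and f01: "\<And>z. 0 \<le> f z" "\<And>z. f z \<le> 1"
    and supp: "\<And>z j. f z \<noteq> 0 \<Longrightarrow> \<bar>z $ j\<bar> \<le> R" and R: "0 \<le> R" and t: "2 * R + 2 \<le> t"
  shows "ennreal (theta_t lam psi t) \<le> phi lam psi f * ennreal (theta_t lam psi (t - (2 * R + 2)))"
proof -
  let ?t' = "t - (2 * R + 2)"
  have t0: "0 \<le> t" "0 \<le> ?t'" using R t by auto
  obtain N :: nat where N: "t / 2 + 1 < real N" using reals_Archimedean2 by blast
  \<comment> \<open>The window seen from \<open>y\<close> is shifted by up to \<open>R + 1\<close>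
    in each coordinate, and \<open>N'\<close> is large enough to contain it.\<close>
  obtain N' :: nat where N': "real N + R + 1 < real N'" using reals_Archimedean2 by blast
  define L where "L = lam * real (card (KN N :: (int^'d) set))"
  have L0: "0 \<le> L" using lam by (simp add: L_def)
  let ?M = "muS (KN N) :: (real^'d) measure" and ?T = "- box_t t :: (real^'d) set"
  define Y :: "(real^'d) set" where "Y = {y. \<forall>j. \<bar>y $ j\<bar> \<le> R + 1}"
  interpret W: window psi ?M L by (rule window_muS[OF finite_KN L0])
  have near: "\<bar>y $ j - z $ j\<bar> \<le> 1" if "psi (y - z) \<noteq> 0" for y z :: "real^'d" and j
    using that psi_pos_near[of y z j] psi_ge0[of "y - z"] by linarith
  have "PE L ?M (\<lambda>n x. ennreal (cG ?T {..<n} x)) \<le> (ennreal (exp L) * ennreal (theta_t lam psi ?t')) *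
      (ennreal L * (ennreal (exp (- (L * (\<integral>b. f b \<partial>?M)))) * (\<integral>\<^sup>+y. ennreal (1 - f y) * W.tau f y \<partial>?M)))"
  proof (rule W.exit_bound[OF f f01, where Y=Y])
    fix z assume z: "f z \<noteq> 0"
    have "\<bar>z $ j\<bar> \<le> t / 2" for j using supp[OF z, of j] t by linarith
    then show "z \<notin> ?T" by (simp add: box_t_def)
  next
    fix y assume "psi y \<noteq> 0"
    then have "\<bar>y $ j\<bar> \<le> R + 1" for j using near[of y 0 j] R by simp
    then show "y \<in> Y" by (simp add: Y_def)
  next
    fix y z assume z: "f z \<noteq> 0" "psi (y - z) \<noteq> 0"
    have "\<bar>y $ j\<bar> \<le> R + 1" for j using near[OF z(2), of j] supp[OF z(1), of j] by linarith
    then show "y \<in> Y" by (simp add: Y_def)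
  next
    fix y assume y: "y \<in> Y"
    have "ennreal (exp (- L)) * PE L ?M (\<lambda>m x. ennreal (cE ?T y {..<m} x)) \<le> ennreal (theta_t lam psi ?t')"
      unfolding L_def
    proof (subst theta_t_window[OF lam t0(2), of N'])
      have "?t' / 2 = t / 2 - R - 1" by (simp add: field_simps)
      then show "?t' / 2 + 1 < real N'" using N N' R by linarith
      show "ennreal (exp (- (lam * real (card (KN N :: (int^'d) set))))) * PE (lam * real (card (KN N :: (int^'d) set))) ?M (\<lambda>m x. ennreal (cE ?T y {..<m} x))
        \<le> ennreal (exp (- (lam * real (card (KN N' :: (int^'d) set))))) * PE (lam * real (card (KN N' :: (int^'d) set))) (muS (KN N')) (\<lambda>n x. ennreal (cG (- box_t ?t') {..<n} x))"
      proof (rule PE_cE_le[OF finite_KN finite_KN])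
        show "KN N' \<noteq> ({} :: (int^'d) set)" using KN_card_pos[of N'] N' R by (auto simp: card_gt_0_iff)
        show "AE x in lborel. x + y \<in> OS (KN N) \<longrightarrow> x \<in> OS (KN N')"
          using AE_in_OS_KN[of N']
        proof eventually_elim
          case (elim x)
          show ?case
          proof
            assume "x + y \<in> OS (KN N)"
            then have xy: "\<bar>x $ j + y $ j\<bar> < real N" for j using OS_KN_bound[of "x + y" N j] by simp
            have "\<bar>x $ j\<bar> < real N'" for j
            proof -
              have "\<bar>y $ j\<bar> \<le> R + 1" using y by (simp add: Y_def)
              with xy[of j] N' show ?thesis by linarith
            qed
            with elim show "x \<in> OS (KN N')" by blast
          qed
        qed
        fix z assume "z \<in> ?T"
        then obtain j where j: "t / 2 < \<bar>z $ j\<bar>" by (auto simp: box_t_def not_le)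
        moreover have "\<bar>y $ j\<bar> \<le> R + 1" using y by (simp add: Y_def)
        moreover have "\<bar>z $ j\<bar> - \<bar>y $ j\<bar> \<le> \<bar>(z - y) $ j\<bar>" by (simp add: abs_triangle_ineq2)
        moreover have "?t' / 2 = t / 2 - R - 1" by (simp add: field_simps)
        ultimately have "?t' / 2 < \<bar>(z - y) $ j\<bar>" by linarith
        then show "z - y \<in> - box_t ?t'" by (auto simp: box_t_def not_le)
      qed (use lam in auto)
    qed
    then have "ennreal (exp L) * (ennreal (exp (- L)) * PE L ?M (\<lambda>m x. ennreal (cE ?T y {..<m} x))) \<le> ennreal (exp L) * ennreal (theta_t lam psi ?t')"
      by (rule mult_left_mono) simp
    moreover have "ennreal (exp L) * ennreal (exp (- L)) = 1"
      by (simp add: ennreal_mult[symmetric] exp_add[symmetric])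
    ultimately show "PE L ?M (\<lambda>m x. ennreal (cE ?T y {..<m} x)) \<le> ennreal (exp L) * ennreal (theta_t lam psi ?t')"
      by (simp add: mult.assoc[symmetric])
  qed (use t0 in \<open>auto simp: box_t_def\<close>)
  also have "ennreal L * (ennreal (exp (- (L * (\<integral>b. f b \<partial>?M)))) * (\<integral>\<^sup>+y. ennreal (1 - f y) * W.tau f y \<partial>?M)) = phi lam psi f"
    unfolding L_def by (rule phi_window[OF lam f f01 supp R, symmetric]) (use N t in auto)
  finally have "ennreal (exp (- L)) * PE L ?M (\<lambda>n x. ennreal (cG ?T {..<n} x)) \<le>
      ennreal (exp (- L)) * ((ennreal (exp L) * ennreal (theta_t lam psi ?t')) * phi lam psi f)"
    by (rule mult_left_mono) simp
  also have "\<dots> = (ennreal (exp (- L)) * ennreal (exp L)) * (phi lam psi f * ennreal (theta_t lam psi ?t'))"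
    by (simp add: mult_ac)
  also have "ennreal (exp (- L)) * ennreal (exp L) = 1"
    by (simp add: ennreal_mult[symmetric] exp_add[symmetric])
  finally show ?thesis
    using theta_t_window[OF lam t0(1) N, folded L_def] by simp
qed

lemma thinning_fnsD:
  assumes "f \<in> thinning_fns"
  shows "f \<in> borel_measurable borel" "\<And>z. 0 \<le> f z" "\<And>z. f z \<le> 1"
    "\<exists>R\<ge>0. \<forall>z j. f z \<noteq> 0 \<longrightarrow> \<bar>z $ j\<bar> \<le> R"
proof -
  show "f \<in> borel_measurable borel" "\<And>z. 0 \<le> f z" "\<And>z. f z \<le> 1"
    using assms by (auto simp: thinning_fns_def)
  from assms obtain R where R: "\<And>z. f z \<noteq> 0 \<Longrightarrow> norm z \<le> R"
    unfolding thinning_fns_def bounded_iff by auto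
  have "\<bar>z $ j\<bar> \<le> max R 0" if "f z \<noteq> 0" for z j
    using R[OF that] component_le_norm_cart[of z j] by linarith
  then show "\<exists>R\<ge>0. \<forall>z j. f z \<noteq> 0 \<longrightarrow> \<bar>z $ j\<bar> \<le> R" by (intro exI[of _ "max R 0"]) auto
qed

text \<open>Each step of length \<open>a\<close> costs a factor of at most \<open>m < 1\<close>. On
  the first interval, 0 < t <= a, the bound is \<open>theta_t <= m\<close>, and m <= m powr (t / a)
  there, so the induction starts with constant 1.\<close>

lemma theta_t_exp_decay:
  assumes lam: "0 < lam" and f: "f \<in> thinning_fns" and phi: "phi lam psi f < 1"
  shows "\<exists>c>0. \<forall>t>0. theta_t lam psi t \<le> exp (- c * t)"
proof -
  obtain R where R: "0 \<le> R" "\<And>z j. f z \<noteq> 0 \<Longrightarrow> \<bar>z $ j\<bar> \<le> R" using thinning_fnsD(4)[OF f] by blast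
  define a where "a = 2 * R + 2"
  have a: "0 < a" using R by (simp add: a_def)
  obtain N :: nat where N: "a / 2 + 1 < real N" using reals_Archimedean2 by blast
  define q where "q = enn2real (phi lam psi f)"
  have q: "phi lam psi f = ennreal q" "0 \<le> q" "q < 1"
  proof -
    have "phi lam psi f < top" using phi by (rule less_trans) simp
    then show 1: "phi lam psi f = ennreal q" by (simp add: q_def)
    show 2: "0 \<le> q" by (simp add: q_def)
    have "ennreal q < ennreal 1" using phi unfolding 1 by simp
    then show "q < 1" using 2 by (simp only: ennreal_less_iff)
  qed
  \<comment> \<open>The larger of the factor lost per step and the bound for small \<open>t\<close>;
    both are smaller than 1.\<close>
  define m where "m = max q (1 - exp (- (lam * real (card (KN N :: (int^'d) set)))))"
  have m: "q \<le> m" "1 - exp (- (lam * real (card (KN N :: (int^'d) set)))) \<le> m" by (auto simp: m_def)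
  have c: "0 < lam * real (card (KN N :: (int^'d) set))" using KN_card_pos[of N] N a lam by simp
  have "exp (- (lam * real (card (KN N :: (int^'d) set)))) < 1" using c by simp
  then have m0: "0 < m" "m < 1" using q by (auto simp: m_def less_max_iff_disj)
  have step: "theta_t lam psi t \<le> m * theta_t lam psi (t - a)" if "a < t" for t
  proof -
    have "ennreal (theta_t lam psi t) \<le> phi lam psi f * ennreal (theta_t lam psi (t - a))"
      unfolding a_def by (rule theta_t_step[OF lam thinning_fnsD(1-3)[OF f] R(2,1)]) (use that in \<open>auto simp: a_def\<close>)
    also have "\<dots> = ennreal (q * theta_t lam psi (t - a))"
      unfolding q(1) using q(2) by (simp add: ennreal_mult theta_t_def)
    finally have "theta_t lam psi t \<le> q * theta_t lam psi (t - a)"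
      using q(2) by (simp add: theta_t_def)
    also have "\<dots> \<le> m * theta_t lam psi (t - a)"
      using m by (intro mult_right_mono) (auto simp: theta_t_def)
    finally show ?thesis .
  qed
  have bound: "theta_t lam psi t \<le> m powr (t / a)" if "0 < t" "t \<le> real (Suc k) * a" for k t
    using that
  proof (induction k arbitrary: t)
    case 0
    have "theta_t lam psi t \<le> m"
      using theta_t_le_isolated[OF lam, of t N] 0 N m(2) by auto
    also have "m = m powr 1" using m0 by simp
    also have "\<dots> \<le> m powr (t / a)" using 0 a m0 by (intro powr_mono') auto
    finally show ?case .
  next
    case (Suc k)
    show ?case
    proof (cases "t \<le> real (Suc k) * a")
      case True then show ?thesis using Suc by blast
    next
      case False
      have "real (Suc k) * a \<ge> 1 * a" using a by (intro mult_right_mono) auto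
      then have ta: "a < t" using False by simp
      have "theta_t lam psi t \<le> m * theta_t lam psi (t - a)" by (rule step[OF ta])
      also have "\<dots> \<le> m * m powr ((t - a) / a)"
        using Suc.prems ta m0 by (intro mult_left_mono Suc.IH) (auto simp: algebra_simps)
      also have "\<dots> = m powr (1 + (t - a) / a)" using m0 by (simp add: powr_add)
      also have "1 + (t - a) / a = t / a" using a by (simp add: field_simps)
      finally show ?thesis .
    qed
  qed
  show ?thesis
  proof (intro exI[of _ "- ln m / a"] conjI allI impI)
    show "0 < - ln m / a" by (intro divide_pos_pos) (use m0 a in auto)
    fix t :: real assume t: "0 < t"
    obtain k :: nat where "t / a < real k" using reals_Archimedean2 by blast
    then have "t \<le> real (Suc k) * a" using a by (simp add: field_simps)
    from bound[OF t this] show "theta_t lam psi t \<le> exp (- (- ln m / a) * t)"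
      using m0 by (simp add: powr_def mult.commute)
  qed
qed

section \<open>Lower bound in the supercritical regime\<close>

text \<open>The differential inequality in integrated form, in a window fixed for all intensities
  between \<open>lam0\<close> and \<open>lam1\<close>. The hypothesis on \<open>phi\<close> is used
  for the random function \<open>fG\<close>, whose support lies in the box because the ghost factor
  vanishes outside.\<close>

lemma theta_t_lower:
  assumes lam: "0 < lam0" "lam0 \<le> lam1" and t: "0 \<le> t"
    and phi: "\<And>lam f. lam0 \<le> lam \<Longrightarrow> lam \<le> lam1 \<Longrightarrow> f \<in> thinning_fns \<Longrightarrow> 1 \<le> phi lam psi f"
  shows "lam1 * (1 - theta_t lam1 psi t) \<le> lam0 * (1 - theta_t lam0 psi t)"
proof -
  obtain N :: nat where N: "t / 2 + 1 < real N" using reals_Archimedean2 by blast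
  define c where "c = real (card (KN N :: (int^'d) set))"
  have c: "0 < c" using KN_card_pos[of N] N t by (simp add: c_def)
  let ?M = "muS (KN N) :: (real^'d) measure" and ?T = "- box_t t :: (real^'d) set"
  interpret I: iid_seq ?M by (rule iid_muS[OF finite_KN])
  define g where "g n = enn2real (\<integral>\<^sup>+x. ennreal (cG ?T {..<n} x) \<partial>SQ ?M)" for n
  have cGm[measurable]: "(\<lambda>x. cG ?T {..<n} x) \<in> borel_measurable (SQ ?M)" for n
    by (intro measurable_cG measurable_muS_comp) simp
  have le1: "(\<integral>\<^sup>+x. ennreal (cG ?T {..<n} x) \<partial>SQ ?M) \<le> 1" for n
  proof -
    have "(\<integral>\<^sup>+x. ennreal (cG ?T {..<n} x) \<partial>SQ ?M) \<le> (\<integral>\<^sup>+x. 1 \<partial>SQ ?M)"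
      by (intro nn_integral_mono) (simp add: ennreal_1[symmetric] del: ennreal_1)
    then show ?thesis by simp
  qed
  have g: "(\<integral>\<^sup>+x. ennreal (cG ?T {..<n} x) \<partial>SQ ?M) = ennreal (g n)" "0 \<le> g n" "g n \<le> 1" for n
  proof -
    show 1: "(\<integral>\<^sup>+x. ennreal (cG ?T {..<n} x) \<partial>SQ ?M) = ennreal (g n)"
      unfolding g_def using le1[of n] by (subst ennreal_enn2real) (auto simp: less_top[symmetric] top_unique)
    show "0 \<le> g n" by (simp add: g_def)
    show "g n \<le> 1" using le1[of n] unfolding 1 by (simp add: ennreal_1[symmetric] del: ennreal_1)
  qed
  have g': "(\<integral>\<^sup>+x. ennreal (1 - cG ?T {..<n} x) \<partial>SQ ?M) = ennreal (1 - g n)" for n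
  proof -
    have "ennreal (g n) + (\<integral>\<^sup>+x. ennreal (1 - cG ?T {..<n} x) \<partial>SQ ?M) = (\<integral>\<^sup>+x. ennreal (cG ?T {..<n} x) + ennreal (1 - cG ?T {..<n} x) \<partial>SQ ?M)"
      unfolding g(1)[symmetric] by (rule nn_integral_add[symmetric]) measurable
    also have "\<dots> = 1" by (simp add: ennreal_plus[symmetric] del: ennreal_plus)
    also have "\<dots> = ennreal (g n) + ennreal (1 - g n)" using g[of n] by (simp add: ennreal_plus[symmetric] del: ennreal_plus)
    finally show ?thesis by simp
  qed
  have summ: "summable (\<lambda>n. x ^ n / fact n * h n)" if "0 \<le> x" "\<And>n. \<bar>h n\<bar> \<le> 1" for x :: real and h
  proof (rule summable_comparison_test'[of "\<lambda>n. x ^ n / fact n"])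
    show "summable (\<lambda>n. x ^ n / fact n)"
      using summable_exp_generic[of x] by (simp add: scaleR_conv_of_real field_simps)
    show "norm (x ^ n / fact n * h n) \<le> x ^ n / fact n" for n
      using that(1) mult_left_mono[OF that(2)[of n], of "x ^ n / fact n"] by (simp add: abs_mult)
  qed
  have PEg: "PE x ?M F = ennreal (\<Sum>n. x ^ n / fact n * h n)"
    if x: "0 \<le> x" and h: "\<And>n. 0 \<le> h n" "\<And>n. h n \<le> 1" and F: "\<And>n. (\<integral>\<^sup>+x. F n x \<partial>SQ ?M) = ennreal (h n)" for x h F
  proof -
    have "PE x ?M F = (\<Sum>n. ennreal (x ^ n / fact n * h n))"
      unfolding PE_def F using x h by (intro suminf_cong) (simp add: ennreal_mult del: times_divide_eq_left)
    also have "\<dots> = ennreal (\<Sum>n. x ^ n / fact n * h n)"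
    proof (rule suminf_ennreal2)
      show "summable (\<lambda>n. x ^ n / fact n * h n)" by (rule summ) (use x h in \<open>auto simp: abs_le_iff intro: order_trans[of _ 0]\<close>)
      show "0 \<le> x ^ n / fact n * h n" for n using x h(1)[of n] by simp
    qed
    finally show ?thesis .
  qed
  have theta: "theta_t lam psi t = exp (- (lam * c)) * (\<Sum>n. (lam * c) ^ n / fact n * g n)" if "0 < lam" for lam
  proof -
    have "0 \<le> (\<Sum>n. (lam * c) ^ n / fact n * g n)"
      using that c g by (intro suminf_nonneg summ) auto
    moreover have "ennreal (theta_t lam psi t) = ennreal (exp (- (lam * c))) * ennreal (\<Sum>n. (lam * c) ^ n / fact n * g n)"
      unfolding theta_t_window[OF that t N, folded c_def] by (subst PEg[of _ g]) (use that c g in auto)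
    ultimately show ?thesis by (simp add: ennreal_mult[symmetric] theta_t_def)
  qed
  have "(lam1 * c) * (1 - exp (- (lam1 * c)) * (\<Sum>n. (lam1 * c) ^ n / fact n * g n)) \<le>
    (lam0 * c) * (1 - exp (- (lam0 * c)) * (\<Sum>n. (lam0 * c) ^ n / fact n * g n))"
  \<comment> \<open>The variable of the series is the mean number of points x = lam * c with
    \<open>c\<close> the number of cubes, so intermediate values of x are intermediate intensities.
    The common factor \<open>c\<close> is cancelled at the end.\<close>
  proof (rule exp_series_decr)
    show "\<bar>g n\<bar> \<le> 1" for n using g[of n] by simp
    show "lam0 * c \<le> lam1 * c" using lam c by simp
    fix x assume x: "lam0 * c \<le> x" "x \<le> lam1 * c"
    define lam where "lam = x / c"
    have lamx: "lam0 \<le> lam" "lam \<le> lam1" "x = lam * c" using x c by (auto simp: lam_def field_simps)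
    have x0: "0 < x" using lam c x(1) by (meson mult_pos_pos less_le_trans)
    interpret W: window psi ?M x by (rule window_muS[OF finite_KN]) (use x0 in auto)
    have Tm: "?T \<in> sets borel" by simp
    have "PE x ?M (\<lambda>n z. ennreal (1 - cG ?T {..<n} z)) \<le> ennreal x * PE x ?M (\<lambda>n z. \<integral>\<^sup>+y. W.piv ?T n y z \<partial>?M)"
    proof (rule W.PE_piv_ge[OF Tm])
      fix k z
      let ?f = "fG ?T {..<k} z"
      have box: "b \<in> box_t t" if "?f b \<noteq> 0" for b using that by (auto simp: fG_def indicator_def split: if_splits)
      then have supp: "\<bar>b $ j\<bar> \<le> t / 2" if "?f b \<noteq> 0" for b j using that by (auto simp: box_t_def)
      have "bounded {b. ?f b \<noteq> 0}"
      proof (rule boundedI)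
        fix b assume "b \<in> {b. ?f b \<noteq> 0}"
        then have "(\<Sum>j\<in>UNIV. \<bar>b $ j\<bar>) \<le> (\<Sum>j\<in>(UNIV :: 'd set). t / 2)"
          using supp by (intro sum_mono) auto
        then show "norm b \<le> (\<Sum>j\<in>(UNIV :: 'd set). t / 2)" using norm_le_l1_cart[of b] by linarith
      qed
      then have "?f \<in> thinning_fns" using measurable_fG_const[OF Tm, of "{..<k}" z] by (simp add: thinning_fns_def)
      then have "1 \<le> phi lam psi ?f" by (rule phi[OF lamx(1,2)])
      also have "phi lam psi ?f = ennreal x * (ennreal (exp (- (x * (\<integral>b. ?f b \<partial>?M)))) * (\<integral>\<^sup>+y. ennreal (1 - ?f y) * W.tau ?f y \<partial>?M))"
        unfolding lamx(3) c_def
        by (rule phi_window[where R="t / 2"]) (use lam lamx t N supp measurable_fG_const[OF Tm] in auto)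
      \<comment> \<open>Multiplying 1 <= phi by the inverse of the normalisation in
        \<open>phi_window\<close> gives the hypothesis of \<open>PE_piv_ge\<close>.\<close>
      finally have "ennreal (exp (x * (\<integral>b. ?f b \<partial>?M))) * 1 \<le> ennreal (exp (x * (\<integral>b. ?f b \<partial>?M))) *
          (ennreal x * (ennreal (exp (- (x * (\<integral>b. ?f b \<partial>?M)))) * (\<integral>\<^sup>+y. ennreal (1 - ?f y) * W.tau ?f y \<partial>?M)))"
        by (rule mult_left_mono) simp
      also have "\<dots> = (ennreal (exp (x * (\<integral>b. ?f b \<partial>?M))) * ennreal (exp (- (x * (\<integral>b. ?f b \<partial>?M))))) *
          (ennreal x * (\<integral>\<^sup>+y. ennreal (1 - ?f y) * W.tau ?f y \<partial>?M))"
        by (simp only: mult_ac)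
      also have "ennreal (exp (x * (\<integral>b. ?f b \<partial>?M))) * ennreal (exp (- (x * (\<integral>b. ?f b \<partial>?M)))) = 1"
        by (simp add: ennreal_mult[symmetric] exp_add[symmetric])
      finally show "ennreal (exp (x * (\<integral>b. ?f b \<partial>?M))) \<le> ennreal x * (\<integral>\<^sup>+y. ennreal (1 - ?f y) * W.tau ?f y \<partial>?M)"
        by simp
    qed
    also have "PE x ?M (\<lambda>n z. ennreal (1 - cG ?T {..<n} z)) = ennreal (\<Sum>n. x ^ n / fact n * (1 - g n))"
      by (rule PEg) (use x0 g g' in auto)
    also have "PE x ?M (\<lambda>n z. \<integral>\<^sup>+y. W.piv ?T n y z \<partial>?M) \<le> ennreal (\<Sum>n. x ^ n / fact n * (g (Suc n) - g n))"
    proof -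
      have inc: "ennreal (g n) + (\<integral>\<^sup>+z. \<integral>\<^sup>+y. W.piv ?T n y z \<partial>?M \<partial>SQ ?M) \<le> ennreal (g (Suc n))" for n
        using W.cG_increment[OF Tm, of n] unfolding g(1) .
      have mono: "g n \<le> g (Suc n)" for n
        using order_trans[OF _ inc[of n], of "ennreal (g n)"] g[of "Suc n"] by simp
      have P: "(\<integral>\<^sup>+z. \<integral>\<^sup>+y. W.piv ?T n y z \<partial>?M \<partial>SQ ?M) \<le> ennreal (g (Suc n) - g n)" for n
      proof -
        have "ennreal (g n) + (\<integral>\<^sup>+z. \<integral>\<^sup>+y. W.piv ?T n y z \<partial>?M \<partial>SQ ?M) \<le> ennreal (g n) + ennreal (g (Suc n) - g n)"
          using inc[of n] mono[of n] g[of n] by (simp add: ennreal_plus[symmetric] del: ennreal_plus)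
        then show ?thesis by (simp add: ennreal_add_left_cancel_le)
      qed
      have "PE x ?M (\<lambda>n z. \<integral>\<^sup>+y. W.piv ?T n y z \<partial>?M) \<le> (\<Sum>n. ennreal (x ^ n / fact n * (g (Suc n) - g n)))"
        unfolding PE_def
      proof (rule suminf_le)
        show "ennreal (x ^ n / fact n) * (\<integral>\<^sup>+z. \<integral>\<^sup>+y. W.piv ?T n y z \<partial>?M \<partial>SQ ?M) \<le> ennreal (x ^ n / fact n * (g (Suc n) - g n))" for n
          using mult_left_mono[OF P[of n], of "ennreal (x ^ n / fact n)"] x0 mono[of n]
          by (subst ennreal_mult) auto
      qed auto
      also have "\<dots> = ennreal (\<Sum>n. x ^ n / fact n * (g (Suc n) - g n))"
      proof (rule suminf_ennreal2)
        show "summable (\<lambda>n. x ^ n / fact n * (g (Suc n) - g n))"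
        proof (rule summ)
          show "\<bar>g (Suc n) - g n\<bar> \<le> 1" for n using g[of n] g[of "Suc n"] by auto
        qed (use x0 in simp)
        show "0 \<le> x ^ n / fact n * (g (Suc n) - g n)" for n using x0 mono[of n] by simp
      qed
      finally show ?thesis .
    qed
    finally have "ennreal (\<Sum>n. x ^ n / fact n * (1 - g n)) \<le> ennreal x * ennreal (\<Sum>n. x ^ n / fact n * (g (Suc n) - g n))"
      by (simp add: mult_left_mono)
    moreover have mono: "g n \<le> g (Suc n)" for n
      using order_trans[OF _ W.cG_increment[OF Tm, of n, unfolded g(1)], of "ennreal (g n)"] g[of "Suc n"] by simp
    have "0 \<le> (\<Sum>n. x ^ n / fact n * (g (Suc n) - g n))"
    proof (rule suminf_nonneg)
      show "summable (\<lambda>n. x ^ n / fact n * (g (Suc n) - g n))"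
      proof (rule summ)
        show "\<bar>g (Suc n) - g n\<bar> \<le> 1" for n using g[of n] g[of "Suc n"] by auto
      qed (use x0 in simp)
      show "0 \<le> x ^ n / fact n * (g (Suc n) - g n)" for n using x0 mono[of n] by simp
    qed
    ultimately show "(\<Sum>n. x ^ n / fact n * (1 - g n)) \<le> x * (\<Sum>n. x ^ n / fact n * (g (Suc n) - g n))"
      using x0 by (simp add: ennreal_mult[symmetric])
  qed
  then have "c * (lam1 * (1 - theta_t lam1 psi t)) \<le> c * (lam0 * (1 - theta_t lam0 psi t))"
    using lam by (simp add: theta mult_ac)
  then show ?thesis using c by simp
qed

section \<open>The limit \<open>theta\<close> and the two thresholds\<close>

lemma theta_t_antimono: "t \<le> t' \<Longrightarrow> theta_t lam psi t' \<le> theta_t lam psi t"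
proof -
  assume "t \<le> t'"
  then have box: "box_t t \<subseteq> (box_t t' :: (real^'d) set)" by (auto simp: box_t_def intro: order_trans)
  interpret R: prob_space "RCM_space lam :: 'd sample measure" by (rule prob_space_RCM)
  show ?thesis
    unfolding theta_t_def using pred_theta[OF psi_meas, where lam=lam and t=t, unfolded pred_def] box
    by (intro R.finite_measure_mono) auto
qed

lemma theta_t_nonneg: "0 \<le> theta_t lam psi t"
  by (simp add: theta_t_def)

text \<open>As a nonincreasing function bounded below, \<open>theta_t\<close> converges to its
  infimum, so the \<open>Lim\<close> in the definition of \<open>theta\<close> is a genuine
  limit.\<close>

lemma theta_tendsto: "((\<lambda>t. theta_t lam psi t) \<longlongrightarrow> theta lam psi) at_top"
proof -
  define l where "l = (INF t. theta_t lam psi t)"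
  have bdd: "bdd_below (range (\<lambda>t. theta_t lam psi t))" by (rule bdd_belowI[of _ 0]) (auto simp: theta_t_nonneg)
  have "((\<lambda>t. theta_t lam psi t) \<longlongrightarrow> l) at_top"
  proof (rule order_tendstoI)
    fix b assume "b < l"
    moreover have "l \<le> theta_t lam psi t" for t unfolding l_def using bdd by (rule cINF_lower) simp
    ultimately show "eventually (\<lambda>t. b < theta_t lam psi t) at_top" by (auto intro: less_le_trans always_eventually)
  next
    fix b assume "l < b"
    then obtain t0 where "theta_t lam psi t0 < b" unfolding l_def using cINF_less_iff[OF _ bdd] by auto
    then show "eventually (\<lambda>t. theta_t lam psi t < b) at_top"
      by (intro eventually_mono[OF eventually_ge_at_top[of t0]]) (blast intro: theta_t_antimono le_less_trans)
  qed
  then show ?thesis unfolding theta_def by (simp add: tendsto_Lim)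
qed

lemma theta_le_theta_t: "theta lam psi \<le> theta_t lam psi t"
  by (rule tendsto_upperbound[OF theta_tendsto])
     (auto intro: eventually_mono[OF eventually_ge_at_top[of t]] theta_t_antimono)

lemma theta_lower:
  assumes "\<And>t. 0 \<le> t \<Longrightarrow> b \<le> theta_t lam psi t"
  shows "b \<le> theta lam psi"
  by (rule tendsto_lowerbound[OF theta_tendsto])
     (auto intro: eventually_mono[OF eventually_ge_at_top[of 0]] assms)

text \<open>Thinning by 0 removes all points, and only the direct edge from the origin to
  \<open>y\<close> remains. So \<open>phi\<close> is at most \<open>lam\<close> times the volume of
  the unit ball, which is below 1 for small \<open>lam\<close>. Hence the supremum defining the
  threshold is over a nonempty set and positive.\<close>

lemma phi_zero_lt_1: "\<exists>lam>0. phi lam psi (\<lambda>_. 0) < 1"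
proof -
  define V where "V = measure lborel (cball 0 1 :: (real^'d) set)"
  have V: "emeasure lborel (cball 0 1 :: (real^'d) set) = ennreal V" "0 \<le> V"
    using emeasure_lborel_cball_finite[of "0 :: real^'d" 1] by (auto simp: V_def emeasure_eq_ennreal_measure less_top)
  define lam where "lam = 1 / (V + 1)"
  have lam: "0 < lam" using V by (simp add: lam_def)
  define L where "L = lam * real (card (KN 1 :: (int^'d) set))"
  have win: "window psi (muS (KN 1)) L" by (rule window_muS[OF finite_KN]) (use lam in \<open>simp add: L_def\<close>)
  let ?m = "\<lambda>y. measure (RCM_space lam :: 'd sample measure)
        {\<omega> \<in> space (RCM_space lam). (adj psi y \<omega> ({Orig, Extra} \<union> thinned (\<lambda>_. 0) \<omega>))\<^sup>*\<^sup>* Orig Extra}"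
  interpret R: prob_space "RCM_space lam :: 'd sample measure" by (rule prob_space_RCM)
  have le: "ennreal ((1 - 0) * ?m y) \<le> indicator (cball 0 1) y" for y
  proof (cases "psi y = 0")
    case True
    have "ennreal (?m y) = ennreal (exp (- (L * (\<integral>b. 0 \<partial>muS (KN 1 :: (int^'d) set))))) * window.tau psi (muS (KN 1)) L (\<lambda>_. 0) y"
      unfolding L_def by (rule conn_window[OF lam, where f="\<lambda>_. 0"]) auto
    also have "\<dots> = 0" using tau_eq_0[OF win True, of "\<lambda>_. 0"] by simp
    finally show ?thesis by simp
  next
    case False
    then have "y \<in> cball 0 1" using psi_range[of y] by force
    then show ?thesis using R.prob_le_1 by (simp add: ennreal_1[symmetric] del: ennreal_1)
  qed
  have "phi lam psi (\<lambda>_. 0) \<le> ennreal lam * (\<integral>\<^sup>+y. indicator (cball 0 1 :: (real^'d) set) y \<partial>lborel)"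
    unfolding phi_def by (rule mult_left_mono, rule nn_integral_mono, rule le, simp)
  also have "\<dots> = ennreal (lam * V)" using V lam by (simp add: ennreal_mult)
  also have "\<dots> < 1"
    using V by (simp add: lam_def ennreal_1[symmetric] ennreal_less_iff del: ennreal_1)
  finally show ?thesis using lam by blast
qed

lemma zero_thinning: "(\<lambda>_. 0) \<in> thinning_fns"
  by (simp add: thinning_fns_def)

lemma tilde_pos: "0 < lambda_c_tilde psi"
proof -
  obtain lam where lam: "0 < lam" "phi lam psi (\<lambda>_. 0) < 1" using phi_zero_lt_1 by blast
  then have "ereal lam \<le> lambda_c_tilde psi"
    unfolding lambda_c_tilde_def using zero_thinning by (intro Sup_upper) blast
  then show ?thesis using lam(1) by (meson ereal_less(2) less_le_trans)
qed

text \<open>Beyond the threshold no thinning function has \<open>phi\<close> below 1, at any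
  intensity from \<open>lam0\<close> on. So \<open>theta_t_lower\<close> applies on the whole
  interval, and on its right-hand side \<open>1 - theta_t\<close> at \<open>lam0\<close> is bounded
  by 1.\<close>

lemma theta_above_tilde:
  assumes "0 < lam0" "lam0 \<le> lam" "lambda_c_tilde psi < ereal lam0"
  shows "lam - lam0 \<le> lam * theta lam psi"
proof -
  have "1 \<le> phi l psi f" if "lam0 \<le> l" "f \<in> thinning_fns" for l f
  proof (rule ccontr)
    assume "\<not> 1 \<le> phi l psi f"
    then have "ereal l \<le> lambda_c_tilde psi"
      unfolding lambda_c_tilde_def using that assms(1) by (intro Sup_upper) (auto simp: not_le intro: less_le_trans)
    moreover have "ereal lam0 \<le> ereal l" using that by simp
    ultimately show False using assms(3) by (meson le_less_trans not_less order_trans)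
  qed
  note phi = this
  have "1 - lam0 / lam \<le> theta_t lam psi t" if t: "0 \<le> t" for t
  proof -
    have "lam * (1 - theta_t lam psi t) \<le> lam0 * (1 - theta_t lam0 psi t)"
      by (rule theta_t_lower[OF assms(1,2) t]) (use phi in auto)
    also have "\<dots> \<le> lam0 * 1" using assms(1) theta_t_nonneg by (intro mult_left_mono) auto
    finally show ?thesis using assms(1,2) by (simp add: field_simps)
  qed
  then have "1 - lam0 / lam \<le> theta lam psi" by (rule theta_lower)
  then show ?thesis using assms(1,2) by (simp add: field_simps)
qed

lemma theta_eq_0_below:
  assumes "0 < lam" "lam \<le> lam'" "f \<in> thinning_fns" "phi lam' psi f < 1"
  shows "theta lam psi \<le> 0"
proof -
  obtain c where c: "0 < c" "\<And>t. 0 < t \<Longrightarrow> theta_t lam' psi t \<le> exp (- c * t)"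
    using theta_t_exp_decay[OF _ assms(3,4)] assms(1,2) by (meson less_le_trans)
  have "((\<lambda>t. exp (- c * t)) \<longlongrightarrow> 0) at_top"
    by (rule filterlim_compose[OF exp_at_bot], rule filterlim_tendsto_neg_mult_at_bot[OF tendsto_const _ filterlim_ident])
       (use c(1) in simp)
  moreover have "eventually (\<lambda>t. theta lam psi \<le> exp (- c * t)) at_top"
    using eventually_gt_at_top[of 0]
  proof eventually_elim
    case (elim t)
    have "theta lam psi \<le> theta_t lam psi t" by (rule theta_le_theta_t)
    also have "\<dots> \<le> theta_t lam' psi t" using assms elim by (intro theta_t_mono_lam) auto
    also have "\<dots> \<le> exp (- c * t)" by (rule c(2)[OF elim])
    finally show ?case .
  qed
  ultimately show ?thesis by (rule tendsto_lowerbound) simp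
qed

text \<open>Exponential decay forces \<open>theta\<close> to vanish up to any intensity admitting a
  good thinning function, which gives one inequality. If the other failed, two intensities chosen
  strictly between the thresholds would give a positive \<open>theta\<close> below
  \<open>lambda_c\<close>.\<close>

lemma tilde_eq: "lambda_c_tilde psi = lambda_c psi"
proof (rule antisym)
  show "lambda_c_tilde psi \<le> lambda_c psi"
    unfolding lambda_c_tilde_def lambda_c_def
  proof (intro Sup_least Inf_greatest, clarify)
    fix lam lam' f assume h: "0 < lam'" "0 < theta lam' psi" "f \<in> thinning_fns" "phi lam psi f < 1"
    show "ereal lam \<le> ereal lam'"
    proof (rule ccontr)
      assume "\<not> ?thesis"
      then have "lam' \<le> lam" by simp
      from theta_eq_0_below[OF h(1) this h(3,4)] h(2) show False by simp
    qed
  qed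
  show "lambda_c psi \<le> lambda_c_tilde psi"
  proof (rule ccontr)
    assume "\<not> ?thesis"
    then obtain lam0 where lam0: "lambda_c_tilde psi < ereal lam0" "ereal lam0 < lambda_c psi"
      using ereal_dense2[of "lambda_c_tilde psi" "lambda_c psi"] by (auto simp: not_le)
    then obtain lam where lam: "ereal lam0 < ereal lam" "ereal lam < lambda_c psi"
      using ereal_dense2[of "ereal lam0" "lambda_c psi"] by auto
    have "0 < ereal lam0" using tilde_pos lam0(1) by (rule less_trans)
    then have pos: "0 < lam0" by simp
    have "lam - lam0 \<le> lam * theta lam psi" using theta_above_tilde[OF pos _ lam0(1)] lam(1) by simp
    then have "0 < lam * theta lam psi" using lam(1) by simp
    then have "0 < theta lam psi" using pos lam(1) by (simp add: zero_less_mult_iff)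
    then have "lambda_c psi \<le> ereal lam"
      unfolding lambda_c_def using pos lam(1) by (intro Inf_lower) auto
    with lam(2) show False by simp
  qed
qed

text \<open>A good thinning function is available at some intensity \<open>lam'\<close> above
  \<open>lam\<close>, not necessarily at \<open>lam\<close> itself; monotonicity in the intensity
  transfers the decay.\<close>

lemma subcritical:
  assumes "0 < lam" "ereal lam < lambda_c psi"
  shows "\<exists>c>0. \<forall>t>0. theta_t lam psi t \<le> exp (- c * t)"
proof -
  from assms(2) obtain lam' f where h: "lam < lam'" "f \<in> thinning_fns" "phi lam' psi f < 1"
    unfolding tilde_eq[symmetric] lambda_c_tilde_def less_Sup_iff by auto
  then obtain c where c: "0 < c" "\<And>t. 0 < t \<Longrightarrow> theta_t lam' psi t \<le> exp (- c * t)"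
    using theta_t_exp_decay[OF _ h(2,3)] assms(1) by (meson less_trans)
  have "theta_t lam psi t \<le> exp (- c * t)" if "0 < t" for t
    using order_trans[OF theta_t_mono_lam[OF assms(1), of lam' t] c(2)[OF that]] h(1) that by simp
  with c(1) show ?thesis by blast
qed

text \<open>\<open>theta_above_tilde\<close> needs a starting intensity strictly above the
  threshold; the bound at the threshold follows by letting that intensity decrease to it. The
  threshold is positive and lies below \<open>lam\<close>, hence is a real number.\<close>

lemma supercritical:
  assumes "0 < lam" "lambda_c psi < ereal lam"
  shows "(lam - real_of_ereal (lambda_c psi)) / lam \<le> theta lam psi"
proof -
  have pos: "0 < lambda_c psi" using tilde_pos by (simp add: tilde_eq)
  then obtain l where l: "lambda_c psi = ereal l" using assms(2) by (cases "lambda_c psi") auto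
  have l': "0 < l" "l < lam" using pos assms(2) l by auto
  have "lam - lam * theta lam psi \<le> l"
  proof (rule dense_ge_bounded[OF l'(2)])
    fix w assume "l < w" "w < lam"
    then show "lam - lam * theta lam psi \<le> w"
      using theta_above_tilde[of w lam] l l' by (simp add: tilde_eq)
  qed
  then show ?thesis using assms(1) l by (simp add: field_simps)
qed

end

theorem mainTheorem2:
  fixes psi :: "real ^ ('d::finite) \<Rightarrow> real"
  assumes "psi \<in> borel_measurable lborel"
    and "\<And>x. 0 \<le> psi x \<and> psi x \<le> 1"
    and "\<And>x. psi (- x) = psi x"
    and "\<And>x. norm x > 1 \<Longrightarrow> psi x = 0"
  shows "lambda_c_tilde psi = lambda_c psi
    \<and> (\<forall>lam > 0. ereal lam < lambda_c psi \<longrightarrow>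
          (\<exists>c > 0. \<forall>t > 0. theta_t lam psi t \<le> exp (- c * t)))
    \<and> (\<forall>lam > 0. lambda_c psi < ereal lam \<longrightarrow>
          theta lam psi \<ge> (lam - real_of_ereal (lambda_c psi)) / lam)"
proof -
  interpret rcm psi
    using assms by unfold_locales auto
  show ?thesis using tilde_eq subcritical supercritical by blast
qed

end
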